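(* Let $Q$ be a paracompact smooth finite-dimensional manifold, let $[a,b]\subset\mathbb{R}$, let $q_1,q_2\in Q$, and let $W_1,\dots,W_m$ be independent Wiener processes on $[a,b]$, adapted to a nondecreasing family $(\mathcal{F}_t)_{t\in[a,b]}$ of sub-$\sigma$-algebras on a probability space $(\Omega,\mathcal{F},P)$. Let $\mathcal{L}:TQ\to\mathbb{R}$ be a Lagrangian of class $C^2$ with respect to $q$ and $v$ and with globally Lipschitz first derivatives with respect to $q$ and $v$. Let $\gamma_i:Q\to\mathbb{R}$, $i=1,\dots,m$, be of class $C^2$ with globally Lipschitz first derivatives. Let $\mathcal{C}([a,b],q_1,q_2)$ be the path space and $\mathfrak{G}:\Omega\times\mathcal{C}([a,b],q_1,q_2)\to\mathbb{R}$ the stochastic Hamilton-Pontryagin action $$\mathfrak{G}(\omega,q,v,p)=\int_a^b\Big[\mathcal{L}(q,v)\,dt+\sum_{i=1}^m\gamma_i(q)\circ dW_i(t,\omega)+\Big\langle p,\frac{dq}{dt}-v\Big\rangle dt\Big].$$ Then almost surely the following holds: a curve $c=(q,v,p)\in\mathcal{C}([a,b],q_1,q_2)$ (which may depend on $\omega$) satisfies the stochastic Hamilton-Pontryagin equations $$dq=v\,dt,\qquad dp=\frac{\partial\mathcal{L}}{\partial q}(q,v)\,dt+\sum_{i=1}^m\frac{\partial\gamma_i}{\partial q}(q)\circ dW_i,\qquad p=\frac{\partial\mathcal{L}}{\partial v}(q,v)$$ on $[a,b]$ if and only if it is a critical point of $\mathfrak{G}$, that is, $\mathbf{d}\mathf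rak{G}(\omega,c(\omega))=0$.
   Context: The Pontryagin bundle $TQ\oplus T^*Q$ is the Whitney sum, a vector bundle over $Q$ with fiber $T_qQ\oplus T_q^*Q$ at $q$; $(q,v,p)$ denotes a point of it with $v\in T_qQ$, $p\in T_q^*Q$. The path space is $$\mathcal{C}([a,b],q_1,q_2)=\{(q,v,p)\in C^0([a,b],TQ\oplus T^*Q)\;:\;q\in C^1([a,b],Q),\ q(a)=q_1,\ q(b)=q_2\}.$$ Its tangent space at $c=(q,v,p)$ consists of maps $(q,v,p,\delta q,\delta v,\delta p)\in C^0([a,b],T(TQ\oplus T^*Q))$ with $q,\delta q$ of class $C^1$ and $\delta q(a)=\delta q(b)=0$. The differential $\mathbf{d}\mathfrak{G}(\omega,c)$ is taken with respect to the curve only, with $\omega$ fixed: for a one-parameter family $(q,v,p)(\cdot,\epsilon)$ of curves in $\mathcal{C}([a,b],q_1,q_2)$, differentiable in $\epsilon$, equal to $c$ at $\epsilon=0$ and with $\epsilon$-derivative $(\delta q,\delta v,\delta p)$ at $\epsilon=0$, $$\mathbf{d}\mathfrak{G}(\omega,c)\cdot(\delta q,\delta v,\delta p):=\frac{\partial}{\partial\epsilon}\mathfrak{G}(\omega,q(\cdot,\epsilon),v(\cdot,\epsilon),p(\cdot,\epsilon))\Big|_{\epsilon=0}.$$ $c$ is a critical point if this vanishes for all tangent vectors at $c$. $\circ\,dW_i$ denotes the Stratonovich integral. Since $q$ is $C^1$ in $t$ and $\gamma_i$ is $C^2$, the integrands $\gamma_i(q(t))$ and (in local coordinates) $\frac{\partial\gamma_i}{\partial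 q}(q(t))$ are $C^1$ in $t$, so these integrals can be read path by path as Riemann-Stieltjes integrals against $t\mapsto W_i(t,\omega)$. The equation for $dp$ is understood in integrated form in local coordinates: whenever $q([s,t])$ lies in a coordinate chart of $Q$, for each $j$, $$p_j(t)-p_j(s)=\int_s^t\frac{\partial\mathcal{L}}{\partial q^j}(q,v)\,dr+\sum_{i=1}^m\int_s^t\frac{\partial\gamma_i}{\partial q^j}(q)\circ dW_i.$$ *)

theory Defs
  imports "HOL-Probability.Probability"
begin

section \<open>Smooth manifolds\<close>

primrec Ck_on :: "nat \<Rightarrow> 'a::euclidean_space set \<Rightarrow> ('a \<Rightarrow> 'b::real_normed_vector) \<Rightarrow> bool" where
  "Ck_on 0 S f \<longleftrightarrow> continuous_on S f"
| "Ck_on (Suc k) S f \<longleftrightarrow> (\<forall>x\<in>S. f differentiable (at x)) \<and>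
     (\<forall>v. Ck_on k S (\<lambda>x. frechet_derivative f (at x) v))"

definition paracompact_space :: "'a topology \<Rightarrow> bool" where
  "paracompact_space X \<longleftrightarrow>
     (\<forall>\<U>. (\<forall>U\<in>\<U>. openin X U) \<and> \<Union>\<U> = topspace X \<longrightarrow>
       (\<exists>\<V>. (\<forall>V\<in>\<V>. openin X V) \<and> \<Union>\<V> = topspace X \<and>
             (\<forall>V\<in>\<V>. \<exists>U\<in>\<U>. V \<subseteq> U) \<and> locally_finite_in X \<V>))"

text \<open>A chart is a pair of its domain and its coordinate map; only the values of the coordinate
  map on the domain matter.\<close>

type_synonym ('q, 'e) chart = "'q set \<times> ('q \<Rightarrow> 'e)"

definition chart_inv :: "('q, 'e) chart \<Rightarrow> 'e \<Rightarrow> 'q" where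
  "chart_inv c = inv_into (fst c) (snd c)"

definition transition :: "('q, 'e) chart \<Rightarrow> ('q, 'e) chart \<Rightarrow> 'e \<Rightarrow> 'e" where
  "transition c d x = snd d (chart_inv c x)"

definition smooth_atlas :: "('q::topological_space, 'e::euclidean_space) chart set \<Rightarrow> bool" where
  "smooth_atlas A \<longleftrightarrow>
     (\<forall>c\<in>A. open (fst c) \<and> open (snd c ` fst c) \<and>
        homeomorphism (fst c) (snd c ` fst c) (snd c) (chart_inv c)) \<and>
     (\<Union>c\<in>A. fst c) = UNIV \<and>
     (\<forall>c\<in>A. \<forall>d\<in>A. \<forall>k. Ck_on k (snd c ` (fst c \<inter> fst d)) (transition c d))"

text \<open>The atlas need not be maximal. Hausdorffness is imposed through the type class.\<close>

definition paracompact_smooth_manifold :: "('q::t2_space, 'e::euclidean_space) chart set \<Rightarrow> bool" where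
  "paracompact_smooth_manifold A \<longleftrightarrow>
     smooth_atlas A \<and> paracompact_space (euclidean :: 'q topology)"

definition charts_at :: "('q, 'e) chart set \<Rightarrow> 'q \<Rightarrow> ('q, 'e) chart set" where
  "charts_at A q = {c\<in>A. q \<in> fst c}"

definition C2_function :: "('q, 'e::euclidean_space) chart set \<Rightarrow> ('q \<Rightarrow> real) \<Rightarrow> bool" where
  "C2_function A g \<longleftrightarrow> (\<forall>c\<in>A. Ck_on 2 (snd c ` fst c) (g \<circ> chart_inv c))"


section \<open>Tangent bundle, cotangent bundle, Pontryagin bundle\<close>

text \<open>A tangent (cotangent) vector at a point is given by its coordinate vectors in all charts
  around that point, subject to the contravariant (covariant) transformation law. Components of
  covectors are taken with respect to the dual basis, so that in each chart the duality pairing is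
  the Euclidean inner product of the coordinate vectors. The value at charts that do not contain
  the base point is fixed to be 0, so that equality of vectors is equality of functions.\<close>

type_synonym ('q, 'e) fibre = "('q, 'e) chart \<Rightarrow> 'e"

definition tangent_space :: "('q, 'e::euclidean_space) chart set \<Rightarrow> 'q \<Rightarrow> ('q, 'e) fibre set" where
  "tangent_space A q =
     {v. (\<forall>c\<in>charts_at A q. \<forall>d\<in>charts_at A q.
            v d = frechet_derivative (transition c d) (at (snd c q)) (v c)) \<and>
         (\<forall>c. c \<notin> charts_at A q \<longrightarrow> v c = 0)}"

definition cotangent_space :: "('q, 'e::euclidean_space) chart set \<Rightarrow> 'q \<Rightarrow> ('q, 'e) fibre set" where
  "cotangent_space A q =
     {p. (\<forall>c\<in>charts_at A q. \<forall>d\<in>charts_at A q. \<forall>u.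
            p c \<bullet> u = p d \<bullet> frechet_derivative (transition c d) (at (snd c q)) u) \<and>
         (\<forall>c. c \<notin> charts_at A q \<longrightarrow> p c = 0)}"

text \<open>Both arguments transform so that the choice of the chart is immaterial.\<close>

definition pairing ::
  "('q, 'e::euclidean_space) chart set \<Rightarrow> 'q \<Rightarrow> ('q, 'e) fibre \<Rightarrow> ('q, 'e) fibre \<Rightarrow> real" where
  "pairing A q p w = (let c = (SOME c. c \<in> charts_at A q) in p c \<bullet> w c)"

definition tangent_of_coords ::
  "('q, 'e::euclidean_space) chart set \<Rightarrow> ('q, 'e) chart \<Rightarrow> 'q \<Rightarrow> 'e \<Rightarrow> ('q, 'e) fibre" where
  "tangent_of_coords A c q u =
     (\<lambda>d. if d \<in> charts_at A q then frechet_derivative (transition c d) (at (snd c q)) u else 0)"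

text \<open>Change of coordinates on the Pontryagin bundle induced by a change of charts on the base.\<close>

definition pontryagin_transition ::
  "('q, 'e::euclidean_space) chart \<Rightarrow> ('q, 'e) chart \<Rightarrow> 'e \<times> 'e \<times> 'e \<Rightarrow> 'e \<times> 'e \<times> 'e" where
  "pontryagin_transition c d = (\<lambda>(x, u, \<pi>).
     (transition c d x,
      frechet_derivative (transition c d) (at x) u,
      adjoint (frechet_derivative (transition d c) (at (transition c d x))) \<pi>))"

text \<open>The tangent space of the Pontryagin bundle at (q, v, p), again through coordinate vectors.\<close>

definition pontryagin_tangent_space ::
  "('q, 'e::euclidean_space) chart set \<Rightarrow> 'q \<Rightarrow> ('q, 'e) fibre \<Rightarrow> ('q, 'e) fibre \<Rightarrow>
     (('q, 'e) fibre \<times> ('q, 'e) fibre \<times> ('q, 'e) fibre) set" where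
  "pontryagin_tangent_space A q v p =
     {(\<delta>q, \<delta>v, \<delta>p).
        (\<forall>c\<in>charts_at A q. \<forall>d\<in>charts_at A q.
           (\<delta>q d, \<delta>v d, \<delta>p d) =
           frechet_derivative (pontryagin_transition c d) (at (snd c q, v c, p c))
             (\<delta>q c, \<delta>v c, \<delta>p c)) \<and>
        (\<forall>c. c \<notin> charts_at A q \<longrightarrow> \<delta>q c = 0 \<and> \<delta>v c = 0 \<and> \<delta>p c = 0)}"


section \<open>Lagrangians\<close>

text \<open>Coordinate expression of a function on the tangent bundle.\<close>

definition local_lagrangian ::
  "('q, 'e::euclidean_space) chart set \<Rightarrow> ('q \<times> ('q, 'e) fibre \<Rightarrow> real) \<Rightarrow> ('q, 'e) chart \<Rightarrow>
     'e \<times> 'e \<Rightarrow> real" where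
  "local_lagrangian A L c =
     (\<lambda>(x, u). L (chart_inv c x, tangent_of_coords A c (chart_inv c x) u))"

definition C2_lagrangian ::
  "('q, 'e::euclidean_space) chart set \<Rightarrow> ('q \<times> ('q, 'e) fibre \<Rightarrow> real) \<Rightarrow> bool" where
  "C2_lagrangian A L \<longleftrightarrow> (\<forall>c\<in>A. Ck_on 2 ((snd c ` fst c) \<times> UNIV) (local_lagrangian A L c))"

text \<open>On a bare manifold, Lipschitz continuity of partial derivatives only makes sense relative to
  a choice of coordinates. It is taken relative to a reference atlas \<open>R\<close>, with one Lipschitz
  constant for all charts of \<open>R\<close>; for Euclidean space with the identity as its only reference
  chart this is the usual notion. For a Lagrangian, \<open>Basis\<close> of the product type yields both the
  derivatives in q and those in v.\<close>

definition lipschitz_partials ::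
  "real \<Rightarrow> 'a::euclidean_space set \<Rightarrow> ('a \<Rightarrow> real) \<Rightarrow> bool" where
  "lipschitz_partials K S f \<longleftrightarrow>
     (\<forall>b\<in>Basis. K-lipschitz_on S (\<lambda>x. frechet_derivative f (at x) b))"

definition globally_lipschitz_derivs ::
  "('q, 'e::euclidean_space) chart set \<Rightarrow> ('q \<Rightarrow> real) \<Rightarrow> bool" where
  "globally_lipschitz_derivs R g \<longleftrightarrow>
     (\<exists>K. \<forall>c\<in>R. lipschitz_partials K (snd c ` fst c) (g \<circ> chart_inv c))"

definition globally_lipschitz_derivs_lagrangian ::
  "('q, 'e::euclidean_space) chart set \<Rightarrow> ('q, 'e) chart set \<Rightarrow>
     ('q \<times> ('q, 'e) fibre \<Rightarrow> real) \<Rightarrow> bool" where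
  "globally_lipschitz_derivs_lagrangian A R L \<longleftrightarrow>
     (\<exists>K. \<forall>c\<in>R. lipschitz_partials K ((snd c ` fst c) \<times> UNIV) (local_lagrangian A L c))"

text \<open>The covector dL/dv at (q, v).\<close>

definition fibre_derivative ::
  "('q, 'e::euclidean_space) chart set \<Rightarrow> ('q \<times> ('q, 'e) fibre \<Rightarrow> real) \<Rightarrow> 'q \<Rightarrow>
     ('q, 'e) fibre \<Rightarrow> ('q, 'e) fibre" where
  "fibre_derivative A L q v =
     (\<lambda>c. if c \<in> charts_at A q
          then \<Sum>b\<in>Basis. frechet_derivative (local_lagrangian A L c) (at (snd c q, v c)) (0, b) *\<^sub>R b
          else 0)"


section \<open>The path space\<close>

text \<open>Regularity on [a,b] of an object along a curve \<open>q\<close> whose coordinate expression in the chart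
  \<open>c\<close> at time \<open>t\<close> is \<open>f t c\<close>. For vectors along \<open>q\<close> this is regularity with respect to the
  vector bundle topology, since coordinate trivialisations are homeomorphisms.\<close>

definition C0_along ::
  "('q, 'e) chart set \<Rightarrow> real \<Rightarrow> real \<Rightarrow> (real \<Rightarrow> 'q) \<Rightarrow>
     (real \<Rightarrow> ('q, 'e::euclidean_space) chart \<Rightarrow> 'e) \<Rightarrow> bool" where
  "C0_along A a b q f \<longleftrightarrow>
     (\<forall>c\<in>A. continuous_on {t\<in>{a..b}. q t \<in> fst c} (\<lambda>t. f t c))"

definition C1_along ::
  "('q, 'e) chart set \<Rightarrow> real \<Rightarrow> real \<Rightarrow> (real \<Rightarrow> 'q) \<Rightarrow>
     (real \<Rightarrow> ('q, 'e::euclidean_space) chart \<Rightarrow> 'e) \<Rightarrow> bool" where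
  "C1_along A a b q f \<longleftrightarrow>
     (\<forall>c\<in>A. (\<forall>t\<in>{t\<in>{a..b}. q t \<in> fst c}. (\<lambda>t. f t c) differentiable (at t within {a..b})) \<and>
            continuous_on {t\<in>{a..b}. q t \<in> fst c}
              (\<lambda>t. vector_derivative (\<lambda>t. f t c) (at t within {a..b})))"

definition C1_curve ::
  "('q::topological_space, 'e::euclidean_space) chart set \<Rightarrow> real \<Rightarrow> real \<Rightarrow> (real \<Rightarrow> 'q) \<Rightarrow> bool" where
  "C1_curve A a b q \<longleftrightarrow> continuous_on {a..b} q \<and> C1_along A a b q (\<lambda>t c. snd c (q t))"

definition velocity ::
  "('q, 'e::euclidean_space) chart set \<Rightarrow> real \<Rightarrow> real \<Rightarrow> (real \<Rightarrow> 'q) \<Rightarrow> real \<Rightarrow> ('q, 'e) fibre" where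
  "velocity A a b q t =
     (\<lambda>c. if c \<in> charts_at A (q t)
          then vector_derivative (\<lambda>t. snd c (q t)) (at t within {a..b}) else 0)"

type_synonym ('q, 'e) path =
  "(real \<Rightarrow> 'q) \<times> (real \<Rightarrow> ('q, 'e) fibre) \<times> (real \<Rightarrow> ('q, 'e) fibre)"

type_synonym ('q, 'e) path_variation =
  "(real \<Rightarrow> ('q, 'e) fibre) \<times> (real \<Rightarrow> ('q, 'e) fibre) \<times> (real \<Rightarrow> ('q, 'e) fibre)"

definition path_space ::
  "('q::topological_space, 'e::euclidean_space) chart set \<Rightarrow> real \<Rightarrow> real \<Rightarrow> 'q \<Rightarrow> 'q \<Rightarrow>
     ('q, 'e) path set" where
  "path_space A a b q1 q2 =
     {(q, v, p). C1_curve A a b q \<and> q a = q1 \<and> q b = q2 \<and>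
        (\<forall>t\<in>{a..b}. v t \<in> tangent_space A (q t) \<and> p t \<in> cotangent_space A (q t)) \<and>
        C0_along A a b q v \<and> C0_along A a b q p}"

fun path_tangent_space ::
  "('q, 'e::euclidean_space) chart set \<Rightarrow> real \<Rightarrow> real \<Rightarrow> ('q, 'e) path \<Rightarrow>
     ('q, 'e) path_variation set" where
  "path_tangent_space A a b (q, v, p) =
     {(\<delta>q, \<delta>v, \<delta>p).
        (\<forall>t\<in>{a..b}. (\<delta>q t, \<delta>v t, \<delta>p t) \<in> pontryagin_tangent_space A (q t) (v t) (p t)) \<and>
        C1_along A a b q \<delta>q \<and> C0_along A a b q \<delta>v \<and> C0_along A a b q \<delta>p \<and>
        (\<forall>c. \<delta>q a c = 0 \<and> \<delta>q b c = 0)}"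

text \<open>Coordinate expression of a path, together with the time derivative of its base curve; the
  path space carries the $C^1$ topology in q and the $C^0$ topology in v and p.\<close>

fun path_coords ::
  "real \<Rightarrow> real \<Rightarrow> ('q, 'e::euclidean_space) chart \<Rightarrow> ('q, 'e) path \<Rightarrow> real \<Rightarrow> 'e \<times> 'e \<times> 'e \<times> 'e" where
  "path_coords a b c (q, v, p) r =
     (snd c (q r), vector_derivative (\<lambda>t. snd c (q t)) (at r within {a..b}), v r c, p r c)"

fun variation_coords ::
  "real \<Rightarrow> real \<Rightarrow> ('q, 'e::euclidean_space) chart \<Rightarrow> ('q, 'e) path_variation \<Rightarrow> real \<Rightarrow>
     'e \<times> 'e \<times> 'e \<times> 'e" where
  "variation_coords a b c (\<delta>q, \<delta>v, \<delta>p) r =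
     (\<delta>q r c, vector_derivative (\<lambda>t. \<delta>q t c) (at r within {a..b}), \<delta>v r c, \<delta>p r c)"

text \<open>The one-parameter family \<open>\<Gamma>\<close> of paths has derivative \<open>\<delta>\<close> at the parameter \<open>e\<close>, as a map into
  the path space.\<close>

definition has_path_derivative ::
  "('q, 'e::euclidean_space) chart set \<Rightarrow> real \<Rightarrow> real \<Rightarrow> (real \<Rightarrow> ('q, 'e) path) \<Rightarrow>
     ('q, 'e) path_variation \<Rightarrow> real \<Rightarrow> bool" where
  "has_path_derivative A a b \<Gamma> \<delta> e \<longleftrightarrow>
     (\<forall>c\<in>A. \<forall>s t. a \<le> s \<and> s \<le> t \<and> t \<le> b \<and> fst (\<Gamma> e) ` {s..t} \<subseteq> fst c \<longrightarrow>
        (\<forall>\<^sub>F h in at 0. fst (\<Gamma> (e + h)) ` {s..t} \<subseteq> fst c) \<and>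
        uniform_limit {s..t}
          (\<lambda>h r. (path_coords a b c (\<Gamma> (e + h)) r - path_coords a b c (\<Gamma> e) r) /\<^sub>R h)
          (variation_coords a b c \<delta>) (at 0))"

definition path_family ::
  "('q::topological_space, 'e::euclidean_space) chart set \<Rightarrow> real \<Rightarrow> real \<Rightarrow> 'q \<Rightarrow> 'q \<Rightarrow>
     ('q, 'e) path \<Rightarrow> ('q, 'e) path_variation \<Rightarrow> (real \<Rightarrow> ('q, 'e) path) \<Rightarrow> bool" where
  "path_family A a b q1 q2 c \<delta> \<Gamma> \<longleftrightarrow>
     (\<exists>\<eta>>0. \<forall>e. \<bar>e\<bar> < \<eta> \<longrightarrow> \<Gamma> e \<in> path_space A a b q1 q2 \<and>
        (\<exists>\<delta>'\<in>path_tangent_space A a b (\<Gamma> e). has_path_derivative A a b \<Gamma> \<delta>' e)) \<and>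
     \<Gamma> 0 = c \<and> has_path_derivative A a b \<Gamma> \<delta> 0"

text \<open>The differential of the functional \<open>G\<close> at \<open>c\<close> takes the value \<open>D\<close> on \<open>\<delta>\<close>.\<close>

definition has_path_differential ::
  "('q::topological_space, 'e::euclidean_space) chart set \<Rightarrow> real \<Rightarrow> real \<Rightarrow> 'q \<Rightarrow> 'q \<Rightarrow>
     (('q, 'e) path \<Rightarrow> real) \<Rightarrow> ('q, 'e) path \<Rightarrow> ('q, 'e) path_variation \<Rightarrow> real \<Rightarrow> bool" where
  "has_path_differential A a b q1 q2 G c \<delta> D \<longleftrightarrow>
     (\<forall>\<Gamma>. path_family A a b q1 q2 c \<delta> \<Gamma> \<longrightarrow>
        ((\<lambda>e. G (\<Gamma> e)) has_real_derivative D) (at 0))"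

definition critical_point ::
  "('q::topological_space, 'e::euclidean_space) chart set \<Rightarrow> real \<Rightarrow> real \<Rightarrow> 'q \<Rightarrow> 'q \<Rightarrow>
     (('q, 'e) path \<Rightarrow> real) \<Rightarrow> ('q, 'e) path \<Rightarrow> bool" where
  "critical_point A a b q1 q2 G c \<longleftrightarrow>
     (\<forall>\<delta>\<in>path_tangent_space A a b c. has_path_differential A a b q1 q2 G c \<delta> 0)"


section \<open>Wiener processes and pathwise Stratonovich integrals\<close>

definition wiener_process ::
  "'w measure \<Rightarrow> real \<Rightarrow> real \<Rightarrow> (real \<Rightarrow> 'w \<Rightarrow> real) \<Rightarrow> bool" where
  "wiener_process M a b W \<longleftrightarrow>
     (\<forall>t\<in>{a..b}. W t \<in> borel_measurable M) \<and>
     (AE \<omega> in M. W a \<omega> = 0) \<and>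
     (AE \<omega> in M. continuous_on {a..b} (\<lambda>t. W t \<omega>)) \<and>
     (\<forall>s t. a \<le> s \<and> s < t \<and> t \<le> b \<longrightarrow>
        distributed M lborel (\<lambda>\<omega>. W t \<omega> - W s \<omega>) (normal_density 0 (sqrt (t - s)))) \<and>
     (\<forall>(n::nat) \<tau>. (\<forall>k\<le>n. \<tau> k \<in> {a..b}) \<and> (\<forall>k<n. \<tau> k < \<tau> (Suc k)) \<longrightarrow>
        prob_space.indep_vars M (\<lambda>_. borel) (\<lambda>k \<omega>. W (\<tau> (Suc k)) \<omega> - W (\<tau> k) \<omega>) {..<n})"

text \<open>Independence of whole processes, as random elements of the product space over [a,b].\<close>

definition independent_processes ::
  "'w measure \<Rightarrow> real \<Rightarrow> real \<Rightarrow> (nat \<Rightarrow> real \<Rightarrow> 'w \<Rightarrow> real) \<Rightarrow> nat set \<Rightarrow> bool" where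
  "independent_processes M a b W I \<longleftrightarrow>
     prob_space.indep_vars M (\<lambda>_. PiM {a..b} (\<lambda>_. borel)) (\<lambda>i \<omega>. \<lambda>t\<in>{a..b}. W i t \<omega>) I"

definition filtration_on :: "'w measure \<Rightarrow> real \<Rightarrow> real \<Rightarrow> (real \<Rightarrow> 'w measure) \<Rightarrow> bool" where
  "filtration_on M a b F \<longleftrightarrow>
     (\<forall>t\<in>{a..b}. subalgebra M (F t)) \<and>
     (\<forall>s t. a \<le> s \<and> s \<le> t \<and> t \<le> b \<longrightarrow> sets (F s) \<subseteq> sets (F t))"

text \<open>Riemann-Stieltjes integral as limit of the sums over tagged partitions with mesh tending to 0;
  the integrator need not have bounded variation.\<close>

definition has_rs_integral :: "(real \<Rightarrow> real) \<Rightarrow> (real \<Rightarrow> real) \<Rightarrow> real \<Rightarrow> real \<Rightarrow> real \<Rightarrow> bool" where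
  "has_rs_integral f g s t I \<longleftrightarrow>
     (\<forall>\<epsilon>>0. \<exists>d>0. \<forall>\<D>. \<D> tagged_division_of {s..t} \<and> (\<lambda>x. ball x d) fine \<D> \<longrightarrow>
        \<bar>(\<Sum>(x, K)\<in>\<D>. f x * (g (Sup K) - g (Inf K))) - I\<bar> < \<epsilon>)"

definition rs_integral :: "real \<Rightarrow> real \<Rightarrow> (real \<Rightarrow> real) \<Rightarrow> (real \<Rightarrow> real) \<Rightarrow> real" where
  "rs_integral s t f g = (THE I. has_rs_integral f g s t I)"


section \<open>Action and equations, for a given realisation \<open>w\<close> of the noise\<close>

fun hp_action ::
  "('q, 'e::euclidean_space) chart set \<Rightarrow> real \<Rightarrow> real \<Rightarrow> ('q \<times> ('q, 'e) fibre \<Rightarrow> real) \<Rightarrow> nat \<Rightarrow>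
     (nat \<Rightarrow> 'q \<Rightarrow> real) \<Rightarrow> (nat \<Rightarrow> real \<Rightarrow> real) \<Rightarrow> ('q, 'e) path \<Rightarrow> real" where
  "hp_action A a b L m \<gamma> w (q, v, p) =
     integral {a..b} (\<lambda>t. L (q t, v t)) +
     (\<Sum>i=1..m. rs_integral a b (\<lambda>t. \<gamma> i (q t)) (w i)) +
     integral {a..b} (\<lambda>t. pairing A (q t) (p t) (\<lambda>c. velocity A a b q t c - v t c))"

fun hp_equations ::
  "('q, 'e::euclidean_space) chart set \<Rightarrow> real \<Rightarrow> real \<Rightarrow> ('q \<times> ('q, 'e) fibre \<Rightarrow> real) \<Rightarrow> nat \<Rightarrow>
     (nat \<Rightarrow> 'q \<Rightarrow> real) \<Rightarrow> (nat \<Rightarrow> real \<Rightarrow> real) \<Rightarrow> ('q, 'e) path \<Rightarrow> bool" where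
  "hp_equations A a b L m \<gamma> w (q, v, p) \<longleftrightarrow>
     (\<forall>t\<in>{a..b}. velocity A a b q t = v t) \<and>
     (\<forall>c\<in>A. \<forall>s t. a \<le> s \<and> s \<le> t \<and> t \<le> b \<and> q ` {s..t} \<subseteq> fst c \<longrightarrow>
        (\<forall>j\<in>Basis. p t c \<bullet> j - p s c \<bullet> j =
           integral {s..t}
             (\<lambda>r. frechet_derivative (local_lagrangian A L c) (at (snd c (q r), v r c)) (j, 0)) +
           (\<Sum>i=1..m. rs_integral s t
             (\<lambda>r. frechet_derivative (\<gamma> i \<circ> chart_inv c) (at (snd c (q r))) j) (w i)))) \<and>
     (\<forall>t\<in>{a..b}. p t = fibre_derivative A L (q t) (v t))"

end

theory Submission
  imports Defs
begin

text \<open>Only the continuity of the noise paths matters, so one argues path by path. Summation by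
  parts turns the Stratonovich term into \<open>[\<gamma>(q) w] - \<integral> w (\<gamma>(q))' dt\<close>, an ordinary integral that is
  differentiable for the $C^1$ topology on the base curves. In a chart the first variation over
  \<open>[s,t]\<close> becomes, after integrating by parts against
  \<open>E(r) = \<integral>\<^sub>s\<^sup>r \<partial>L/\<partial>q dt + \<integral>\<^sub>s\<^sup>r \<partial>\<gamma>/\<partial>q dw\<close>,
  \<open>E(t) \<delta>q(t) + \<integral> (p - E) \<delta>q' + \<integral> (\<partial>L/\<partial>v - p) \<delta>v + \<integral> (q' - v) \<delta>p\<close>.
  On solutions this is the increment of the chart-independent pairing of \<open>p\<close> with \<open>\<delta>q\<close>, so the pieces
  telescope to zero. Conversely, variations supported in a single chart and the lemma of du
  Bois-Reymond give the three equations.\<close>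

section \<open>Continuously differentiable maps\<close>

text \<open>Paths leave their charts, and the derivative of a family of paths is tested in every
  chart at once, together with the time derivative of the base curve. A computation in one chart
  therefore has to be portable to the others. This is why the coordinates of a path are quadruples
  (position, its time derivative, velocity variable, momentum): their change of charts is a C1 map
  between open sets of a vector space, and a chain rule for uniformly convergent difference
  quotients moves derivatives from chart to chart. The time derivative of a transformed variation
  contains a second derivative of the transition map with its two arguments interchanged, and
  symmetry of second derivatives reconciles it with the derivative of the quadruple map. The same
  symmetry turns the variation of the noise integrand into a total time derivative. The converse
  direction needs actual families of paths, differentiable at every parameter near 0, so the
  perturbations are built explicitly from coordinates.\<close>

text \<open>Continuity of the derivative is asked direction by direction, as in
  \<open>Ck_on\<close>; in finite dimension this amounts to continuity in operator norm. The
  derivative is an explicit argument so that the chain and product rules below yield closed formulas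
  for it.\<close>

definition C1_deriv_on ::
  "'a::euclidean_space set \<Rightarrow> ('a \<Rightarrow> 'b::real_normed_vector) \<Rightarrow> ('a \<Rightarrow> 'a \<Rightarrow> 'b) \<Rightarrow> bool" where
  "C1_deriv_on S f f' \<longleftrightarrow>
     (\<forall>x\<in>S. (f has_derivative f' x) (at x)) \<and> (\<forall>k. continuous_on S (\<lambda>x. f' x k))"

lemma C1_deriv_onD: "C1_deriv_on S f f' \<Longrightarrow> x \<in> S \<Longrightarrow> (f has_derivative f' x) (at x)"
  by (simp add: C1_deriv_on_def)

lemma C1_deriv_on_continuous:
  assumes "C1_deriv_on S f f'" shows "continuous_on S f"
  using assms unfolding C1_deriv_on_def
  by (meson continuous_at_imp_continuous_on has_derivative_continuous)

lemma C1_deriv_on_frechet: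
  assumes "C1_deriv_on S f f'" "x \<in> S" shows "frechet_derivative f (at x) = f' x"
  using C1_deriv_onD[OF assms] by (metis frechet_derivative_at)

lemma Ck_on_continuous: "Ck_on k S f \<Longrightarrow> continuous_on S f"
  by (cases k) (auto intro!: continuous_at_imp_continuous_on differentiable_imp_continuous_within)

lemma Ck_on_Suc_C1_deriv_on:
  assumes "Ck_on (Suc k) S f"
  shows "C1_deriv_on S f (\<lambda>x. frechet_derivative f (at x))"
  using assms unfolding C1_deriv_on_def
  by (auto simp: frechet_derivative_works[symmetric] intro: Ck_on_continuous)

text \<open>With one order left over, the derivative in each fixed direction \<open>v\<close> is
  again a C1 map. Second derivatives are handled as this family indexed by \<open>v\<close> rather
  than as bilinear maps.\<close>

lemma Ck_on_2D:
  assumes "Ck_on 2 S f"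
  shows "C1_deriv_on S f (\<lambda>x. frechet_derivative f (at x))"
    and "C1_deriv_on S (\<lambda>x. frechet_derivative f (at x) v)
           (\<lambda>x. frechet_derivative (\<lambda>x. frechet_derivative f (at x) v) (at x))"
  using assms unfolding numeral_2_eq_2
  by (auto intro!: Ck_on_Suc_C1_deriv_on simp del: Ck_on.simps(2))
     (simp only: Ck_on.simps(2), blast)

lemma linear_basis_expansion:
  fixes f :: "'a::euclidean_space \<Rightarrow> 'b::real_normed_vector"
  assumes "linear f" shows "f k = (\<Sum>b\<in>Basis. (k \<bullet> b) *\<^sub>R f b)"
proof -
  have "f k = f (\<Sum>b\<in>Basis. (k \<bullet> b) *\<^sub>R b)" by (simp add: euclidean_representation)
  also have "\<dots> = (\<Sum>b\<in>Basis. (k \<bullet> b) *\<^sub>R f b)"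
    using assms by (simp add: linear_sum linear_scale)
  finally show ?thesis .
qed

lemma C1_deriv_on_expansion:
  assumes "C1_deriv_on S f f'" "x \<in> S"
  shows "f' x k = (\<Sum>b\<in>Basis. (k \<bullet> b) *\<^sub>R f' x b)"
  using linear_basis_expansion C1_deriv_onD[OF assms] has_derivative_linear by blast

text \<open>Expanding the direction in \<open>Basis\<close> turns continuity for each fixed
  direction into continuity in base point and direction together.\<close>

lemma C1_deriv_on_joint_continuous:
  assumes "C1_deriv_on S f f'"
    and "continuous_on T g" "continuous_on T k" "\<And>t. t \<in> T \<Longrightarrow> g t \<in> S"
  shows "continuous_on T (\<lambda>t. f' (g t) (k t))"
proof -
  have "continuous_on T (\<lambda>t. f' (g t) b)" for b
    using assms unfolding C1_deriv_on_def
    by (intro continuous_on_compose2[of S "\<lambda>x. f' x b" T g]) auto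
  then have "continuous_on T (\<lambda>t. \<Sum>b\<in>Basis. (k t \<bullet> b) *\<^sub>R f' (g t) b)"
    by (intro continuous_intros assms)
  then show ?thesis
    by (rule continuous_on_eq) (simp add: C1_deriv_on_expansion[OF assms(1,4), symmetric])
qed

lemma C1_deriv_on_compose:
  assumes "C1_deriv_on S f f'" "C1_deriv_on T g g'" "f ` S \<subseteq> T"
  shows "C1_deriv_on S (\<lambda>x. g (f x)) (\<lambda>x k. g' (f x) (f' x k))"
  unfolding C1_deriv_on_def
proof (intro conjI ballI allI)
  fix x assume "x \<in> S"
  with assms show "((\<lambda>x. g (f x)) has_derivative (\<lambda>k. g' (f x) (f' x k))) (at x)"
    by (intro has_derivative_compose[of f "f' x" x UNIV g "g' (f x)"]) (auto dest: C1_deriv_onD)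
next
  fix k
  show "continuous_on S (\<lambda>x. g' (f x) (f' x k))"
    using assms by (intro C1_deriv_on_joint_continuous[OF assms(2)] C1_deriv_on_continuous[OF assms(1)])
      (auto simp: C1_deriv_on_def)
qed

lemma C1_deriv_on_linear: "bounded_linear f \<Longrightarrow> C1_deriv_on S f (\<lambda>_. f)"
  unfolding C1_deriv_on_def by (auto simp: bounded_linear_imp_has_derivative)

lemma C1_deriv_on_bounded_bilinear:
  assumes "bounded_bilinear mul" "C1_deriv_on S f f'" "C1_deriv_on S g g'"
  shows "C1_deriv_on S (\<lambda>x. mul (f x) (g x)) (\<lambda>x k. mul (f x) (g' x k) + mul (f' x k) (g x))"
proof -
  interpret bounded_bilinear mul by fact
  show ?thesis
    using assms(2,3) unfolding C1_deriv_on_def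
    by (auto intro!: FDERIV continuous_intros continuous_on C1_deriv_on_continuous[OF assms(2)]
        C1_deriv_on_continuous[OF assms(3)])
qed

lemmas C1_deriv_on_scaleR = C1_deriv_on_bounded_bilinear[OF bounded_bilinear_scaleR]
lemmas C1_deriv_on_inner = C1_deriv_on_bounded_bilinear[OF bounded_bilinear_inner]

lemma C1_deriv_on_Pair:
  assumes "C1_deriv_on S f f'" "C1_deriv_on S g g'"
  shows "C1_deriv_on S (\<lambda>x. (f x, g x)) (\<lambda>x k. (f' x k, g' x k))"
  using assms unfolding C1_deriv_on_def by (auto intro!: has_derivative_Pair continuous_intros)

lemma C1_deriv_on_sum:
  assumes "\<And>i. i \<in> I \<Longrightarrow> C1_deriv_on S (f i) (f' i)"
  shows "C1_deriv_on S (\<lambda>x. \<Sum>i\<in>I. f i x) (\<lambda>x k. \<Sum>i\<in>I. f' i x k)"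
  using assms unfolding C1_deriv_on_def
  by (auto intro!: has_derivative_sum continuous_intros)

lemma C1_deriv_on_add:
  assumes "C1_deriv_on S f f'" "C1_deriv_on S g g'"
  shows "C1_deriv_on S (\<lambda>x. f x + g x) (\<lambda>x k. f' x k + g' x k)"
  using assms unfolding C1_deriv_on_def by (auto intro!: has_derivative_add continuous_intros)

text \<open>The map (x, v) to f'(x) v is the fibre part of the tangent map of f: it transforms
  velocities under a change of charts and is the integrand of the noise term after summation by
  parts. Only derivatives in fixed directions are known to be C1, so v is expanded in
  \<open>Basis\<close> and a finite sum is differentiated.\<close>

lemma C1_deriv_on_derivative_pairing:
  fixes f :: "'a::euclidean_space \<Rightarrow> 'b::real_normed_vector"
  assumes f: "C1_deriv_on U f f'" and f2: "\<And>v. C1_deriv_on U (\<lambda>x. f' x v) (f2 v)" and "open U"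
  shows "C1_deriv_on (U \<times> UNIV) (\<lambda>z. f' (fst z) (snd z))
    (\<lambda>z k. f2 (snd z) (fst z) (fst k) + f' (fst z) (snd k))"
proof -
  let ?g = "\<lambda>z::'a \<times> 'a. \<Sum>b\<in>Basis. (snd z \<bullet> b) *\<^sub>R f' (fst z) b"
  have c: "C1_deriv_on (U \<times> UNIV) (\<lambda>z::'a \<times> 'a. f' (fst z) b) (\<lambda>z k. f2 b (fst z) (fst k))" for b
    by (rule C1_deriv_on_compose[OF C1_deriv_on_linear[OF bounded_linear_fst] f2]) auto
  have i: "C1_deriv_on (U \<times> UNIV) (\<lambda>z::'a \<times> 'a. snd z \<bullet> b) (\<lambda>z k. snd k \<bullet> b)" for b
    by (rule C1_deriv_on_linear) (intro bounded_linear_intros)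
  have g: "C1_deriv_on (U \<times> UNIV) ?g
      (\<lambda>z k. \<Sum>b\<in>Basis. (snd z \<bullet> b) *\<^sub>R f2 b (fst z) (fst k) + (snd k \<bullet> b) *\<^sub>R f' (fst z) b)"
    by (intro C1_deriv_on_sum C1_deriv_on_scaleR c i)
  have eq: "?g z = f' (fst z) (snd z)" if "z \<in> U \<times> UNIV" for z
    using C1_deriv_on_expansion[OF f, of "fst z" "snd z"] that by auto
  \<comment> \<open>Linearity of \<open>f2 v x k\<close> in the index \<open>v\<close> comes from
    uniqueness of derivatives: the sum over \<open>Basis\<close> is a derivative of the same
    function.\<close>
  have lin: "(\<Sum>b\<in>Basis. (v \<bullet> b) *\<^sub>R f2 b x k) = f2 v x k" if "x \<in> U" for v x k
  proof -
    have 1: "((\<lambda>x. \<Sum>b\<in>Basis. (v \<bullet> b) *\<^sub>R f' x b) has_derivative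
        (\<lambda>k. \<Sum>b\<in>Basis. (v \<bullet> b) *\<^sub>R f2 b x k)) (at x)"
      by (intro has_derivative_sum has_derivative_scaleR_right C1_deriv_onD[OF f2] that)
    have "((\<lambda>x. f' x v) has_derivative (\<lambda>k. \<Sum>b\<in>Basis. (v \<bullet> b) *\<^sub>R f2 b x k)) (at x)"
      by (rule has_derivative_transform_within_open[OF 1 \<open>open U\<close> that])
        (simp add: C1_deriv_on_expansion[OF f, of _ v])
    from has_derivative_unique[OF this C1_deriv_onD[OF f2 that]] show ?thesis by metis
  qed
  have o: "open (U \<times> (UNIV::'a set))" using \<open>open U\<close> by (intro open_Times) auto
  have d: "(\<Sum>b\<in>Basis. (snd z \<bullet> b) *\<^sub>R f2 b (fst z) (fst k) + (snd k \<bullet> b) *\<^sub>R f' (fst z) b)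
     = f2 (snd z) (fst z) (fst k) + f' (fst z) (snd k)" if "z \<in> U \<times> UNIV" for z k
    using that C1_deriv_on_expansion[OF f, of "fst z" "snd k"] by (auto simp: sum.distrib lin)
  show ?thesis unfolding C1_deriv_on_def
  proof (intro conjI ballI allI)
    fix z assume z: "z \<in> U \<times> (UNIV::'a set)"
    have "((\<lambda>z. f' (fst z) (snd z)) has_derivative (\<lambda>k. \<Sum>b\<in>Basis. (snd z \<bullet> b) *\<^sub>R f2 b (fst z) (fst k) + (snd k \<bullet> b) *\<^sub>R f' (fst z) b)) (at z)"
      by (rule has_derivative_transform_within_open[OF C1_deriv_onD[OF g z] o z]) (rule eq)
    then show "((\<lambda>z. f' (fst z) (snd z)) has_derivative (\<lambda>k. f2 (snd z) (fst z) (fst k) + f' (fst z) (snd k))) (at z)"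
      by (simp only: d[OF z])
  next
    fix k
    show "continuous_on (U \<times> UNIV) (\<lambda>z. f2 (snd z) (fst z) (fst k) + f' (fst z) (snd k))"
      by (rule continuous_on_eq[where f = "\<lambda>z. \<Sum>b\<in>Basis. (snd z \<bullet> b) *\<^sub>R f2 b (fst z) (fst k) + (snd k \<bullet> b) *\<^sub>R f' (fst z) b"])
        (use g d in \<open>auto simp: C1_deriv_on_def\<close>)
  qed
qed

section \<open>Symmetry of second derivatives\<close>

lemma has_derivative_line:
  assumes "(f has_derivative f') (at (x + s *\<^sub>R u))"
  shows "((\<lambda>s. f (x + s *\<^sub>R u)) has_derivative (\<lambda>h. f' (h *\<^sub>R u))) (at s)"
  by (rule has_derivative_compose[of "\<lambda>s. x + s *\<^sub>R u" "\<lambda>h. h *\<^sub>R u" s UNIV f f'])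
    (use assms in \<open>auto intro!: derivative_eq_intros\<close>)

text \<open>Schwarz's theorem through the second difference of f over the parallelogram spanned by h
  u and h v. It is symmetric in u and v, and two applications of the mean value theorem express it
  as h^2 times a mixed derivative at a point near x, in either order. Continuity at x then excludes
  a gap between the two mixed derivatives.\<close>

lemma symmetric_second_derivative_real:
  fixes f :: "'a::euclidean_space \<Rightarrow> real"
  assumes "open U" "x \<in> U"
    and f: "\<And>y. y \<in> U \<Longrightarrow> (f has_derivative f' y) (at y)"
    and fu: "\<And>y. y \<in> U \<Longrightarrow> ((\<lambda>z. f' z u) has_derivative f2 u y) (at y)"
    and fv: "\<And>y. y \<in> U \<Longrightarrow> ((\<lambda>z. f' z v) has_derivative f2 v y) (at y)"
    and cu: "continuous_on U (\<lambda>y. f2 u y v)" and cv: "continuous_on U (\<lambda>y. f2 v y u)"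
  shows "f2 u x v = f2 v x u"
proof (rule ccontr)
  assume ne: "f2 u x v \<noteq> f2 v x u"
  \<comment> \<open>Half the gap: no number is closer than this to both mixed derivatives at
    x.\<close>
  define e where "e = \<bar>f2 u x v - f2 v x u\<bar> / 2"
  have e: "e > 0" using ne by (simp add: e_def)
  obtain r where r: "r > 0" "ball x r \<subseteq> U" using assms(1,2) open_contains_ball by blast
  have iu: "isCont (\<lambda>y. f2 u y v) x" and iv: "isCont (\<lambda>y. f2 v y u) x"
    using cu cv assms(1,2) continuous_on_eq_continuous_at by blast+
  obtain du where du: "du > 0" "\<And>y. dist y x < du \<Longrightarrow> dist (f2 u y v) (f2 u x v) < e"
    using iu e unfolding continuous_at_eps_delta by (metis dist_norm)
  obtain dv where dv: "dv > 0" "\<And>y. dist y x < dv \<Longrightarrow> dist (f2 v y u) (f2 v x u) < e"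
    using iv e unfolding continuous_at_eps_delta by (metis dist_norm)
  define d where "d = min r (min du dv)"
  have d: "d > 0" using r du dv by (simp add: d_def)
  \<comment> \<open>Small enough for the whole parallelogram to stay within d of x; the summand 1
    keeps the denominator positive.\<close>
  define h where "h = d / (2 * (norm u + norm v + 1))"
  have np: "norm u + norm v + 1 > 0" by (smt (verit) norm_ge_zero)
  have h: "h > 0" using d np by (simp add: h_def)
  have hh: "h * (norm u + norm v) < d"
  proof -
    have "h * (norm u + norm v) \<le> h * (norm u + norm v + 1)" using h by (simp add: distrib_left)
    also have "\<dots> = d/2" using np unfolding h_def by (simp add: field_simps del: distrib_right_numeral)
    finally show ?thesis using d by linarith
  qed
  have near: "dist (x + s *\<^sub>R p + t *\<^sub>R q) x < d"
    if "0 \<le> s" "s \<le> h" "0 \<le> t" "t \<le> h" "{p,q} = {u,v}" for s t p q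
  proof -
    have "dist (x + s *\<^sub>R p + t *\<^sub>R q) x = norm (s *\<^sub>R p + t *\<^sub>R q)" by (simp add: dist_norm algebra_simps)
    also have "\<dots> \<le> s * norm p + t * norm q"
      using that by (intro norm_triangle_le) simp
    also have "\<dots> \<le> h * norm p + h * norm q"
      using that by (intro add_mono mult_right_mono) auto
    also have "\<dots> = h * (norm u + norm v)"
      using that(5) by (auto simp: doubleton_eq_iff algebra_simps)
    finally show ?thesis using hh by linarith
  qed
  have inU: "x + s *\<^sub>R p + t *\<^sub>R q \<in> U"
    if "0 \<le> s" "s \<le> h" "0 \<le> t" "t \<le> h" "{p,q} = {u,v}" for s t p q
    using near[OF that] r by (auto simp: d_def dist_commute)
  \<comment> \<open>Stated for an unordered pair of directions so that it applies to (u, v) and to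
    (v, u).\<close>
  have key: "\<exists>s t. 0 \<le> s \<and> s \<le> h \<and> 0 \<le> t \<and> t \<le> h \<and>
      f (x + h *\<^sub>R p + h *\<^sub>R q) - f (x + h *\<^sub>R p) - f (x + h *\<^sub>R q) + f x
      = h * (h * f2 p (x + s *\<^sub>R p + t *\<^sub>R q) q)"
    if pq: "{p,q} = {u,v}" for p q
  proof -
    have fp: "((\<lambda>z. f' z p) has_derivative f2 p y) (at y)" if "y \<in> U" for y
      using pq fu[OF that] fv[OF that] by (auto simp: doubleton_eq_iff)
    define g where "g s = f ((x + h *\<^sub>R q) + s *\<^sub>R p) - f (x + s *\<^sub>R p)" for s
    have "\<exists>s\<in>{0<..<h}. g h - g 0 = (\<lambda>k. f' ((x + h *\<^sub>R q) + s *\<^sub>R p) (k *\<^sub>R p) - f' (x + s *\<^sub>R p) (k *\<^sub>R p)) (h - 0)"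
    proof (rule mvt_simple[OF h, where f = g and f' = "\<lambda>s k. f' ((x + h *\<^sub>R q) + s *\<^sub>R p) (k *\<^sub>R p) - f' (x + s *\<^sub>R p) (k *\<^sub>R p)"])
      fix s assume s: "0 \<le> s" "s \<le> h"
      have 1: "x + h *\<^sub>R q + s *\<^sub>R p \<in> U"
        using inU[OF s, of h p q] pq h by (simp add: algebra_simps)
      have 2: "x + s *\<^sub>R p \<in> U"
        using inU[OF s, of 0 p q] pq h by (simp add: algebra_simps)
      show "(g has_derivative (\<lambda>k. f' ((x + h *\<^sub>R q) + s *\<^sub>R p) (k *\<^sub>R p) - f' (x + s *\<^sub>R p) (k *\<^sub>R p))) (at s within {0..h})"
        unfolding g_def
        by (intro has_derivative_diff has_derivative_at_withinI[OF has_derivative_line] f 1 2)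
    qed
    then obtain s where s: "0 < s" "s < h"
      and gs: "g h - g 0 = f' ((x + h *\<^sub>R q) + s *\<^sub>R p) (h *\<^sub>R p) - f' (x + s *\<^sub>R p) (h *\<^sub>R p)" by auto
    have lin: "f' y (h *\<^sub>R p) = h * f' y p" if "y \<in> U" for y
      using has_derivative_linear[OF f[OF that]] by (simp add: linear_scale)
    have 1: "x + h *\<^sub>R q + s *\<^sub>R p \<in> U"
      using inU[of s h p q] s pq h by (simp add: algebra_simps)
    have 2: "x + s *\<^sub>R p \<in> U"
      using inU[of s 0 p q] s pq h by (simp add: algebra_simps)
    have gs': "g h - g 0 = h * (f' ((x + s *\<^sub>R p) + h *\<^sub>R q) p - f' (x + s *\<^sub>R p) p)"
      using gs lin[OF 1] lin[OF 2] by (simp add: algebra_simps)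
    define k where "k t = f' ((x + s *\<^sub>R p) + t *\<^sub>R q) p" for t
    have "\<exists>t\<in>{0<..<h}. k h - k 0 = (\<lambda>l. f2 p ((x + s *\<^sub>R p) + t *\<^sub>R q) (l *\<^sub>R q)) (h - 0)"
    proof (rule mvt_simple[OF h, where f = k and f' = "\<lambda>t l. f2 p ((x + s *\<^sub>R p) + t *\<^sub>R q) (l *\<^sub>R q)"])
      fix t assume "0 \<le> t" "t \<le> h"
      then show "(k has_derivative (\<lambda>l. f2 p ((x + s *\<^sub>R p) + t *\<^sub>R q) (l *\<^sub>R q))) (at t within {0..h})"
        unfolding k_def
        by (intro has_derivative_at_withinI[OF has_derivative_line] fp inU) (use s pq in auto)
    qed
    then obtain t where t: "0 < t" "t < h" and kt: "k h - k 0 = f2 p ((x + s *\<^sub>R p) + t *\<^sub>R q) (h *\<^sub>R q)" by auto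
    have 3: "x + s *\<^sub>R p + t *\<^sub>R q \<in> U" using inU[of s t p q] s t pq by auto
    have "f2 p ((x + s *\<^sub>R p) + t *\<^sub>R q) (h *\<^sub>R q) = h * f2 p ((x + s *\<^sub>R p) + t *\<^sub>R q) q"
      using has_derivative_linear[OF fp[OF 3]] by (simp add: linear_scale)
    then have "g h - g 0 = h * (h * f2 p (x + s *\<^sub>R p + t *\<^sub>R q) q)"
      using gs' kt by (simp add: k_def)
    moreover have "g h - g 0 = f (x + h *\<^sub>R p + h *\<^sub>R q) - f (x + h *\<^sub>R p) - f (x + h *\<^sub>R q) + f x"
      by (simp add: g_def algebra_simps)
    ultimately show ?thesis using s t by (metis less_imp_le)
  qed
  obtain s t where st: "0 \<le> s" "s \<le> h" "0 \<le> t" "t \<le> h"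
    "f (x + h *\<^sub>R u + h *\<^sub>R v) - f (x + h *\<^sub>R u) - f (x + h *\<^sub>R v) + f x
      = h * (h * f2 u (x + s *\<^sub>R u + t *\<^sub>R v) v)" using key[of u v] by blast
  obtain s' t' where st': "0 \<le> s'" "s' \<le> h" "0 \<le> t'" "t' \<le> h"
    "f (x + h *\<^sub>R v + h *\<^sub>R u) - f (x + h *\<^sub>R v) - f (x + h *\<^sub>R u) + f x
      = h * (h * f2 v (x + s' *\<^sub>R v + t' *\<^sub>R u) u)" using key[of v u] by blast
  have "f (x + h *\<^sub>R u + h *\<^sub>R v) = f (x + h *\<^sub>R v + h *\<^sub>R u)" by (simp add: ac_simps)
  then have "h * (h * f2 u (x + s *\<^sub>R u + t *\<^sub>R v) v) = h * (h * f2 v (x + s' *\<^sub>R v + t' *\<^sub>R u) u)"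
    using st(5) st'(5) by linarith
  then have eq: "f2 u (x + s *\<^sub>R u + t *\<^sub>R v) v = f2 v (x + s' *\<^sub>R v + t' *\<^sub>R u) u"
    using h by simp
  have "dist (f2 u (x + s *\<^sub>R u + t *\<^sub>R v) v) (f2 u x v) < e"
    using near[OF st(1-4), of u v] by (intro du) (auto simp: d_def)
  moreover have "dist (f2 v (x + s' *\<^sub>R v + t' *\<^sub>R u) u) (f2 v x u) < e"
    using near[OF st'(1-4), of v u] by (intro dv) (auto simp: d_def)
  ultimately show False unfolding eq e_def dist_real_def by (simp add: abs_if split: if_splits)
qed

lemma symmetric_second_derivative:
  fixes f :: "'a::euclidean_space \<Rightarrow> 'b::euclidean_space"
  assumes "open U" "x \<in> U" and f: "C1_deriv_on U f f'"
    and f2: "\<And>v. C1_deriv_on U (\<lambda>x. f' x v) (f2 v)"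
  shows "f2 u x v = f2 v x u"
proof (rule euclidean_eqI)
  fix b :: 'b assume "b \<in> Basis"
  show "f2 u x v \<bullet> b = f2 v x u \<bullet> b"
    by (rule symmetric_second_derivative_real[where f = "\<lambda>y. f y \<bullet> b" and f' = "\<lambda>y k. f' y k \<bullet> b"
          and ?f2.0 = "\<lambda>v y k. f2 v y k \<bullet> b", OF assms(1,2)])
      (use f f2 in \<open>auto simp: C1_deriv_on_def intro!: has_derivative_inner_left continuous_intros\<close>)
qed

section \<open>Difference quotients that converge uniformly along a curve\<close>

text \<open>On a compact set the first-order remainder is small uniformly in the base point. The
  closed \<open>d0\<close>-balls around points of K form a compact set inside U, on which the
  derivative is uniformly continuous over directions in the unit ball; the mean value inequality on
  a ball around y gives the bound.\<close>

lemma C1_deriv_on_uniformly_differentiable: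
  fixes f :: "'a::euclidean_space \<Rightarrow> 'b::real_normed_vector"
  assumes "open U" and f: "C1_deriv_on U f f'" and "compact K" "K \<subseteq> U" "e > 0"
  obtains d where "d > 0" "\<And>y k. y \<in> K \<Longrightarrow> norm k < d \<Longrightarrow> y + k \<in> U"
    "\<And>y k. y \<in> K \<Longrightarrow> norm k < d \<Longrightarrow> norm (f (y + k) - f y - f' y k) \<le> e * norm k"
proof -
  obtain d0 where d0: "d0 > 0" "(\<Union>x\<in>K. cball x d0) \<subseteq> U"
    using compact_subset_open_imp_cball_epsilon_subset[OF assms(3,1,4)] by metis
  have "compact (\<Union>x\<in>K. cball x d0)"
    using assms(3) by (rule compact_minkowski_sum_cball)
  let ?K = "\<Union>x\<in>K. cball x d0"
  have "continuous_on (?K \<times> cball 0 1) (\<lambda>z. f' (fst z) (snd z))"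
    using d0 by (intro C1_deriv_on_joint_continuous[OF f] continuous_intros) auto
  then have "uniformly_continuous_on (?K \<times> cball 0 1) (\<lambda>z. f' (fst z) (snd z))"
    using \<open>compact ?K\<close> by (intro compact_uniformly_continuous compact_Times) auto
  then obtain d1 where d1: "d1 > 0" "\<And>z z'. z \<in> ?K \<times> cball 0 1 \<Longrightarrow> z' \<in> ?K \<times> cball 0 1 \<Longrightarrow>
      dist z' z < d1 \<Longrightarrow> dist (f' (fst z') (snd z')) (f' (fst z) (snd z)) < e"
    using \<open>e > 0\<close> unfolding uniformly_continuous_on_def by metis
  show ?thesis
  proof (rule that[of "min d0 d1"])
    show "min d0 d1 > 0" using d0 d1 by simp
    fix y k :: 'a assume y: "y \<in> K" and k: "norm k < min d0 d1"
    have seg: "y + t *\<^sub>R k \<in> ball y (min d0 d1)" if "t \<in> {0..1}" for t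
      using that k mult_right_mono[of t 1 "norm k"] by (auto simp: dist_norm)
    have B: "ball y (min d0 d1) \<subseteq> ?K" using y by auto
    have BU: "ball y (min d0 d1) \<subseteq> U" using B d0(2) by (rule subset_trans)
    show "y + k \<in> U" using BU seg[of 1] by auto
    have "norm (f (y + k) - f y - f' y (y + k - y)) \<le> norm (y + k - y) * e"
    proof (rule differentiable_bound_linearization[where S = "ball y (min d0 d1)" and ?f' = f'])
      show "\<And>t. t \<in> {0..1} \<Longrightarrow> y + t *\<^sub>R (y + k - y) \<in> ball y (min d0 d1)" using seg by simp
      show "(f has_derivative f' x) (at x within ball y (min d0 d1))" if "x \<in> ball y (min d0 d1)" for x
        using C1_deriv_onD[OF f subsetD[OF BU that]] by (rule has_derivative_at_withinI)
      show "y \<in> ball y (min d0 d1)" using d0 d1 by simp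
      fix x assume x: "x \<in> ball y (min d0 d1)"
      have xU: "x \<in> U" "y \<in> U" using subsetD[OF BU x] y assms(4) by auto
      have bl: "bounded_linear (\<lambda>k. f' x k - f' y k)"
        by (intro bounded_linear_sub has_derivative_bounded_linear[OF C1_deriv_onD[OF f]] xU)
      show "onorm (f' x - f' y) \<le> e"
        unfolding fun_diff_def
      proof (rule onorm_bound)
        show "0 \<le> e" using \<open>e > 0\<close> by simp
        fix v :: 'a
        show "norm (f' x v - f' y v) \<le> e * norm v"
        proof (cases "v = 0")
          case True
          then show ?thesis using bl by (simp add: linear_0[OF bounded_linear.linear[OF bl], simplified])
        next
          case False
          let ?w = "v /\<^sub>R norm v"
          have w: "norm ?w = 1" using False by simp
          have "dist (f' (fst (x, ?w)) (snd (x, ?w))) (f' (fst (y, ?w)) (snd (y, ?w))) < e"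
          proof (rule d1(2))
            show "(x, ?w) \<in> ?K \<times> cball 0 1" using subsetD[OF B x] w by simp
            show "(y, ?w) \<in> ?K \<times> cball 0 1" using subsetD[OF B, of y] w d0 d1 by simp
            show "dist (x, ?w) (y, ?w) < d1" using x by (simp add: dist_Pair_Pair dist_commute)
          qed
          then have "norm (f' x ?w - f' y ?w) < e" by (simp add: dist_norm)
          moreover have "f' x v - f' y v = norm v *\<^sub>R (f' x ?w - f' y ?w)"
            using False linear_scale[OF bounded_linear.linear[OF bl], of "norm v" ?w] by simp
          ultimately show ?thesis using False by (simp add: mult.commute mult_left_mono less_imp_le)
        qed
      qed
    qed
    then show "norm (f (y + k) - f y - f' y k) \<le> e * norm k" by (simp add: mult.commute)
  qed
qed

text \<open>Composition with a C1 map is differentiable for the sup norm along a curve with compact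
  image. This serves twice: for the integrands of the action, and for carrying the derivative of a
  family of paths from one chart to another.\<close>

lemma uniform_limit_difference_quotient_compose:
  fixes f :: "'a::euclidean_space \<Rightarrow> 'b::real_normed_vector"
  assumes "open U" and f: "C1_deriv_on U f f'"
    and K: "compact (Y0 ` S)" "Y0 ` S \<subseteq> U" and bd: "bounded (\<eta> ` S)"
    and lim: "uniform_limit S (\<lambda>h r. (Y h r - Y0 r) /\<^sub>R h) \<eta> (at (0::real))"
  shows "\<forall>\<^sub>F h in at 0. \<forall>r\<in>S. Y h r \<in> U"
    and "uniform_limit S (\<lambda>h r. (f (Y h r) - f (Y0 r)) /\<^sub>R h) (\<lambda>r. f' (Y0 r) (\<eta> r)) (at 0)"
proof -
  obtain B where B: "B > 0" "\<And>r. r \<in> S \<Longrightarrow> norm (\<eta> r) \<le> B"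
    using bd by (auto simp: bounded_pos)
  have main: "\<forall>\<^sub>F h in at 0. \<forall>r\<in>S. Y h r \<in> U \<and>
      dist ((f (Y h r) - f (Y0 r)) /\<^sub>R h) (f' (Y0 r) (\<eta> r)) < e" if "e > 0" for e
  proof -
    have "continuous_on (Y0 ` S \<times> cball 0 1) (\<lambda>z. f' (fst z) (snd z))"
      using K by (intro C1_deriv_on_joint_continuous[OF f] continuous_intros) auto
    then have "bounded ((\<lambda>z. f' (fst z) (snd z)) ` (Y0 ` S \<times> cball 0 1))"
      using K by (intro compact_imp_bounded compact_continuous_image compact_Times) auto
    then obtain M where M: "M > 0" "\<And>y k. y \<in> Y0 ` S \<Longrightarrow> norm k \<le> 1 \<Longrightarrow> norm (f' y k) \<le> M"
      by (force simp: bounded_pos)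
    have M': "norm (f' y k) \<le> M * norm k" if "y \<in> Y0 ` S" for y k
    proof (cases "k = 0")
      case False
      have "linear (f' y)" using K that f by (meson C1_deriv_onD has_derivative_linear subsetD)
      then have "f' y k = norm k *\<^sub>R f' y (k /\<^sub>R norm k)"
        using False linear_scale[of "f' y" "norm k" "k /\<^sub>R norm k"] by simp
      then have "norm (f' y k) = norm k * norm (f' y (k /\<^sub>R norm k))" by (metis norm_scaleR abs_norm_cancel)
      also have "\<dots> \<le> norm k * M" using False by (intro mult_left_mono M that) auto
      finally show ?thesis by (simp add: mult.commute)
    next
      case True
      have "linear (f' y)" using K that f by (meson C1_deriv_onD has_derivative_linear subsetD)
      then show ?thesis using True by (simp add: linear_0)
    qed
    \<comment> \<open>Half of e pays for the first-order remainder, the quotients being bounded by B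
      + 1; the other half pays for M times the distance of the quotient from its limit.\<close>
    define \<epsilon> where "\<epsilon> = e / (2 * (B + 1))"
    have \<epsilon>: "\<epsilon> > 0" using that B by (simp add: \<epsilon>_def)
    obtain d where d: "d > 0" "\<And>y k. y \<in> Y0 ` S \<Longrightarrow> norm k < d \<Longrightarrow> y + k \<in> U"
      "\<And>y k. y \<in> Y0 ` S \<Longrightarrow> norm k < d \<Longrightarrow> norm (f (y + k) - f y - f' y k) \<le> \<epsilon> * norm k"
      using C1_deriv_on_uniformly_differentiable[OF assms(1) f K \<epsilon>] by metis
    have 1: "\<forall>\<^sub>F h in at 0. \<forall>r\<in>S. dist ((Y h r - Y0 r) /\<^sub>R h) (\<eta> r) < min 1 (e / (2 * M))"
      using lim that M by (intro uniform_limitD) auto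
    have 2: "\<forall>\<^sub>F h in at (0::real). h \<noteq> 0 \<and> \<bar>h\<bar> < d / (B + 1)"
      using d B by (auto simp: eventually_at dist_real_def intro!: exI[of _ "d / (B + 1)"])
    from 1 2 show ?thesis
    proof eventually_elim
      case (elim h)
      show ?case
      proof
        fix r assume r: "r \<in> S"
        define Q where "Q = (Y h r - Y0 r) /\<^sub>R h"
        have Y: "Y h r = Y0 r + h *\<^sub>R Q" using elim by (simp add: Q_def)
        have Q1: "norm (Q - \<eta> r) < min 1 (e / (2 * M))" using elim r by (simp add: Q_def dist_norm)
        have "norm Q \<le> norm (Q - \<eta> r) + norm (\<eta> r)" using norm_triangle_sub by (metis add.commute)
        then have Q2: "norm Q < B + 1" using Q1 B(2)[OF r] by linarith
        have hQ: "norm (h *\<^sub>R Q) < d"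
        proof -
          have "norm (h *\<^sub>R Q) \<le> \<bar>h\<bar> * (B + 1)" using Q2 by (simp add: mult_left_mono)
          also have "\<dots> < d" using elim B by (simp add: field_simps)
          finally show ?thesis .
        qed
        have lin: "linear (f' (Y0 r))" using K r f by (meson C1_deriv_onD has_derivative_linear subsetD image_eqI)
        have "(f (Y h r) - f (Y0 r)) /\<^sub>R h - f' (Y0 r) (\<eta> r)
          = (f (Y0 r + h *\<^sub>R Q) - f (Y0 r) - f' (Y0 r) (h *\<^sub>R Q)) /\<^sub>R h + f' (Y0 r) (Q - \<eta> r)"
          using elim by (simp add: Y linear_scale[OF lin] linear_diff[OF lin] scaleR_right_diff_distrib)
        also have "norm \<dots> \<le> norm ((f (Y0 r + h *\<^sub>R Q) - f (Y0 r) - f' (Y0 r) (h *\<^sub>R Q)) /\<^sub>R h)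
            + norm (f' (Y0 r) (Q - \<eta> r))" by (rule norm_triangle_ineq)
        also have "\<dots> \<le> (\<epsilon> * norm (h *\<^sub>R Q)) / \<bar>h\<bar> + M * norm (Q - \<eta> r)"
        proof (rule add_mono)
          have "norm (f (Y0 r + h *\<^sub>R Q) - f (Y0 r) - f' (Y0 r) (h *\<^sub>R Q)) / \<bar>h\<bar>
              \<le> (\<epsilon> * norm (h *\<^sub>R Q)) / \<bar>h\<bar>"
            using hQ r by (intro divide_right_mono d(3)) auto
          then show "norm ((f (Y0 r + h *\<^sub>R Q) - f (Y0 r) - f' (Y0 r) (h *\<^sub>R Q)) /\<^sub>R h)
              \<le> (\<epsilon> * norm (h *\<^sub>R Q)) / \<bar>h\<bar>"
            by (simp add: divide_inverse mult.commute)
        qed (use M' r in auto)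
        also have "\<dots> = \<epsilon> * norm Q + M * norm (Q - \<eta> r)" using elim by simp
        also have "\<dots> < \<epsilon> * (B + 1) + M * (e / (2 * M))"
          using Q1 Q2 \<epsilon> M by (intro add_strict_mono mult_strict_left_mono) auto
        also have "\<dots> = e" using B M by (simp add: \<epsilon>_def field_simps)
        finally show "Y h r \<in> U \<and> dist ((f (Y h r) - f (Y0 r)) /\<^sub>R h) (f' (Y0 r) (\<eta> r)) < e"
          using d(2)[of "Y0 r" "h *\<^sub>R Q"] hQ r by (simp add: Y dist_norm)
      qed
    qed
  qed
  show "\<forall>\<^sub>F h in at 0. \<forall>r\<in>S. Y h r \<in> U"
    using main[of 1] by (auto elim: eventually_mono)
  show "uniform_limit S (\<lambda>h r. (f (Y h r) - f (Y0 r)) /\<^sub>R h) (\<lambda>r. f' (Y0 r) (\<eta> r)) (at 0)"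
  proof (rule uniform_limitI)
    fix e :: real assume "e > 0"
    from main[OF this] show "\<forall>\<^sub>F h in at 0. \<forall>r\<in>S. dist ((f (Y h r) - f (Y0 r)) /\<^sub>R h) (f' (Y0 r) (\<eta> r)) < e"
      by (rule eventually_mono) blast
  qed
qed

section \<open>Riemann-Stieltjes integrals of continuously differentiable functions\<close>

text \<open>A division that is fine for both radii exists, and its sum would be close to both
  values.\<close>

lemma has_rs_integral_unique:
  assumes "has_rs_integral f g s t I" "has_rs_integral f g s t J"
  shows "I = J"
proof (rule ccontr)
  assume "I \<noteq> J"
  then have e: "\<bar>I - J\<bar> / 2 > 0" by simp
  obtain d1 where d1: "d1 > 0" "\<And>\<D>. \<D> tagged_division_of {s..t} \<Longrightarrow> (\<lambda>x. ball x d1) fine \<D> \<Longrightarrow>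
      \<bar>(\<Sum>(x, K)\<in>\<D>. f x * (g (Sup K) - g (Inf K))) - I\<bar> < \<bar>I - J\<bar> / 2"
    using assms(1) e unfolding has_rs_integral_def by meson
  obtain d2 where d2: "d2 > 0" "\<And>\<D>. \<D> tagged_division_of {s..t} \<Longrightarrow> (\<lambda>x. ball x d2) fine \<D> \<Longrightarrow>
      \<bar>(\<Sum>(x, K)\<in>\<D>. f x * (g (Sup K) - g (Inf K))) - J\<bar> < \<bar>I - J\<bar> / 2"
    using assms(2) e unfolding has_rs_integral_def by meson
  have "gauge (\<lambda>x::real. ball x (min d1 d2))" using d1 d2 by (intro gauge_ball) auto
  then obtain \<D> where \<D>: "\<D> tagged_division_of {s..t}" "(\<lambda>x. ball x (min d1 d2)) fine \<D>"
    by (rule fine_division_exists_real)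
  have "(\<lambda>x. ball x d1) fine \<D>" "(\<lambda>x. ball x d2) fine \<D>"
    using \<D>(2) by (auto simp: fine_def subset_iff)
  from d1(2)[OF \<D>(1) this(1)] d2(2)[OF \<D>(1) this(2)] show False by argo
qed

lemma rs_integral_cong:
  assumes "\<And>r. r \<in> {s..t} \<Longrightarrow> f r = f' r"
  shows "rs_integral s t f g = rs_integral s t f' g"
proof -
  have "(\<Sum>(x, K)\<in>\<D>. f x * (g (Sup K) - g (Inf K))) = (\<Sum>(x, K)\<in>\<D>. f' x * (g (Sup K) - g (Inf K)))"
    if "\<D> tagged_division_of {s..t}" for \<D>
    using assms tagged_division_ofD(2,3)[OF that] by (intro sum.cong refl) (auto simp: subset_iff)
  then have "has_rs_integral f g s t I \<longleftrightarrow> has_rs_integral f' g s t I" for I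
    unfolding has_rs_integral_def by (simp cong: conj_cong imp_cong)
  then show ?thesis by (simp add: rs_integral_def)
qed

lemma rs_integral_refl: "rs_integral s s f g = 0"
proof -
  have "(\<Sum>(x, K)\<in>\<D>. f x * (g (Sup K) - g (Inf K))) = 0" if D: "\<D> tagged_division_of {s..s}" for \<D>
  proof (rule sum.neutral, clarify)
    fix x K assume "(x, K) \<in> \<D>"
    from tagged_division_ofD(2,3)[OF D this] have "K = {s}" by auto
    then show "f x * (g (Sup K) - g (Inf K)) = 0" by simp
  qed
  then have "has_rs_integral f g s s 0"
    unfolding has_rs_integral_def by (auto intro!: exI[of _ 1])
  then show ?thesis unfolding rs_integral_def using has_rs_integral_unique by blast
qed

text \<open>The difference equals the integral of (g - g(u)) f' over [u,x] plus the integral of (g -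
  g(v)) f' over [x,v], so the oscillation of g and a bound on f' control it.\<close>

lemma rs_term_estimate:
  fixes f g f' :: "real \<Rightarrow> real"
  assumes uxv: "u \<le> x" "x \<le> v"
    and f: "\<And>r. r \<in> {u..v} \<Longrightarrow> (f has_vector_derivative f' r) (at r within {u..v})"
    and cf: "continuous_on {u..v} f'" and cg: "continuous_on {u..v} g"
    and osc: "\<And>r r'. r \<in> {u..v} \<Longrightarrow> r' \<in> {u..v} \<Longrightarrow> \<bar>g r - g r'\<bar> \<le> e"
    and M: "\<And>r. r \<in> {u..v} \<Longrightarrow> \<bar>f' r\<bar> \<le> M"
  shows "\<bar>f x * (g v - g u) - (f v * g v - f u * g u - integral {u..v} (\<lambda>r. g r * f' r))\<bar>
    \<le> e * M * (v - u)"
proof -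
  have fint: "(f' has_integral f d - f c) {c..d}" if "u \<le> c" "c \<le> d" "d \<le> v" for c d
    using that by (intro fundamental_theorem_of_calculus has_vector_derivative_within_subset[OF f]) auto
  have piece: "\<bar>integral {c..d} (\<lambda>r. g r * f' r) - g z * (f d - f c)\<bar> \<le> e * M * (d - c)"
    if cd: "u \<le> c" "c \<le> d" "d \<le> v" and z: "z \<in> {u..v}" for c d z
  proof -
    have cont: "continuous_on {c..d} f'" "continuous_on {c..d} g"
      using cf cg that by (auto elim: continuous_on_subset)
    have 1: "(\<lambda>r. g r * f' r) integrable_on {c..d}"
      by (intro integrable_continuous_real continuous_intros cont)
    have "integral {c..d} (\<lambda>r. g r * f' r) - g z * (f d - f c)
        = integral {c..d} (\<lambda>r. g r * f' r) - integral {c..d} (\<lambda>r. g z * f' r)"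
      using integral_unique[OF fint[OF cd]] by simp
    also have "\<dots> = integral {c..d} (\<lambda>r. g r * f' r - g z * f' r)"
      by (rule integral_diff[symmetric]) (use 1 in \<open>auto intro!: integrable_continuous_real continuous_intros cont\<close>)
    also have "\<bar>\<dots>\<bar> \<le> e * M * (d - c)"
      unfolding real_norm_def[symmetric]
    proof (rule integral_bound)
      fix r assume "r \<in> {c..d}"
      then have r: "r \<in> {u..v}" using cd by auto
      have "\<bar>g r - g z\<bar> * \<bar>f' r\<bar> \<le> e * M"
        using osc[OF r z] M[OF r] by (intro mult_mono) auto
      then show "norm (g r * f' r - g z * f' r) \<le> e * M"
        by (simp add: left_diff_distrib[symmetric] abs_mult)
    qed (use cd in \<open>auto intro!: continuous_intros cont\<close>)
    finally show ?thesis .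
  qed
  have "integral {u..x} (\<lambda>r. g r * f' r) + integral {x..v} (\<lambda>r. g r * f' r) = integral {u..v} (\<lambda>r. g r * f' r)"
    by (intro Henstock_Kurzweil_Integration.integral_combine uxv integrable_continuous_real continuous_intros cf cg)
  then have "f x * (g v - g u) - (f v * g v - f u * g u - integral {u..v} (\<lambda>r. g r * f' r))
      = (integral {u..x} (\<lambda>r. g r * f' r) - g u * (f x - f u)) + (integral {x..v} (\<lambda>r. g r * f' r) - g v * (f v - f x))"
    by (simp add: algebra_simps)
  also have "\<bar>\<dots>\<bar> \<le> e * M * (x - u) + e * M * (v - x)"
    using piece[of u x u] piece[of x v v] uxv by auto
  finally show ?thesis by (simp add: algebra_simps)
qed

text \<open>Summation by parts over a fine tagged division reduces the claim to the uniform continuity of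
  the integrator, so no bounded variation is needed.\<close>

lemma has_rs_integral_C1:
  fixes f g f' :: "real \<Rightarrow> real"
  assumes st: "s \<le> t"
    and f: "\<And>r. r \<in> {s..t} \<Longrightarrow> (f has_vector_derivative f' r) (at r within {s..t})"
    and cf: "continuous_on {s..t} f'" and cg: "continuous_on {s..t} g"
  shows "has_rs_integral f g s t (f t * g t - f s * g s - integral {s..t} (\<lambda>r. g r * f' r))"
  unfolding has_rs_integral_def
proof (intro allI impI)
  fix \<epsilon> :: real assume \<epsilon>: "\<epsilon> > 0"
  have "bounded (f' ` {s..t})" by (intro compact_imp_bounded compact_continuous_image cf) auto
  then obtain M where M: "M > 0" "\<And>r. r \<in> {s..t} \<Longrightarrow> \<bar>f' r\<bar> \<le> M"
    by (auto simp: bounded_pos)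
  \<comment> \<open>The errors of the pieces add up to at most \<open>e * M * (t - s)\<close>, which
    is at most half of \<epsilon>; the summand 1 keeps the denominator positive also for s =
    t.\<close>
  define e where "e = \<epsilon> / (2 * (M * (t - s) + 1))"
  have pos: "M * (t - s) + 1 > 0" using M st by (simp add: add_nonneg_pos)
  have e: "e > 0" using \<epsilon> pos by (simp add: e_def)
  have "uniformly_continuous_on {s..t} g" by (intro compact_uniformly_continuous cg) auto
  then obtain d where d: "d > 0" "\<And>r r'. r \<in> {s..t} \<Longrightarrow> r' \<in> {s..t} \<Longrightarrow> dist r' r < d \<Longrightarrow> dist (g r') (g r) < e"
    using e unfolding uniformly_continuous_on_def by metis
  let ?h = "\<lambda>r. g r * f' r"
  let ?F = "\<lambda>K. f (Sup K) * g (Sup K) - f (Inf K) * g (Inf K)"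
  show "\<exists>d>0. \<forall>\<D>. \<D> tagged_division_of {s..t} \<and> (\<lambda>x. ball x d) fine \<D> \<longrightarrow>
      \<bar>(\<Sum>(x, K)\<in>\<D>. f x * (g (Sup K) - g (Inf K))) - (f t * g t - f s * g s - integral {s..t} ?h)\<bar> < \<epsilon>"
  \<comment> \<open>Points of one piece lie within d/2 of its tag, hence within d of each
    other.\<close>
  proof (intro exI[of _ "d / 2"] conjI allI impI)
    show "d / 2 > 0" using d by simp
    fix \<D> assume A: "\<D> tagged_division_of {s..t} \<and> (\<lambda>x. ball x (d / 2)) fine \<D>"
    then have D: "\<D> tagged_division_of {s..t}" and fine: "(\<lambda>x. ball x (d / 2)) fine \<D>" by auto
    have 1: "(\<Sum>(x, K)\<in>\<D>. ?F K) = f t * g t - f s * g s"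
      using additive_tagged_division_1[OF st D, of "\<lambda>r. f r * g r"] by simp
    have 2: "integral {s..t} ?h = (\<Sum>(x, K)\<in>\<D>. integral K ?h)"
      using integral_combine_tagged_division_topdown[of ?h s t \<D>] D
      by (auto intro!: integrable_continuous_real continuous_intros cf cg)
    have 3: "(\<Sum>(x, K)\<in>\<D>. Sup K - Inf K) = t - s"
      using additive_tagged_division_1[OF st D, of "\<lambda>r. r"] by simp
    have 4: "(\<Sum>(x, K)\<in>\<D>. f x * (g (Sup K) - g (Inf K))) - (f t * g t - f s * g s - integral {s..t} ?h)
      = (\<Sum>(x, K)\<in>\<D>. f x * (g (Sup K) - g (Inf K)) - (?F K - integral K ?h))"
      unfolding 1[symmetric] 2 by (simp add: sum_subtractf split_def)
    have "\<bar>\<Sum>(x, K)\<in>\<D>. f x * (g (Sup K) - g (Inf K)) - (?F K - integral K ?h)\<bar>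
      \<le> (\<Sum>(x, K)\<in>\<D>. e * M * (Sup K - Inf K))"
    proof (rule order_trans[OF sum_abs], rule sum_mono, clarify)
      fix x K assume xK: "(x, K) \<in> \<D>"
      obtain u v where K: "K = {u..v}" using tagged_division_ofD(4)[OF D xK] by auto
      have xm: "x \<in> K" and sub: "K \<subseteq> {s..t}" using tagged_division_ofD(2,3)[OF D xK] by auto
      have ball: "K \<subseteq> ball x (d / 2)" using fine xK by (auto simp: fine_def)
      have uv: "u \<le> x" "x \<le> v" using xm K by auto
      have osc: "\<bar>g r - g r'\<bar> \<le> e" if "r \<in> {u..v}" "r' \<in> {u..v}" for r r'
      proof -
        have "r \<in> ball x (d/2)" "r' \<in> ball x (d/2)" using that ball K by auto
        then have "dist r r' < d" using dist_triangle_half_r[of x r d r'] by simp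
        moreover have "r \<in> {s..t}" "r' \<in> {s..t}" using that sub K by auto
        ultimately have "dist (g r) (g r') < e" by (intro d(2)) auto
        then show ?thesis by (simp add: dist_real_def)
      qed
      have "\<bar>f x * (g v - g u) - (f v * g v - f u * g u - integral {u..v} ?h)\<bar> \<le> e * M * (v - u)"
        using sub K M(2) osc
        by (intro rs_term_estimate uv has_vector_derivative_within_subset[OF f])
          (auto intro: continuous_on_subset[OF cf] continuous_on_subset[OF cg])
      moreover have "Sup K = v" "Inf K = u" using uv K by auto
      ultimately show "\<bar>f x * (g (Sup K) - g (Inf K)) - (?F K - integral K ?h)\<bar> \<le> e * M * (Sup K - Inf K)"
        using K by simp
    qed
    also have "\<dots> = e * M * (t - s)"
      unfolding 3[symmetric] by (simp add: sum_distrib_left split_def)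
    also have "\<dots> \<le> e * (M * (t - s) + 1)" using e by (simp add: algebra_simps)
    also have "\<dots> = \<epsilon> / 2" using pos by (simp add: e_def field_simps)
    also have "\<dots> < \<epsilon>" using \<epsilon> by simp
    finally show "\<bar>(\<Sum>(x, K)\<in>\<D>. f x * (g (Sup K) - g (Inf K))) - (f t * g t - f s * g s - integral {s..t} ?h)\<bar> < \<epsilon>"
      unfolding 4 .
  qed
qed

lemma rs_integral_C1:
  fixes f g f' :: "real \<Rightarrow> real"
  assumes "s \<le> t" "\<And>r. r \<in> {s..t} \<Longrightarrow> (f has_vector_derivative f' r) (at r within {s..t})"
    "continuous_on {s..t} f'" "continuous_on {s..t} g"
  shows "rs_integral s t f g = f t * g t - f s * g s - integral {s..t} (\<lambda>r. g r * f' r)"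
  unfolding rs_integral_def
  using has_rs_integral_C1[OF assms] has_rs_integral_unique by blast

section \<open>Integration by parts and indefinite Riemann-Stieltjes integrals\<close>

lemma has_vector_derivative_continuous_on:
  "(\<And>r. r \<in> S \<Longrightarrow> (f has_vector_derivative f' r) (at r within S)) \<Longrightarrow> continuous_on S f"
  by (meson continuous_on_eq_continuous_within has_vector_derivative_continuous)

lemma integral_by_parts_real:
  fixes f f' g g' :: "real \<Rightarrow> real"
  assumes "s \<le> t" and f: "\<And>r. r \<in> {s..t} \<Longrightarrow> (f has_vector_derivative f' r) (at r within {s..t})"
    and g: "\<And>r. r \<in> {s..t} \<Longrightarrow> (g has_vector_derivative g' r) (at r within {s..t})"
    and c: "continuous_on {s..t} f'" "continuous_on {s..t} g'"
  shows "integral {s..t} (\<lambda>r. f' r * g r) = f t * g t - f s * g s - integral {s..t} (\<lambda>r. f r * g' r)"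
proof -
  have cf: "continuous_on {s..t} f" "continuous_on {s..t} g"
    using has_vector_derivative_continuous_on[OF f] has_vector_derivative_continuous_on[OF g] by simp_all
  have "((\<lambda>r. f r * g' r + f' r * g r) has_integral f t * g t - f s * g s) {s..t}"
    using assms(1) f g by (intro fundamental_theorem_of_calculus has_vector_derivative_mult) auto
  then have "f t * g t - f s * g s = integral {s..t} (\<lambda>r. f r * g' r + f' r * g r)"
    by (simp add: integral_unique)
  also have "\<dots> = integral {s..t} (\<lambda>r. f r * g' r) + integral {s..t} (\<lambda>r. f' r * g r)"
    by (intro integral_add integrable_continuous_real continuous_intros c cf)
  finally show ?thesis by simp
qed

lemma rs_integral_initial_segment:
  fixes f f' w :: "real \<Rightarrow> real"
  assumes "\<And>r. r \<in> {s..t} \<Longrightarrow> (f has_vector_derivative f' r) (at r within {s..t})"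
    "continuous_on {s..t} f'" "continuous_on {s..t} w" "r \<in> {s..t}"
  shows "rs_integral s r f w = f r * w r - f s * w s - integral {s..r} (\<lambda>r. w r * f' r)"
  using assms
  by (intro rs_integral_C1 has_vector_derivative_within_subset[OF assms(1)])
    (auto intro: continuous_on_subset[OF assms(2)] continuous_on_subset[OF assms(3)])

text \<open>The integrator may have unbounded variation. Summation by parts nevertheless exhibits
  the indefinite integral as a product with \<open>w\<close>, up to a constant, minus an ordinary
  indefinite integral.\<close>

lemma continuous_on_rs_integral:
  fixes f f' w :: "real \<Rightarrow> real"
  assumes f: "\<And>r. r \<in> {s..t} \<Longrightarrow> (f has_vector_derivative f' r) (at r within {s..t})"
    and c: "continuous_on {s..t} f'" "continuous_on {s..t} w"
  shows "continuous_on {s..t} (\<lambda>r. rs_integral s r f w)"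
proof -
  have "continuous_on {s..t} (\<lambda>r. f r * w r - f s * w s - integral {s..r} (\<lambda>r. w r * f' r))"
    by (intro continuous_intros has_vector_derivative_continuous_on[OF f] c
        indefinite_integral_continuous_1 integrable_continuous_real)
  then show ?thesis
    by (rule continuous_on_eq) (rule rs_integral_initial_segment[OF assms, symmetric])
qed

text \<open>With R(r) the integral of f dw over [s,r], this is integration of \<phi> against dR. R
  is merely continuous, so all Riemann-Stieltjes integrals are rewritten as ordinary ones; what
  remains is a classical partial integration of J(r), the integral of w f' over [s,r], against
  \<phi>'.\<close>

lemma rs_integral_by_parts:
  fixes f f' \<phi> \<phi>' w :: "real \<Rightarrow> real"
  assumes "s \<le> t" and f: "\<And>r. r \<in> {s..t} \<Longrightarrow> (f has_vector_derivative f' r) (at r within {s..t})"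
    and \<phi>: "\<And>r. r \<in> {s..t} \<Longrightarrow> (\<phi> has_vector_derivative \<phi>' r) (at r within {s..t})"
    and c: "continuous_on {s..t} f'" "continuous_on {s..t} \<phi>'" and w: "continuous_on {s..t} w"
  shows "rs_integral s t (\<lambda>r. f r * \<phi> r) w =
    rs_integral s t f w * \<phi> t - integral {s..t} (\<lambda>r. rs_integral s r f w * \<phi>' r)"
proof -
  have cf: "continuous_on {s..t} f" "continuous_on {s..t} \<phi>"
    using has_vector_derivative_continuous_on[OF f] has_vector_derivative_continuous_on[OF \<phi>] by simp_all
  define J where "J r = integral {s..r} (\<lambda>r. w r * f' r)" for r
  have J: "(J has_vector_derivative w r * f' r) (at r within {s..t})" if "r \<in> {s..t}" for r
    unfolding J_def using that
    by (intro integral_has_vector_derivative[where f = "\<lambda>r. w r * f' r"] continuous_intros c w)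
  have cJ: "continuous_on {s..t} J" by (rule has_vector_derivative_continuous_on[OF J])
  have 1: "rs_integral s t (\<lambda>r. f r * \<phi> r) w
     = f t * \<phi> t * w t - f s * \<phi> s * w s - integral {s..t} (\<lambda>r. w r * (f r * \<phi>' r + f' r * \<phi> r))"
    using f \<phi> by (intro rs_integral_C1 assms(1) has_vector_derivative_mult continuous_intros c cf w) auto
  have 2: "integral {s..t} (\<lambda>r. w r * (f r * \<phi>' r + f' r * \<phi> r))
     = integral {s..t} (\<lambda>r. w r * f r * \<phi>' r) + integral {s..t} (\<lambda>r. w r * f' r * \<phi> r)"
    by (subst integral_add[symmetric])
      (auto intro!: integrable_continuous_real continuous_intros c cf w simp: algebra_simps)
  have 3: "integral {s..t} (\<lambda>r. w r * f' r * \<phi> r) = J t * \<phi> t - integral {s..t} (\<lambda>r. J r * \<phi>' r)"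
    using integral_by_parts_real[OF assms(1) J \<phi>] by (auto intro!: continuous_intros c w simp: J_def)
  have i1: "(\<lambda>r. w r * f r * \<phi>' r) integrable_on {s..t}"
    and i2: "(\<lambda>r. f s * w s * \<phi>' r) integrable_on {s..t}"
    and i3: "(\<lambda>r. J r * \<phi>' r) integrable_on {s..t}"
    by (intro integrable_continuous_real continuous_intros c cf w cJ)+
  have "integral {s..t} (\<lambda>r. rs_integral s r f w * \<phi>' r)
     = integral {s..t} (\<lambda>r. w r * f r * \<phi>' r - f s * w s * \<phi>' r - J r * \<phi>' r)"
  proof (rule integral_cong)
    fix r assume r: "r \<in> {s..t}"
    show "rs_integral s r f w * \<phi>' r = w r * f r * \<phi>' r - f s * w s * \<phi>' r - J r * \<phi>' r"
      using rs_integral_initial_segment[OF f c(1) w r] by (simp add: J_def right_diff_distrib mult.commute)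
  qed
  also have "\<dots> = integral {s..t} (\<lambda>r. w r * f r * \<phi>' r) - f s * w s * integral {s..t} \<phi>' - integral {s..t} (\<lambda>r. J r * \<phi>' r)"
    using i1 i2 i3 by (simp add: integral_diff integrable_diff)
  also have "integral {s..t} \<phi>' = \<phi> t - \<phi> s"
    using assms(1) \<phi> by (intro integral_unique fundamental_theorem_of_calculus) auto
  finally have 4: "integral {s..t} (\<lambda>r. rs_integral s r f w * \<phi>' r) =
    integral {s..t} (\<lambda>r. w r * f r * \<phi>' r) - f s * w s * (\<phi> t - \<phi> s) - integral {s..t} (\<lambda>r. J r * \<phi>' r)" .
  have 5: "rs_integral s t f w = f t * w t - f s * w s - J t"
    unfolding J_def using assms(1) by (intro rs_integral_initial_segment[OF f c(1) w]) auto
  show ?thesis unfolding 1 2 3 4 5 by (simp add: algebra_simps)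
qed

section \<open>Fundamental lemmas of the calculus of variations\<close>

text \<open>The weight vanishes at both ends, which makes the weighted H an admissible test
  function, and it is positive inside, so H vanishes on the open interval. Continuity extends this
  to the ends.\<close>

lemma integral_weighted_square_eq_0:
  fixes H :: "real \<Rightarrow> real"
  assumes st: "s < t" and H: "continuous_on {s..t} H"
    and 0: "integral {s..t} (\<lambda>r. H r * ((r - s) * (t - r) * H r)) = 0" and "r \<in> {s..t}"
  shows "H r = 0"
proof -
  have "\<forall>r\<in>{s..t}. H r * ((r - s) * (t - r) * H r) = 0"
  proof (subst integral_eq_0_iff[symmetric])
    fix r assume "r \<in> {s..t}"
    then have "(r - s) * (t - r) * (H r * H r) \<ge> 0" by simp
    then show "H r * ((r - s) * (t - r) * H r) \<ge> 0" by (simp only: ac_simps)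
  qed (use st 0 in \<open>auto intro!: continuous_intros H\<close>)
  then have z: "H r = 0" if "r \<in> {s<..<t}" for r using that by force
  have "continuous_on (closure {s<..<t}) H" using H st by simp
  from continuous_constant_on_closure[OF this z] show ?thesis using st assms(4) by auto
qed

lemma fundamental_lemma_variations:
  fixes H :: "real \<Rightarrow> real"
  assumes "s < t" and H: "continuous_on {s..t} H"
    and test: "\<And>\<psi>. continuous_on {s..t} \<psi> \<Longrightarrow> \<psi> s = 0 \<Longrightarrow> \<psi> t = 0 \<Longrightarrow>
      integral {s..t} (\<lambda>r. H r * \<psi> r) = 0" and "r \<in> {s..t}"
  shows "H r = 0"
  by (rule integral_weighted_square_eq_0[OF assms(1) H test assms(4)]) (auto intro!: continuous_intros H)

text \<open>Constant continuation beyond [s,t]; for a function that vanishes at s and t this is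
  extension by zero.\<close>

lemma continuous_on_clamp:
  fixes \<psi> :: "real \<Rightarrow> real"
  assumes "continuous_on {s..t} \<psi>" "s \<le> t" shows "continuous_on S (\<lambda>r. \<psi> (max s (min r t)))"
  by (rule continuous_on_compose2[OF assms(1)]) (use assms(2) in \<open>auto intro!: continuous_intros\<close>)

text \<open>The inner products of basis vectors are Kronecker deltas. The coefficient is an argument
  of f so that it may sit inside an integral.\<close>

lemma sum_Basis_single:
  fixes f :: "'a::euclidean_space \<Rightarrow> real \<Rightarrow> real"
  assumes "j \<in> Basis" "\<And>k. k \<in> Basis \<Longrightarrow> k \<noteq> j \<Longrightarrow> f k 0 = 0"
  shows "(\<Sum>k\<in>Basis. f k (j \<bullet> k)) = f j 1"
proof -
  have "(\<Sum>k\<in>Basis. f k (j \<bullet> k)) = (\<Sum>k\<in>Basis. if k = j then f j 1 else 0)"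
    using assms by (intro sum.cong refl) (auto simp: inner_Basis)
  then show ?thesis using assms(1) by simp
qed

text \<open>Test fields that point in the single direction j isolate the coefficient
  \<open>H j\<close>; the scalar test functions on [s,t] are extended by zero to [a,b].\<close>

lemma vanishing_coefficients:
  fixes H :: "'a::euclidean_space \<Rightarrow> real \<Rightarrow> real"
  assumes st: "a \<le> s" "s < t" "t \<le> b" and j: "j \<in> Basis" and H: "continuous_on {s..t} (H j)"
    and test: "\<And>\<beta>. continuous_on {a..b} \<beta> \<Longrightarrow> (\<And>r. r \<notin> {s<..<t} \<Longrightarrow> \<beta> r = 0) \<Longrightarrow>
      (\<Sum>k\<in>Basis. integral {s..t} (\<lambda>r. H k r * (\<beta> r \<bullet> k))) = 0"
    and "r \<in> {s..t}"
  shows "H j r = 0"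
proof (rule fundamental_lemma_variations[OF st(2) H _ assms(7)])
  fix \<psi> :: "real \<Rightarrow> real" assume \<psi>: "continuous_on {s..t} \<psi>" "\<psi> s = 0" "\<psi> t = 0"
  let ?\<psi> = "\<lambda>r. \<psi> (max s (min r t))"
  have "(\<Sum>k\<in>Basis. integral {s..t} (\<lambda>r. H k r * (?\<psi> r *\<^sub>R j \<bullet> k))) = 0"
    using st \<psi>(2,3) by (intro test continuous_intros continuous_on_clamp[OF \<psi>(1)]) (auto simp: max_def min_def)
  then have "integral {s..t} (\<lambda>r. H j r * (?\<psi> r * 1)) = 0"
    using sum_Basis_single[OF j, of "\<lambda>k x. integral {s..t} (\<lambda>r. H k r * (?\<psi> r * x))"] by simp
  moreover have "integral {s..t} (\<lambda>r. H j r * (?\<psi> r * 1)) = integral {s..t} (\<lambda>r. H j r * \<psi> r)"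
    by (rule integral_cong) (simp add: max_def min_def)
  ultimately show "integral {s..t} (\<lambda>r. H j r * \<psi> r) = 0" by simp
qed

text \<open>The test functions vanish at the ends because \<psi> will be the time derivative of a
  variation that is extended by zero and has to stay C1. The classical choice, H minus its mean,
  violates this; hence the weight (r - s)(t - r) and the mean m of H with respect to this
  weight.\<close>

lemma du_bois_reymond:
  fixes H :: "real \<Rightarrow> real"
  assumes st: "s < t" and H: "continuous_on {s..t} H"
    and test: "\<And>\<psi>. continuous_on {s..t} \<psi> \<Longrightarrow> \<psi> s = 0 \<Longrightarrow> \<psi> t = 0 \<Longrightarrow> integral {s..t} \<psi> = 0 \<Longrightarrow>
      integral {s..t} (\<lambda>r. H r * \<psi> r) = 0" and "r \<in> {s..t}"
  shows "H r = H s"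
proof -
  let ?\<omega> = "\<lambda>r. (r - s) * (t - r)"
  have \<omega>: "integral {s..t} ?\<omega> \<noteq> 0"
  proof
    assume "integral {s..t} ?\<omega> = 0"
    then have "\<forall>r\<in>{s..t}. ?\<omega> r = 0"
      by (subst (asm) integral_eq_0_iff) (use st in \<open>auto intro!: continuous_intros mult_nonneg_nonneg\<close>)
    moreover have "(s + t) / 2 \<in> {s..t}" using st by auto
    ultimately have "((s + t) / 2 - s) * (t - (s + t) / 2) = 0" by blast
    moreover have "(s + t) / 2 - s > 0" "t - (s + t) / 2 > 0" using st by (simp_all add: field_simps)
    ultimately show False by simp
  qed
  define m where "m = integral {s..t} (\<lambda>r. ?\<omega> r * H r) / integral {s..t} ?\<omega>"
  let ?\<psi> = "\<lambda>r. ?\<omega> r * (H r - m)"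
  have c: "continuous_on {s..t} ?\<psi>" by (intro continuous_intros H)
  have "integral {s..t} ?\<psi> = integral {s..t} (\<lambda>r. ?\<omega> r * H r - m * ?\<omega> r)"
    by (simp add: algebra_simps)
  also have "\<dots> = integral {s..t} (\<lambda>r. ?\<omega> r * H r) - m * integral {s..t} ?\<omega>"
    by (subst integral_diff) (auto intro!: integrable_continuous_real continuous_intros H)
  also have "\<dots> = 0" using \<omega> by (simp add: m_def)
  finally have i0: "integral {s..t} ?\<psi> = 0" .
  have "integral {s..t} (\<lambda>r. (H r - m) * ?\<psi> r) = integral {s..t} (\<lambda>r. H r * ?\<psi> r - m * ?\<psi> r)"
    by (simp only: left_diff_distrib)
  also have "\<dots> = integral {s..t} (\<lambda>r. H r * ?\<psi> r) - m * integral {s..t} ?\<psi>"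
    by (subst integral_diff) (auto intro!: integrable_continuous_real continuous_intros H)
  also have "\<dots> = 0" using test[OF c] i0 by simp
  finally have z: "integral {s..t} (\<lambda>r. (H r - m) * ?\<psi> r) = 0" .
  have "H r - m = 0" if "r \<in> {s..t}" for r
    by (rule integral_weighted_square_eq_0[OF st _ z that]) (intro continuous_intros H)
  from this[OF assms(4)] this[of s] st show ?thesis by simp
qed

section \<open>Differentiation under the integral sign\<close>

lemma has_real_derivative_integral:
  fixes F :: "real \<Rightarrow> real \<Rightarrow> real"
  assumes c: "\<forall>\<^sub>F h in nhds 0. continuous_on {s..t} (F h)"
    and u: "uniform_limit {s..t} (\<lambda>h r. (F h r - F 0 r) /\<^sub>R h) k (at 0)"
  shows "((\<lambda>h. integral {s..t} (F h)) has_real_derivative integral {s..t} k) (at 0)"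
proof -
  have c0: "continuous_on {s..t} (F 0)" using c by (rule eventually_nhds_x_imp_x)
  have c': "\<forall>\<^sub>F h in at 0. continuous_on {s..t} (F h)"
    using c by (simp add: eventually_at_filter eventually_mono)
  \<comment> \<open>The theorem on integrals of uniform limits asks for continuity at every h,
    whereas it is known only near 0; elsewhere the quotient is replaced by 0.\<close>
  define G where "G h = (if continuous_on {s..t} (F h) then (\<lambda>r. (F h r - F 0 r) /\<^sub>R h) else (\<lambda>r. 0))" for h
  have u': "uniform_limit {s..t} G k (at 0)"
    by (rule uniform_limit_cong[THEN iffD1, OF _ _ u]) (use c' in \<open>auto simp: G_def elim: eventually_mono\<close>)
  obtain I J where I: "\<And>h. (G h has_integral I h) {s..t}" and J: "(k has_integral J) {s..t}"
    and lim: "(I \<longlongrightarrow> J) (at 0)"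
    by (rule uniform_limit_integral[OF u']) (auto simp: G_def intro!: continuous_intros c0)
  have "\<forall>\<^sub>F h in at 0. I h = (integral {s..t} (F h) - integral {s..t} (F 0)) / h"
    using c'
  proof eventually_elim
    case (elim h)
    have "I h = integral {s..t} (G h)" using integral_unique[OF I] by simp
    also have "\<dots> = integral {s..t} (\<lambda>r. (F h r - F 0 r) /\<^sub>R h)" using elim by (simp add: G_def)
    also have "\<dots> = integral {s..t} (\<lambda>r. F h r - F 0 r) /\<^sub>R h" by (rule integral_cmul)
    also have "integral {s..t} (\<lambda>r. F h r - F 0 r) = integral {s..t} (F h) - integral {s..t} (F 0)"
      using elim c0 by (intro integral_diff integrable_continuous_real)
    finally show ?case by (simp add: divide_inverse mult.commute)
  qed
  then have "((\<lambda>h. (integral {s..t} (F h) - integral {s..t} (F 0)) / h) \<longlongrightarrow> J) (at 0)"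
    using lim by (simp add: tendsto_cong)
  then show ?thesis using J by (simp add: DERIV_def integral_unique)
qed

section \<open>The action in coordinates and its first variation\<close>

lemma C1_deriv_on_has_vector_derivative:
  assumes "C1_deriv_on U f f'" "(x has_vector_derivative y) (at r within S)" "x r \<in> U"
  shows "((\<lambda>r. f (x r)) has_vector_derivative f' (x r) y) (at r within S)"
proof -
  have f: "(f has_derivative f' (x r)) (at (x r))" using assms C1_deriv_onD by blast
  have "((\<lambda>r. f (x r)) has_derivative (\<lambda>h. f' (x r) (h *\<^sub>R y))) (at r within S)"
    using has_derivative_compose[OF assms(2)[unfolded has_vector_derivative_def] f] .
  moreover have "f' (x r) (h *\<^sub>R y) = h *\<^sub>R f' (x r) y" for h
    using has_derivative_linear[OF f] by (rule linear_scale)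
  ultimately show ?thesis by (simp add: has_vector_derivative_def)
qed

lemma derivative_pairing_has_vector_derivative:
  assumes f: "C1_deriv_on U f f'" "\<And>v. C1_deriv_on U (\<lambda>x. f' x v) (f2 v)" "open U"
    and x: "(x has_vector_derivative y) (at r within S)" "x r \<in> U"
    and \<xi>: "(\<xi> has_vector_derivative \<xi>') (at r within S)"
  shows "((\<lambda>r. f' (x r) (\<xi> r)) has_vector_derivative f2 (\<xi> r) (x r) y + f' (x r) \<xi>') (at r within S)"
  using C1_deriv_on_has_vector_derivative[OF C1_deriv_on_derivative_pairing[OF f]
      has_vector_derivative_Pair[OF x(1) \<xi>]] x(2) by simp

lemma rs_integral_sum:
  fixes f f' :: "'i \<Rightarrow> real \<Rightarrow> real"
  assumes "finite I" "s \<le> t"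
    and f: "\<And>i r. i \<in> I \<Longrightarrow> r \<in> {s..t} \<Longrightarrow> (f i has_vector_derivative f' i r) (at r within {s..t})"
    and c: "\<And>i. i \<in> I \<Longrightarrow> continuous_on {s..t} (f' i)" and w: "continuous_on {s..t} w"
  shows "rs_integral s t (\<lambda>r. \<Sum>i\<in>I. f i r) w = (\<Sum>i\<in>I. rs_integral s t (f i) w)"
proof -
  have 1: "rs_integral s t (\<lambda>r. \<Sum>i\<in>I. f i r) w
      = (\<Sum>i\<in>I. f i t) * w t - (\<Sum>i\<in>I. f i s) * w s - integral {s..t} (\<lambda>r. w r * (\<Sum>i\<in>I. f' i r))"
    using f c by (intro rs_integral_C1 assms(2) w has_vector_derivative_sum continuous_intros) auto
  have 2: "integral {s..t} (\<lambda>r. w r * (\<Sum>i\<in>I. f' i r)) = (\<Sum>i\<in>I. integral {s..t} (\<lambda>r. w r * f' i r))"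
    unfolding sum_distrib_left using assms(1)
    by (intro integral_sum integrable_continuous_real continuous_intros w c)
  have 3: "rs_integral s t (f i) w = f i t * w t - f i s * w s - integral {s..t} (\<lambda>r. w r * f' i r)"
    if "i \<in> I" for i using that by (intro rs_integral_C1 assms(2) f c w)
  show ?thesis unfolding 1 2 by (simp add: 3 sum_subtractf sum_distrib_right)
qed

text \<open>A point \<open>(x, y, u, \<pi>)\<close> collects the coordinates of the position, of its time derivative, of
  the velocity variable and of the momentum. The noise enters through
  \<open>\<integral> \<gamma>(x) dw = [\<gamma>(x) w] - \<integral> w \<gamma>'(x) y dt\<close>.\<close>

locale coordinate_action =
  fixes U :: "'e::euclidean_space set" and \<l> :: "'e \<times> 'e \<Rightarrow> real" and \<l>' :: "'e \<times> 'e \<Rightarrow> 'e \<times> 'e \<Rightarrow> real"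
    and m :: nat and \<gamma> :: "nat \<Rightarrow> 'e \<Rightarrow> real" and \<gamma>' :: "nat \<Rightarrow> 'e \<Rightarrow> 'e \<Rightarrow> real"
    and \<gamma>2 :: "nat \<Rightarrow> 'e \<Rightarrow> 'e \<Rightarrow> 'e \<Rightarrow> real" and w :: "nat \<Rightarrow> real \<Rightarrow> real" and s t :: real
  assumes st: "s \<le> t" and U: "open U" and \<l>: "C1_deriv_on (U \<times> UNIV) \<l> \<l>'"
    and \<gamma>: "\<And>i. i \<in> {1..m} \<Longrightarrow> C1_deriv_on U (\<gamma> i) (\<gamma>' i)"
    and \<gamma>2: "\<And>i v. i \<in> {1..m} \<Longrightarrow> C1_deriv_on U (\<lambda>x. \<gamma>' i x v) (\<gamma>2 i v)"
    and w: "\<And>i. i \<in> {1..m} \<Longrightarrow> continuous_on {s..t} (w i)"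
begin

definition hp_term :: "'e \<times> 'e \<times> 'e \<times> 'e \<Rightarrow> real" where
  "hp_term z = \<l> (fst z, fst (snd (snd z))) + snd (snd (snd z)) \<bullet> (fst (snd z) - fst (snd (snd z)))"

definition hp_term' :: "'e \<times> 'e \<times> 'e \<times> 'e \<Rightarrow> 'e \<times> 'e \<times> 'e \<times> 'e \<Rightarrow> real" where
  "hp_term' z k = \<l>' (fst z, fst (snd (snd z))) (fst k, fst (snd (snd k))) +
     (snd (snd (snd z)) \<bullet> (fst (snd k) - fst (snd (snd k))) +
      snd (snd (snd k)) \<bullet> (fst (snd z) - fst (snd (snd z))))"

definition noise_term :: "nat \<Rightarrow> 'e \<times> 'e \<times> 'e \<times> 'e \<Rightarrow> real" where
  "noise_term i z = \<gamma>' i (fst z) (fst (snd z))"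

definition noise_term' :: "nat \<Rightarrow> 'e \<times> 'e \<times> 'e \<times> 'e \<Rightarrow> 'e \<times> 'e \<times> 'e \<times> 'e \<Rightarrow> real" where
  "noise_term' i z k = \<gamma>2 i (fst (snd z)) (fst z) (fst k) + \<gamma>' i (fst z) (fst (snd k))"

definition action :: "(real \<Rightarrow> 'e \<times> 'e \<times> 'e \<times> 'e) \<Rightarrow> real" where
  "action \<kappa> = integral {s..t} (\<lambda>r. hp_term (\<kappa> r) - (\<Sum>i=1..m. w i r * noise_term i (\<kappa> r))) +
     (\<Sum>i=1..m. \<gamma> i (fst (\<kappa> t)) * w i t - \<gamma> i (fst (\<kappa> s)) * w i s)"

definition action' ::
  "(real \<Rightarrow> 'e \<times> 'e \<times> 'e \<times> 'e) \<Rightarrow> (real \<Rightarrow> 'e \<times> 'e \<times> 'e \<times> 'e) \<Rightarrow> real" where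
  "action' \<kappa> \<delta> =
     integral {s..t} (\<lambda>r. hp_term' (\<kappa> r) (\<delta> r) - (\<Sum>i=1..m. w i r * noise_term' i (\<kappa> r) (\<delta> r))) +
     (\<Sum>i=1..m. \<gamma>' i (fst (\<kappa> t)) (fst (\<delta> t)) * w i t - \<gamma>' i (fst (\<kappa> s)) (fst (\<delta> s)) * w i s)"

lemma C1_hp_term: "C1_deriv_on (U \<times> UNIV) hp_term hp_term'"
proof -
  have 1: "C1_deriv_on (U \<times> UNIV) (\<lambda>z::'e \<times> 'e \<times> 'e \<times> 'e. (fst z, fst (snd (snd z))))
      (\<lambda>_ k. (fst k, fst (snd (snd k))))"
    by (rule C1_deriv_on_linear) (intro bounded_linear_intros)
  have 2: "C1_deriv_on (U \<times> UNIV) (\<lambda>z::'e \<times> 'e \<times> 'e \<times> 'e. snd (snd (snd z)))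
      (\<lambda>_ k. snd (snd (snd k)))"
    by (rule C1_deriv_on_linear) (intro bounded_linear_intros)
  have 3: "C1_deriv_on (U \<times> UNIV) (\<lambda>z::'e \<times> 'e \<times> 'e \<times> 'e. fst (snd z) - fst (snd (snd z)))
      (\<lambda>_ k. fst (snd k) - fst (snd (snd k)))"
    by (rule C1_deriv_on_linear) (intro bounded_linear_intros)
  show ?thesis
    unfolding hp_term_def[abs_def] hp_term'_def[abs_def]
    by (intro C1_deriv_on_add C1_deriv_on_inner 2 3 C1_deriv_on_compose[OF 1 \<l>]) auto
qed

lemma C1_noise_term:
  assumes "i \<in> {1..m}" shows "C1_deriv_on (U \<times> UNIV) (noise_term i) (noise_term' i)"
proof -
  have 1: "C1_deriv_on (U \<times> UNIV) (\<lambda>z::'e \<times> 'e \<times> 'e \<times> 'e. (fst z, fst (snd z))) (\<lambda>_ k. (fst k, fst (snd k)))"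
    by (rule C1_deriv_on_linear) (intro bounded_linear_intros)
  show ?thesis
    using C1_deriv_on_compose[OF 1 C1_deriv_on_derivative_pairing[OF \<gamma>[OF assms] \<gamma>2[OF assms] U]]
    unfolding noise_term_def[abs_def] noise_term'_def[abs_def] by (simp add: image_subset_iff)
qed

text \<open>The slots for the position and for its time derivative are treated as independent here.
  Differentiability is then the uniform chain rule for the integrand together with a pointwise limit
  at the two ends. The noise paths are only continuous, but they do not move with h.\<close>

lemma action_has_derivative:
  assumes \<kappa>: "\<forall>\<^sub>F h in nhds 0. continuous_on {s..t} (\<kappa> h) \<and> \<kappa> h ` {s..t} \<subseteq> U \<times> UNIV"
    and \<delta>: "continuous_on {s..t} \<delta>"
    and lim: "uniform_limit {s..t} (\<lambda>h r. (\<kappa> h r - \<kappa> 0 r) /\<^sub>R h) \<delta> (at 0)"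
  shows "((\<lambda>h. action (\<kappa> h)) has_real_derivative action' (\<kappa> 0) \<delta>) (at 0)"
proof -
  have \<kappa>0: "continuous_on {s..t} (\<kappa> 0)" "\<kappa> 0 ` {s..t} \<subseteq> U \<times> UNIV"
    using eventually_nhds_x_imp_x[OF \<kappa>] by auto
  have oU: "open (U \<times> (UNIV :: ('e \<times> 'e \<times> 'e) set))" using U by (intro open_Times) auto
  have K: "compact (\<kappa> 0 ` {s..t})" by (intro compact_continuous_image \<kappa>0) auto
  have bd: "bounded (\<delta> ` {s..t})" by (intro compact_imp_bounded compact_continuous_image \<delta>) auto
  note ul = uniform_limit_difference_quotient_compose(2)[OF oU _ K \<kappa>0(2) bd lim]
  have c: "continuous_on {s..t} (\<lambda>r. f (\<kappa> h r))"
    if "C1_deriv_on (U \<times> UNIV) f f'" "continuous_on {s..t} (\<kappa> h)" "\<kappa> h ` {s..t} \<subseteq> U \<times> UNIV"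
    for f :: "_ \<Rightarrow> real" and f' h
    using continuous_on_compose2[OF C1_deriv_on_continuous[OF that(1)] that(2,3)] .
  have c': "continuous_on {s..t} (\<lambda>r. f' (\<kappa> 0 r) (\<delta> r))"
    if "C1_deriv_on (U \<times> UNIV) f f'" for f :: "_ \<Rightarrow> real" and f'
    using \<kappa>0 by (intro C1_deriv_on_joint_continuous[OF that] \<delta>) auto
  have wl: "uniform_limit {s..t}
      (\<lambda>h r. (w i r * noise_term i (\<kappa> h r) - w i r * noise_term i (\<kappa> 0 r)) /\<^sub>R h)
      (\<lambda>r. w i r * noise_term' i (\<kappa> 0 r) (\<delta> r)) (at 0)" if "i \<in> {1..m}" for i
  proof -
    have "uniform_limit {s..t} (\<lambda>h r. w i r * ((noise_term i (\<kappa> h r) - noise_term i (\<kappa> 0 r)) /\<^sub>R h))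
      (\<lambda>r. w i r * noise_term' i (\<kappa> 0 r) (\<delta> r)) (at 0)"
      by (intro uniform_lim_mult uniform_limit_const ul[OF C1_noise_term[OF that]]
          compact_imp_bounded compact_continuous_image w[OF that] c'[OF C1_noise_term[OF that]]) auto
    then show ?thesis by (simp add: algebra_simps)
  qed
  have sl: "uniform_limit {s..t}
      (\<lambda>h r. \<Sum>i\<in>I. (w i r * noise_term i (\<kappa> h r) - w i r * noise_term i (\<kappa> 0 r)) /\<^sub>R h)
      (\<lambda>r. \<Sum>i\<in>I. w i r * noise_term' i (\<kappa> 0 r) (\<delta> r)) (at 0)" if "I \<subseteq> {1..m}" "finite I" for I
    using that(2,1)
  proof (induction I)
    case (insert i I)
    then have "i \<in> {1..m}" "I \<subseteq> {1..m}" by auto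
    from uniform_limit_add[OF wl[OF this(1)] insert.IH[OF this(2)]] show ?case
      using insert.hyps by simp
  qed (simp add: uniform_limit_const)
  have "uniform_limit {s..t}
      (\<lambda>h r. (hp_term (\<kappa> h r) - hp_term (\<kappa> 0 r)) /\<^sub>R h -
         (\<Sum>i=1..m. (w i r * noise_term i (\<kappa> h r) - w i r * noise_term i (\<kappa> 0 r)) /\<^sub>R h))
      (\<lambda>r. hp_term' (\<kappa> 0 r) (\<delta> r) - (\<Sum>i=1..m. w i r * noise_term' i (\<kappa> 0 r) (\<delta> r))) (at 0)"
    by (intro uniform_limit_minus ul[OF C1_hp_term] sl) auto
  then have lim': "uniform_limit {s..t}
      (\<lambda>h r. ((hp_term (\<kappa> h r) - (\<Sum>i=1..m. w i r * noise_term i (\<kappa> h r))) -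
              (hp_term (\<kappa> 0 r) - (\<Sum>i=1..m. w i r * noise_term i (\<kappa> 0 r)))) /\<^sub>R h)
      (\<lambda>r. hp_term' (\<kappa> 0 r) (\<delta> r) - (\<Sum>i=1..m. w i r * noise_term' i (\<kappa> 0 r) (\<delta> r))) (at 0)"
    by (simp only: scaleR_sum_right[symmetric] sum_subtractf scaleR_right_diff_distrib diff_diff_eq2)
       (simp add: algebra_simps)
  have 1: "((\<lambda>h. integral {s..t} (\<lambda>r. hp_term (\<kappa> h r) - (\<Sum>i=1..m. w i r * noise_term i (\<kappa> h r))))
      has_real_derivative
      integral {s..t} (\<lambda>r. hp_term' (\<kappa> 0 r) (\<delta> r) - (\<Sum>i=1..m. w i r * noise_term' i (\<kappa> 0 r) (\<delta> r)))) (at 0)"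
  proof (rule has_real_derivative_integral[OF _ lim'])
    show "\<forall>\<^sub>F h in nhds 0. continuous_on {s..t} (\<lambda>r. hp_term (\<kappa> h r) - (\<Sum>i=1..m. w i r * noise_term i (\<kappa> h r)))"
      using \<kappa> by eventually_elim (auto intro!: continuous_intros w c[OF C1_hp_term] c[OF C1_noise_term])
  qed
  have 2: "((\<lambda>h. \<gamma> i (fst (\<kappa> h r))) has_real_derivative \<gamma>' i (fst (\<kappa> 0 r)) (fst (\<delta> r))) (at 0)"
    if "i \<in> {1..m}" "r \<in> {s..t}" for i r
  proof -
    have "C1_deriv_on (U \<times> UNIV) (\<lambda>z::'e \<times> 'e \<times> 'e \<times> 'e. \<gamma> i (fst z)) (\<lambda>z k. \<gamma>' i (fst z) (fst k))"
      by (rule C1_deriv_on_compose[OF C1_deriv_on_linear[OF bounded_linear_fst] \<gamma>[OF that(1)]]) auto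
    from tendsto_uniform_limitI[OF ul[OF this] that(2)] show ?thesis
      by (simp add: DERIV_def divide_inverse mult.commute)
  qed
  show ?thesis
    unfolding action_def action'_def using st
    by (intro DERIV_add 1 DERIV_sum DERIV_diff DERIV_cmult_right 2) auto
qed

text \<open>Component j of the function E: the right-hand side of the integrated momentum equation
  on [s,r].\<close>

definition momentum_balance :: "(real \<Rightarrow> 'e) \<Rightarrow> (real \<Rightarrow> 'e) \<Rightarrow> 'e \<Rightarrow> real \<Rightarrow> real" where
  "momentum_balance x u j r = integral {s..r} (\<lambda>r. \<l>' (x r, u r) (j, 0)) +
     (\<Sum>i=1..m. rs_integral s r (\<lambda>r. \<gamma>' i (x r) j) (w i))"

section \<open>The first variation along an actual curve, after integration by parts\<close>

context
  fixes x y u \<pi> :: "real \<Rightarrow> 'e"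
  assumes x: "\<And>r. r \<in> {s..t} \<Longrightarrow> (x has_vector_derivative y r) (at r within {s..t})"
    and xU: "\<And>r. r \<in> {s..t} \<Longrightarrow> x r \<in> U"
    and y: "continuous_on {s..t} y" and u: "continuous_on {s..t} u" and \<pi>: "continuous_on {s..t} \<pi>"
begin

lemma continuous_coordinate: "continuous_on {s..t} x"
  by (rule has_vector_derivative_continuous_on[OF x])

lemma continuous_partial_lagrangian: "continuous_on {s..t} (\<lambda>r. \<l>' (x r, u r) k)"
  using xU by (intro C1_deriv_on_joint_continuous[OF \<l>] continuous_intros continuous_coordinate u) auto

lemma gamma_along:
  assumes "i \<in> {1..m}" "r \<in> {s..t}"
  shows "((\<lambda>r. \<gamma>' i (x r) j) has_vector_derivative \<gamma>2 i j (x r) (y r)) (at r within {s..t})"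
  using C1_deriv_on_has_vector_derivative[OF \<gamma>2[OF assms(1)] x[OF assms(2)] xU[OF assms(2)]] .

lemma continuous_gamma_along:
  assumes "i \<in> {1..m}"
  shows "continuous_on {s..t} (\<lambda>r. \<gamma>2 i j (x r) (y r))" "continuous_on {s..t} (\<lambda>r. \<gamma>' i (x r) j)"
  using xU by (auto intro!: C1_deriv_on_joint_continuous[OF \<gamma>2[OF assms]]
      C1_deriv_on_joint_continuous[OF \<gamma>[OF assms]] continuous_coordinate y)

lemma continuous_momentum_balance: "continuous_on {s..t} (momentum_balance x u j)"
  unfolding momentum_balance_def
  by (intro continuous_intros indefinite_integral_continuous_1 integrable_continuous_real
      continuous_partial_lagrangian continuous_on_rs_integral[OF gamma_along] continuous_gamma_along w) auto

text \<open>Since x' = y and \<xi>' = \<eta>, the boundary terms and the second-derivative terms of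
  the noise recombine into the Riemann-Stieltjes integral of \<gamma>'(x) \<xi> against w. Splitting
  it into components and integrating by parts moves all terms with \<xi> onto \<eta>, except for the
  value at t; no value at s remains because E starts at 0 there.\<close>

lemma action'_eq:
  fixes \<xi> \<eta> \<alpha> \<beta> :: "real \<Rightarrow> 'e"
  assumes \<xi>: "\<And>r. r \<in> {s..t} \<Longrightarrow> (\<xi> has_vector_derivative \<eta> r) (at r within {s..t})"
    and \<eta>: "continuous_on {s..t} \<eta>" and \<alpha>: "continuous_on {s..t} \<alpha>" and \<beta>: "continuous_on {s..t} \<beta>"
  shows "action' (\<lambda>r. (x r, y r, u r, \<pi> r)) (\<lambda>r. (\<xi> r, \<eta> r, \<alpha> r, \<beta> r)) =
    (\<Sum>j\<in>Basis. momentum_balance x u j t * (\<xi> t \<bullet> j)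
       + integral {s..t} (\<lambda>r. (\<pi> r \<bullet> j - momentum_balance x u j r) * (\<eta> r \<bullet> j))
       + integral {s..t} (\<lambda>r. (\<l>' (x r, u r) (0, j) - \<pi> r \<bullet> j) * (\<alpha> r \<bullet> j))
       + integral {s..t} (\<lambda>r. (y r \<bullet> j - u r \<bullet> j) * (\<beta> r \<bullet> j)))"
    (is "?lhs = _")
proof -
  let ?a = "\<lambda>j r. \<l>' (x r, u r) (j, 0) * (\<xi> r \<bullet> j)" and ?b = "\<lambda>j r. (\<pi> r \<bullet> j) * (\<eta> r \<bullet> j)"
    and ?c = "\<lambda>j r. (\<l>' (x r, u r) (0, j) - \<pi> r \<bullet> j) * (\<alpha> r \<bullet> j)"
    and ?d = "\<lambda>j r. (y r \<bullet> j - u r \<bullet> j) * (\<beta> r \<bullet> j)"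
    and ?h = "\<lambda>r. hp_term' (x r, y r, u r, \<pi> r) (\<xi> r, \<eta> r, \<alpha> r, \<beta> r)"
  have c\<xi>: "continuous_on {s..t} \<xi>" by (rule has_vector_derivative_continuous_on[OF \<xi>])
  note cs = continuous_intros continuous_coordinate y u \<pi> c\<xi> \<eta> \<alpha> \<beta> w continuous_partial_lagrangian
    continuous_gamma_along continuous_momentum_balance
  let ?R = "\<lambda>i j r. rs_integral s r (\<lambda>r. \<gamma>' i (x r) j) (w i)"
  let ?I = "\<lambda>j r. integral {s..r} (\<lambda>r. \<l>' (x r, u r) (j, 0))"
  let ?Rd = "\<lambda>i j r. ?R i j r * (\<eta> r \<bullet> j)" and ?Id = "\<lambda>j r. ?I j r * (\<eta> r \<bullet> j)"
  have cR: "continuous_on {s..t} (?R i j)" if "i \<in> {1..m}" for i j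
    using that by (intro continuous_on_rs_integral[OF gamma_along] continuous_gamma_along w)
  have cI: "continuous_on {s..t} (?I j)" for j
    by (intro indefinite_integral_continuous_1 integrable_continuous_real continuous_partial_lagrangian)
  have \<xi>j: "((\<lambda>r. \<xi> r \<bullet> j) has_vector_derivative \<eta> r \<bullet> j) (at r within {s..t})" if "r \<in> {s..t}" for r j
    using bounded_linear.has_vector_derivative[OF bounded_linear_inner_left \<xi>[OF that]] .
  let ?N = "\<lambda>i r. \<gamma>2 i (y r) (x r) (\<xi> r) + \<gamma>' i (x r) (\<eta> r)"
  have cN: "continuous_on {s..t} (?N i)" if "i \<in> {1..m}" for i
  proof -
    have "continuous_on {s..t} (\<lambda>r. noise_term' i (x r, y r, u r, \<pi> r) (\<xi> r, \<eta> r, \<alpha> r, \<beta> r))"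
      using xU by (intro C1_deriv_on_joint_continuous[OF C1_noise_term[OF that]] cs) auto
    then show ?thesis by (simp add: noise_term'_def)
  qed
  have noise: "\<gamma>' i (x t) (\<xi> t) * w i t - \<gamma>' i (x s) (\<xi> s) * w i s - integral {s..t} (\<lambda>r. w i r * ?N i r)
     = (\<Sum>j\<in>Basis. ?R i j t * (\<xi> t \<bullet> j) - integral {s..t} (?Rd i j))"
    if i: "i \<in> {1..m}" for i
  proof -
    \<comment> \<open>The variation differentiates \<gamma>'(x) y along \<xi>, whereas the total
      time derivative of \<gamma>'(x) \<xi> differentiates along y. Symmetry of the second
      derivative identifies the two terms.\<close>
    have N: "((\<lambda>r. \<gamma>' i (x r) (\<xi> r)) has_vector_derivative ?N i r) (at r within {s..t})" if "r \<in> {s..t}" for r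
      using derivative_pairing_has_vector_derivative[OF \<gamma>[OF i] \<gamma>2[OF i] U x[OF that] xU[OF that] \<xi>[OF that]]
      by (simp add: symmetric_second_derivative[OF U xU[OF that] \<gamma>[OF i] \<gamma>2[OF i], of "y r"])
    have "\<gamma>' i (x t) (\<xi> t) * w i t - \<gamma>' i (x s) (\<xi> s) * w i s - integral {s..t} (\<lambda>r. w i r * ?N i r)
       = rs_integral s t (\<lambda>r. \<gamma>' i (x r) (\<xi> r)) (w i)"
      using i by (intro rs_integral_C1[symmetric] st N cN w)
    also have "\<dots> = rs_integral s t (\<lambda>r. \<Sum>j\<in>Basis. \<gamma>' i (x r) j * (\<xi> r \<bullet> j)) (w i)"
    proof (rule rs_integral_cong)
      fix r assume r: "r \<in> {s..t}"
      show "\<gamma>' i (x r) (\<xi> r) = (\<Sum>j\<in>Basis. \<gamma>' i (x r) j * (\<xi> r \<bullet> j))"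
        using C1_deriv_on_expansion[OF \<gamma>[OF i] xU[OF r], of "\<xi> r"] by (simp add: mult.commute)
    qed
    also have "\<dots> = (\<Sum>j\<in>Basis. rs_integral s t (\<lambda>r. \<gamma>' i (x r) j * (\<xi> r \<bullet> j)) (w i))"
    proof (rule rs_integral_sum[OF finite_Basis st _ _ w[OF i]])
      fix j :: 'e and r assume "r \<in> {s..t}"
      then show "((\<lambda>r. \<gamma>' i (x r) j * (\<xi> r \<bullet> j)) has_vector_derivative
          \<gamma>' i (x r) j * (\<eta> r \<bullet> j) + \<gamma>2 i j (x r) (y r) * (\<xi> r \<bullet> j)) (at r within {s..t})"
        using i by (intro has_vector_derivative_mult[OF gamma_along \<xi>j])
    qed (use i in \<open>intro cs\<close>)
    also have "\<dots> = (\<Sum>j\<in>Basis. ?R i j t * (\<xi> t \<bullet> j) - integral {s..t} (?Rd i j))"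
      using st i by (intro sum.cong refl rs_integral_by_parts[OF _ gamma_along \<xi>j] cs) auto
    finally show ?thesis .
  qed
  have lag: "integral {s..t} (?a j)
     = ?I j t * (\<xi> t \<bullet> j) - integral {s..t} (?Id j)" for j
    using integral_by_parts_real[OF st integral_has_vector_derivative[OF continuous_partial_lagrangian] \<xi>j]
    by (simp add: cs)
  have hp: "?h r =
      (\<Sum>j\<in>Basis. ?a j r + ?b j r
        + ?c j r + ?d j r)"
    if "r \<in> {s..t}" for r
  proof -
    have xr: "(x r, u r) \<in> U \<times> UNIV" using xU[OF that] by simp
    have lin: "linear (\<l>' (x r, u r))" using C1_deriv_onD[OF \<l> xr] has_derivative_linear by blast
    have "\<l>' (x r, u r) (\<xi> r, \<alpha> r) = \<l>' (x r, u r) (\<xi> r, 0) + \<l>' (x r, u r) (0, \<alpha> r)"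
      using linear_add[OF lin, of "(\<xi> r, 0)" "(0, \<alpha> r)"] by simp
    also have "\<l>' (x r, u r) (\<xi> r, 0) = (\<Sum>j\<in>Basis. ?a j r)"
      using linear_basis_expansion[OF linear_compose[OF _ lin, of "\<lambda>k. (k, 0)"], of "\<xi> r"]
      by (simp add: o_def mult.commute linear_iff)
    also have "\<l>' (x r, u r) (0, \<alpha> r) = (\<Sum>j\<in>Basis. \<l>' (x r, u r) (0, j) * (\<alpha> r \<bullet> j))"
      using linear_basis_expansion[OF linear_compose[OF _ lin, of "\<lambda>k. (0, k)"], of "\<alpha> r"]
      by (simp add: o_def mult.commute linear_iff)
    finally have 1: "\<l>' (x r, u r) (\<xi> r, \<alpha> r) = (\<Sum>j\<in>Basis. ?a j r) +
      (\<Sum>j\<in>Basis. \<l>' (x r, u r) (0, j) * (\<alpha> r \<bullet> j))" .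
    have 2: "\<pi> r \<bullet> (\<eta> r - \<alpha> r) = (\<Sum>j\<in>Basis. (\<pi> r \<bullet> j) * ((\<eta> r - \<alpha> r) \<bullet> j))"
      and 3: "\<beta> r \<bullet> (y r - u r) = (\<Sum>j\<in>Basis. (\<beta> r \<bullet> j) * ((y r - u r) \<bullet> j))"
      by (rule euclidean_inner)+
    show ?thesis
      unfolding hp_term'_def fst_conv snd_conv 1 2 3 sum.distrib[symmetric] inner_diff_left
      by (intro sum.cong refl) (simp add: algebra_simps)
  qed
  have int: "integral {s..t} ?h =
      (\<Sum>j\<in>Basis. integral {s..t} (?a j)
        + integral {s..t} (?b j)
        + integral {s..t} (?c j)
        + integral {s..t} (?d j))"
  proof -
    have "integral {s..t} ?h =
       integral {s..t} (\<lambda>r. \<Sum>j\<in>Basis. ?a j r + ?b j r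
        + ?c j r + ?d j r)"
      using hp by (intro integral_cong)
    also have "\<dots> = (\<Sum>j\<in>Basis. integral {s..t} (\<lambda>r. ?a j r + ?b j r
        + ?c j r + ?d j r))"
      by (intro integral_sum integrable_continuous_real cs) auto
    also have "\<dots> = (\<Sum>j\<in>Basis. integral {s..t} (?a j)
        + integral {s..t} (?b j)
        + integral {s..t} (?c j)
        + integral {s..t} (?d j))"
    proof (rule sum.cong[OF refl])
      fix j :: 'e
      have i: "(?a j) integrable_on {s..t}"
        "(?b j) integrable_on {s..t}"
        "(?c j) integrable_on {s..t}"
        "(?d j) integrable_on {s..t}"
        by (intro integrable_continuous_real cs)+
      show "integral {s..t} (\<lambda>r. ?a j r + ?b j r
        + ?c j r + ?d j r)
        = integral {s..t} (?a j)
        + integral {s..t} (?b j)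
        + integral {s..t} (?c j)
        + integral {s..t} (?d j)"
        using i by (simp only: integral_add integrable_add)
    qed
    finally show ?thesis .
  qed
  have chp: "continuous_on {s..t} ?h"
    using xU by (intro C1_deriv_on_joint_continuous[OF C1_hp_term] cs) auto
  have "integral {s..t} (\<lambda>r. ?h r - (\<Sum>i=1..m. w i r * ?N i r))
     = integral {s..t} ?h -
       integral {s..t} (\<lambda>r. \<Sum>i=1..m. w i r * ?N i r)"
    by (intro integral_diff integrable_continuous_real chp continuous_intros w cN)
  also have "integral {s..t} (\<lambda>r. \<Sum>i=1..m. w i r * ?N i r) = (\<Sum>i=1..m. integral {s..t} (\<lambda>r. w i r * ?N i r))"
    by (intro integral_sum integrable_continuous_real continuous_intros w cN) auto
  finally have "?lhs =
     integral {s..t} ?h +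
     (\<Sum>i=1..m. \<gamma>' i (x t) (\<xi> t) * w i t - \<gamma>' i (x s) (\<xi> s) * w i s - integral {s..t} (\<lambda>r. w i r * ?N i r))"
    unfolding action'_def noise_term'_def by (simp add: sum_subtractf)
  also have "\<dots> = integral {s..t} ?h +
     (\<Sum>i=1..m. \<Sum>j\<in>Basis. ?R i j t * (\<xi> t \<bullet> j) - integral {s..t} (?Rd i j))"
    by (simp only: noise cong: sum.cong)
  also have "(\<Sum>i=1..m. \<Sum>j\<in>Basis. ?R i j t * (\<xi> t \<bullet> j) - integral {s..t} (?Rd i j))
     = (\<Sum>j\<in>Basis. \<Sum>i=1..m. ?R i j t * (\<xi> t \<bullet> j) - integral {s..t} (?Rd i j))"
    by (rule sum.swap)
  finally have total: "?lhs =
     integral {s..t} ?h +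
     (\<Sum>j\<in>Basis. \<Sum>i=1..m. ?R i j t * (\<xi> t \<bullet> j) - integral {s..t} (?Rd i j))" .
  have bal: "integral {s..t} (\<lambda>r. (\<pi> r \<bullet> j - momentum_balance x u j r) * (\<eta> r \<bullet> j)) =
      integral {s..t} (?b j) - integral {s..t} (?Id j) -
      (\<Sum>i=1..m. integral {s..t} (?Rd i j))" for j
  proof -
    have i: "(?b j) integrable_on {s..t}"
      "(?Id j) integrable_on {s..t}"
      "(\<lambda>r. \<Sum>i=1..m. ?Rd i j r) integrable_on {s..t}"
      by (intro integrable_continuous_real continuous_intros \<pi> \<eta> cI cR)+
    have "integral {s..t} (\<lambda>r. (\<pi> r \<bullet> j - momentum_balance x u j r) * (\<eta> r \<bullet> j)) =
       integral {s..t} (\<lambda>r. ?b j r - ?Id j r - (\<Sum>i=1..m. ?Rd i j r))"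
      by (intro integral_cong) (simp add: momentum_balance_def algebra_simps sum_distrib_left)
    also have "\<dots> = integral {s..t} (?b j) - integral {s..t} (?Id j) -
      integral {s..t} (\<lambda>r. \<Sum>i=1..m. ?Rd i j r)"
      using i by (simp only: integral_diff integrable_diff)
    also have "integral {s..t} (\<lambda>r. \<Sum>i=1..m. ?Rd i j r) =
       (\<Sum>i=1..m. integral {s..t} (?Rd i j))"
      by (intro integral_sum integrable_continuous_real continuous_intros \<eta> cR) auto
    finally show ?thesis .
  qed
  show ?thesis
    unfolding total int sum.distrib[symmetric] bal
    by (intro sum.cong refl)
      (simp add: lag momentum_balance_def sum_subtractf sum_distrib_right distrib_right)
qed

end

end

section \<open>Charts and bundle coordinates\<close>

text \<open>Passes from a derivative found by calculation to the canonical
  \<open>frechet_derivative\<close>, in which the transformation laws are phrased.\<close>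

lemma C1_deriv_on_frechetI:
  assumes "C1_deriv_on S f f'"
  shows "C1_deriv_on S f (\<lambda>x. frechet_derivative f (at x))"
  using assms C1_deriv_on_frechet[OF assms] unfolding C1_deriv_on_def
  by (auto cong: continuous_on_cong)

lemma C1_deriv_on_cong:
  assumes "C1_deriv_on S f f'" "open S" "\<And>x. x \<in> S \<Longrightarrow> f x = g x"
  shows "C1_deriv_on S g f'"
  using assms unfolding C1_deriv_on_def by (metis has_derivative_transform_within_open)

text \<open>In this form the momentum part of a change of charts becomes a finite sum of C1
  functions.\<close>

lemma adjoint_basis_expansion:
  fixes f :: "'a::euclidean_space \<Rightarrow> 'b::euclidean_space"
  assumes "linear f"
  shows "adjoint f y = (\<Sum>b\<in>Basis. (y \<bullet> f b) *\<^sub>R b)"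
proof -
  have "adjoint f y \<bullet> b = y \<bullet> f b" for b
    using adjoint_works[OF assms, of b y] by (simp add: inner_commute)
  then show ?thesis using euclidean_representation[of "adjoint f y"] by simp
qed

text \<open>Lets derivatives relative to [a,b] be computed on the relatively open set of times at
  which a curve lies in a given chart.\<close>

lemma at_within_openin:
  assumes "openin (top_of_set T) S" "t \<in> S"
  shows "at t within S = at t within T"
proof -
  obtain V where "open V" "S = T \<inter> V" using assms(1) by (auto simp: openin_open)
  then show ?thesis using assms(2) by (intro at_within_nhd[of t V]) auto
qed

text \<open>Covectors are transported by the adjoint of the derivative of the transition back into
  \<open>c\<close>, in accordance with the momentum slot of
  \<open>pontryagin_transition\<close>.\<close>

definition cotangent_of_coords ::
  "('q, 'e::euclidean_space) chart set \<Rightarrow> ('q, 'e) chart \<Rightarrow> 'q \<Rightarrow> 'e \<Rightarrow> ('q, 'e) fibre" where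
  "cotangent_of_coords A c q \<pi> =
     (\<lambda>d. if d \<in> charts_at A q then adjoint (frechet_derivative (transition d c) (at (snd d q))) \<pi> else 0)"

locale atlas =
  fixes A :: "('q::t2_space, 'e::euclidean_space) chart set"
  assumes atlas: "smooth_atlas A"
begin

abbreviation "D c d x \<equiv> frechet_derivative (transition c d) (at x)"
abbreviation "D2 c d v x \<equiv> frechet_derivative (\<lambda>x. D c d x v) (at x)"
abbreviation "overlap c d \<equiv> snd c ` (fst c \<inter> fst d)"
abbreviation "coord_dom c \<equiv> snd c ` fst c"

lemma open_chart: "c \<in> A \<Longrightarrow> open (fst c)"
  and open_coord_dom: "c \<in> A \<Longrightarrow> open (coord_dom c)"
  and continuous_chart: "c \<in> A \<Longrightarrow> continuous_on (fst c) (snd c)"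
  and continuous_chart_inv: "c \<in> A \<Longrightarrow> continuous_on (coord_dom c) (chart_inv c)"
  and chart_inv_chart [simp]: "c \<in> A \<Longrightarrow> q \<in> fst c \<Longrightarrow> chart_inv c (snd c q) = q"
  using atlas unfolding smooth_atlas_def homeomorphism_def by blast+

lemma chart_inv_in: "c \<in> A \<Longrightarrow> x \<in> coord_dom c \<Longrightarrow> chart_inv c x \<in> fst c"
  by auto

lemma chart_chart_inv [simp]: "c \<in> A \<Longrightarrow> x \<in> coord_dom c \<Longrightarrow> snd c (chart_inv c x) = x"
  by auto

lemma ex_chart: "\<exists>c. c \<in> charts_at A q"
  using atlas unfolding smooth_atlas_def charts_at_def by blast

lemma open_overlap:
  assumes "c \<in> A" "d \<in> A" shows "open (overlap c d)"
proof -
  have "overlap c d = coord_dom c \<inter> chart_inv c -` fst d"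
    using assms by auto
  moreover have "open (coord_dom c \<inter> chart_inv c -` fst d)"
    using assms by (intro continuous_open_preimage continuous_chart_inv open_coord_dom open_chart)
  ultimately show ?thesis by simp
qed

lemma transition_chart [simp]: "c \<in> A \<Longrightarrow> q \<in> fst c \<Longrightarrow> transition c d (snd c q) = snd d q"
  by (simp add: transition_def)

lemma C1_transition:
  assumes "c \<in> A" "d \<in> A"
  shows "C1_deriv_on (overlap c d) (transition c d) (D c d)"
    and "C1_deriv_on (overlap c d) (\<lambda>x. D c d x v) (D2 c d v)"
proof -
  have "Ck_on 2 (overlap c d) (transition c d)"
    using atlas assms unfolding smooth_atlas_def by blast
  from Ck_on_2D[OF this] show "C1_deriv_on (overlap c d) (transition c d) (D c d)"
    and "C1_deriv_on (overlap c d) (\<lambda>x. D c d x v) (D2 c d v)" by auto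
qed

lemma linear_D: "c \<in> A \<Longrightarrow> d \<in> A \<Longrightarrow> x \<in> overlap c d \<Longrightarrow> linear (D c d x)"
  using C1_deriv_onD[OF C1_transition(1)] has_derivative_linear by blast

text \<open>Cocycle rule: near the point the composite of two transitions is the third one, and
  derivatives are unique.\<close>

lemma D_chain:
  assumes "c \<in> A" "d \<in> A" "e \<in> A" "q \<in> fst c" "q \<in> fst d" "q \<in> fst e"
  shows "D d e (snd d q) (D c d (snd c q) u) = D c e (snd c q) u"
proof -
  have 1: "((\<lambda>x. transition d e (transition c d x)) has_derivative (\<lambda>u. D d e (snd d q) (D c d (snd c q) u))) (at (snd c q))"
    using assms C1_deriv_onD[OF C1_transition(1)[OF assms(2,3)], of "snd d q"]
    by (intro has_derivative_compose[of "transition c d" "D c d (snd c q)" "snd c q" UNIV "transition d e" "D d e (snd d q)"]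
        C1_deriv_onD[OF C1_transition(1)[OF assms(1,2)]]) auto
  have op: "open (overlap c d)" using assms by (intro open_overlap)
  have "(transition c e has_derivative (\<lambda>u. D d e (snd d q) (D c d (snd c q) u))) (at (snd c q))"
    by (rule has_derivative_transform_within_open[OF 1 op]) (use assms in auto)
  moreover have "(transition c e has_derivative D c e (snd c q)) (at (snd c q))"
    using assms by (intro C1_deriv_onD[OF C1_transition(1)]) auto
  ultimately show ?thesis by (rule fun_cong[OF has_derivative_unique])
qed

lemma D_self:
  assumes "c \<in> A" "q \<in> fst c" shows "D c c (snd c q) u = u"
proof -
  have "(transition c c has_derivative (\<lambda>u. u)) (at (snd c q))"
    by (rule has_derivative_transform_within_open[OF has_derivative_ident open_coord_dom]) (use assms in auto)
  then show ?thesis by (metis frechet_derivative_at)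
qed

section \<open>Tangent and cotangent vectors from their coordinates in one chart\<close>

lemma tangent_spaceI:
  assumes "\<And>c d. c \<in> charts_at A q \<Longrightarrow> d \<in> charts_at A q \<Longrightarrow> v d = D c d (snd c q) (v c)"
    and "\<And>c. c \<notin> charts_at A q \<Longrightarrow> v c = 0"
  shows "v \<in> tangent_space A q"
  unfolding tangent_space_def using assms by blast

lemma tangent_spaceD:
  assumes "v \<in> tangent_space A q"
  shows "c \<in> charts_at A q \<Longrightarrow> d \<in> charts_at A q \<Longrightarrow> v d = D c d (snd c q) (v c)"
    and "c \<notin> charts_at A q \<Longrightarrow> v c = 0"
  using assms unfolding tangent_space_def by blast+

lemma tangent_of_coords_in:
  assumes "c \<in> charts_at A q" shows "tangent_of_coords A c q u \<in> tangent_space A q"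
proof (rule tangent_spaceI)
  fix d e assume de: "d \<in> charts_at A q" "e \<in> charts_at A q"
  have "D d e (snd d q) (D c d (snd c q) u) = D c e (snd c q) u"
    using de assms by (intro D_chain) (auto simp: charts_at_def)
  then show "tangent_of_coords A c q u e = D d e (snd d q) (tangent_of_coords A c q u d)"
    using de by (simp add: tangent_of_coords_def)
qed (simp add: tangent_of_coords_def)

lemma tangent_of_coords_eq:
  assumes "v \<in> tangent_space A q" "c \<in> charts_at A q" shows "tangent_of_coords A c q (v c) = v"
proof
  fix d
  show "tangent_of_coords A c q (v c) d = v d"
    using tangent_spaceD(1)[OF assms, of d] tangent_spaceD(2)[OF assms(1), of d]
    by (simp add: tangent_of_coords_def)
qed

lemma tangent_of_coords_self:
  assumes "c \<in> charts_at A q" shows "tangent_of_coords A c q u c = u"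
  using assms D_self[of c q u] by (simp add: tangent_of_coords_def charts_at_def)

lemma tangent_space_diff:
  assumes "u \<in> tangent_space A x" "v \<in> tangent_space A x"
  shows "(\<lambda>c. u c - v c) \<in> tangent_space A x"
proof (rule tangent_spaceI)
  fix c d assume cd: "c \<in> charts_at A x" "d \<in> charts_at A x"
  then have "linear (D c d (snd c x))" by (intro linear_D) (auto simp: charts_at_def)
  then show "u d - v d = D c d (snd c x) (u c - v c)"
    using tangent_spaceD(1)[OF assms(1) cd] tangent_spaceD(1)[OF assms(2) cd] by (simp add: linear_diff)
qed (use tangent_spaceD(2)[OF assms(1)] tangent_spaceD(2)[OF assms(2)] in simp)

lemma cotangent_space_iff:
  "p \<in> cotangent_space A q \<longleftrightarrow>
     (\<forall>c\<in>charts_at A q. \<forall>d\<in>charts_at A q. \<forall>u. p c \<bullet> u = p d \<bullet> D c d (snd c q) u) \<and>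
     (\<forall>c. c \<notin> charts_at A q \<longrightarrow> p c = 0)"
  unfolding cotangent_space_def by blast

lemma cotangent_spaceD:
  assumes "p \<in> cotangent_space A q"
  shows "c \<in> charts_at A q \<Longrightarrow> d \<in> charts_at A q \<Longrightarrow> p c \<bullet> u = p d \<bullet> D c d (snd c q) u"
    and "c \<notin> charts_at A q \<Longrightarrow> p c = 0"
  using assms unfolding cotangent_space_iff by blast+

lemma cotangent_space_adjoint:
  assumes "p \<in> cotangent_space A q" "c \<in> charts_at A q" "d \<in> charts_at A q"
  shows "p d = adjoint (D d c (snd d q)) (p c)"
proof (rule vector_eq_rdot[THEN iffD1], rule allI)
  fix u
  have lin: "linear (D d c (snd d q))" using assms by (intro linear_D) (auto simp: charts_at_def)
  show "p d \<bullet> u = adjoint (D d c (snd d q)) (p c) \<bullet> u"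
    using adjoint_works[OF lin, of u "p c"] cotangent_spaceD(1)[OF assms(1,3,2), of u]
    by (simp add: inner_commute)
qed

lemma cotangent_of_coords_in:
  assumes c: "c \<in> charts_at A q" shows "cotangent_of_coords A c q \<pi> \<in> cotangent_space A q"
  unfolding cotangent_space_iff
proof (intro conjI ballI allI impI)
  fix d e u assume de: "d \<in> charts_at A q" "e \<in> charts_at A q"
  have lin: "linear (D d c (snd d q))" "linear (D e c (snd e q))"
    using de c by (auto intro!: linear_D simp: charts_at_def)
  have "D e c (snd e q) (D d e (snd d q) u) = D d c (snd d q) u"
    using de c by (intro D_chain) (auto simp: charts_at_def)
  then show "cotangent_of_coords A c q \<pi> d \<bullet> u = cotangent_of_coords A c q \<pi> e \<bullet> D d e (snd d q) u"
    using adjoint_works[OF lin(1), of u \<pi>] adjoint_works[OF lin(2), of "D d e (snd d q) u" \<pi>] de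
    by (simp add: inner_commute cotangent_of_coords_def)
qed (simp add: cotangent_of_coords_def)

lemma cotangent_of_coords_eq:
  assumes "p \<in> cotangent_space A q" "c \<in> charts_at A q" shows "cotangent_of_coords A c q (p c) = p"
proof
  fix d
  show "cotangent_of_coords A c q (p c) d = p d"
    using cotangent_space_adjoint[OF assms, of d] cotangent_spaceD(2)[OF assms(1), of d]
    by (simp add: cotangent_of_coords_def)
qed

lemma cotangent_of_coords_self:
  assumes "c \<in> charts_at A q" shows "cotangent_of_coords A c q \<pi> c = \<pi>"
proof (rule vector_eq_rdot[THEN iffD1], rule allI)
  fix u
  have c: "c \<in> A" "q \<in> fst c" using assms by (auto simp: charts_at_def)
  have lin: "linear (D c c (snd c q))" using c by (intro linear_D) auto
  show "cotangent_of_coords A c q \<pi> c \<bullet> u = \<pi> \<bullet> u"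
    using adjoint_works[OF lin, of u \<pi>] assms
    by (simp add: cotangent_of_coords_def inner_commute D_self[OF c])
qed

text \<open>The opposite transformation laws of the two arguments cancel, so the chart chosen inside
  \<open>pairing\<close> may be replaced by any other.\<close>

lemma pairing_eq:
  assumes "p \<in> cotangent_space A q" "v \<in> tangent_space A q" "c \<in> charts_at A q"
  shows "pairing A q p v = p c \<bullet> v c"
proof -
  define d where "d = (SOME c. c \<in> charts_at A q)"
  have d: "d \<in> charts_at A q" unfolding d_def using ex_chart by (metis someI)
  have "p c \<bullet> v c = p d \<bullet> v d"
    using cotangent_spaceD(1)[OF assms(1,3) d, of "v c"] tangent_spaceD(1)[OF assms(2,3) d] by simp
  then show ?thesis by (simp add: pairing_def d_def Let_def)
qed

section \<open>Changes of coordinates on the Pontryagin bundle and their derivatives\<close>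

abbreviation "PT \<equiv> pontryagin_transition :: ('q,'e) chart \<Rightarrow> _"
abbreviation "DP c d z \<equiv> frechet_derivative (PT c d) (at z)"

text \<open>The velocity and momentum slots already contain one derivative of the transitions, so
  two derivatives are consumed. The adjoint in the momentum slot is expanded over
  \<open>Basis\<close> before it is differentiated.\<close>

lemma C1_pontryagin_transition:
  assumes "c \<in> A" "d \<in> A"
  shows "C1_deriv_on (overlap c d \<times> UNIV) (PT c d) (DP c d)"
proof -
  have op: "open (overlap c d \<times> (UNIV :: ('e \<times> 'e) set))" using assms by (intro open_Times open_overlap) auto
  have x: "C1_deriv_on (overlap c d \<times> UNIV) (\<lambda>z::'e \<times> 'e \<times> 'e. fst z) (\<lambda>_. fst)"
    by (rule C1_deriv_on_linear) (intro bounded_linear_intros)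
  have xu: "C1_deriv_on (overlap c d \<times> UNIV) (\<lambda>z::'e \<times> 'e \<times> 'e. (fst z, fst (snd z))) (\<lambda>_ k. (fst k, fst (snd k)))"
    by (rule C1_deriv_on_linear) (intro bounded_linear_intros)
  have p: "C1_deriv_on (overlap c d \<times> UNIV) (\<lambda>z::'e \<times> 'e \<times> 'e. snd (snd z)) (\<lambda>_ k. snd (snd k))"
    by (rule C1_deriv_on_linear) (intro bounded_linear_intros)
  have \<tau>: "C1_deriv_on (overlap c d \<times> UNIV) (\<lambda>z::'e \<times> 'e \<times> 'e. transition c d (fst z)) (\<lambda>z k. D c d (fst z) (fst k))"
    by (rule C1_deriv_on_compose[OF x C1_transition(1)[OF assms]]) auto
  have im: "transition c d ` overlap c d \<subseteq> overlap d c" using assms by auto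
  have "\<exists>f'. C1_deriv_on (overlap c d \<times> UNIV) (\<lambda>z::'e \<times> 'e \<times> 'e. D c d (fst z) (fst (snd z))) f'"
    using C1_deriv_on_compose[OF xu C1_deriv_on_derivative_pairing[OF C1_transition[OF assms] open_overlap[OF assms]]]
    by fastforce
  then obtain f' where f': "C1_deriv_on (overlap c d \<times> UNIV) (\<lambda>z::'e \<times> 'e \<times> 'e. D c d (fst z) (fst (snd z))) f'" ..
  have "C1_deriv_on (overlap c d \<times> UNIV) (\<lambda>z::'e \<times> 'e \<times> 'e. D d c (transition c d (fst z)) b)
     (\<lambda>z k. D2 d c b (transition c d (fst z)) (D c d (fst z) (fst k)))" for b
    by (rule C1_deriv_on_compose[OF \<tau> C1_transition(2)[OF assms(2,1)]]) (use im in auto)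
  then have G: "C1_deriv_on (overlap c d \<times> UNIV) (\<lambda>z::'e \<times> 'e \<times> 'e. (snd (snd z) \<bullet> D d c (transition c d (fst z)) b) *\<^sub>R b)
     (\<lambda>z k. (snd (snd z) \<bullet> D2 d c b (transition c d (fst z)) (D c d (fst z) (fst k)) + snd (snd k) \<bullet> D d c (transition c d (fst z)) b) *\<^sub>R b)" for b
    by (rule C1_deriv_on_compose[OF C1_deriv_on_inner[OF p] C1_deriv_on_linear[of "\<lambda>x. x *\<^sub>R b"]])
      (auto intro!: bounded_linear_intros)
  obtain g' where g': "C1_deriv_on (overlap c d \<times> UNIV)
      (\<lambda>z::'e \<times> 'e \<times> 'e. \<Sum>b\<in>Basis. (snd (snd z) \<bullet> D d c (transition c d (fst z)) b) *\<^sub>R b) g'"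
    by (rule that[OF C1_deriv_on_sum[OF G]])
  have "C1_deriv_on (overlap c d \<times> UNIV) (PT c d)
     (\<lambda>z k. (D c d (fst z) (fst k), f' z k, g' z k))"
  proof (rule C1_deriv_on_cong[OF C1_deriv_on_Pair[OF \<tau> C1_deriv_on_Pair[OF f' g']] op])
    fix z :: "'e \<times> 'e \<times> 'e" assume "z \<in> overlap c d \<times> UNIV"
    then have "linear (D d c (transition c d (fst z)))" using im assms by (intro linear_D) auto
    then show "(transition c d (fst z), D c d (fst z) (fst (snd z)),
        \<Sum>b\<in>Basis. (snd (snd z) \<bullet> D d c (transition c d (fst z)) b) *\<^sub>R b) = PT c d z"
      by (simp add: pontryagin_transition_def split_def adjoint_basis_expansion)
  qed
  then show ?thesis by (rule C1_deriv_on_frechetI)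
qed

text \<open>The base slot of the bundle transition depends on x alone. Hence the base component of a
  tangent vector to the Pontryagin bundle transforms like a tangent vector of the manifold.\<close>

lemma fst_DP:
  assumes "c \<in> A" "d \<in> A" "x \<in> overlap c d"
  shows "fst (DP c d (x, u, \<pi>) k) = D c d x (fst k)"
proof -
  have "((\<lambda>z. fst (PT c d z)) has_derivative (\<lambda>k. fst (DP c d (x, u, \<pi>) k))) (at (x, u, \<pi>))"
    using assms by (intro has_derivative_fst C1_deriv_onD[OF C1_pontryagin_transition]) auto
  moreover have "(\<lambda>z. fst (PT c d z)) = (\<lambda>z. transition c d (fst z))"
    by (auto simp: pontryagin_transition_def)
  moreover have "((\<lambda>z. transition c d (fst z)) has_derivative (\<lambda>k. D c d x (fst k))) (at (x, u, \<pi>))"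
    using C1_deriv_onD[OF C1_transition(1)[OF assms(1,2)], of x] assms(3)
    by (intro has_derivative_compose[of fst fst "(x, u, \<pi>)" UNIV "transition c d" "D c d x"]
        has_derivative_fst has_derivative_ident) auto
  ultimately show ?thesis using fun_cong[OF has_derivative_unique, of _ _ "(x, u, \<pi>)" _ k] by simp
qed

lemma pontryagin_transition_coords:
  assumes "c \<in> charts_at A q" "d \<in> charts_at A q" "v \<in> tangent_space A q" "p \<in> cotangent_space A q"
  shows "PT c d (snd c q, v c, p c) = (snd d q, v d, p d)"
proof -
  have c: "c \<in> A" "q \<in> fst c" using assms(1) by (auto simp: charts_at_def)
  show ?thesis
    using tangent_spaceD(1)[OF assms(3,1,2)] cotangent_space_adjoint[OF assms(4,1,2)] c
    by (simp add: pontryagin_transition_def)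
qed

text \<open>The cocycle rule one level higher. To compare the transitions at a nearby triple of
  coordinates, the triple is realised by an actual vector and covector over a point of the manifold,
  to which \<open>pontryagin_transition_coords\<close> applies.\<close>

lemma DP_chain:
  assumes c: "c \<in> charts_at A q" "d \<in> charts_at A q" "e \<in> charts_at A q"
    and v: "v \<in> tangent_space A q" "p \<in> cotangent_space A q"
  shows "DP d e (snd d q, v d, p d) (DP c d (snd c q, v c, p c) k) = DP c e (snd c q, v c, p c) k"
proof -
  have A: "c \<in> A" "d \<in> A" "e \<in> A" "q \<in> fst c" "q \<in> fst d" "q \<in> fst e"
    using c by (auto simp: charts_at_def)
  let ?z = "(snd c q, v c, p c)"
  have "((\<lambda>z. PT d e (PT c d z)) has_derivative (\<lambda>k. DP d e (snd d q, v d, p d) (DP c d ?z k))) (at ?z)"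
  proof (rule has_derivative_compose[of "PT c d" "DP c d ?z" ?z UNIV "PT d e" "DP d e (snd d q, v d, p d)"])
    show "(PT c d has_derivative DP c d ?z) (at ?z)"
      using A by (intro C1_deriv_onD[OF C1_pontryagin_transition]) auto
    show "(PT d e has_derivative DP d e (snd d q, v d, p d)) (at (PT c d ?z))"
      unfolding pontryagin_transition_coords[OF c(1,2) v]
      using A by (intro C1_deriv_onD[OF C1_pontryagin_transition]) auto
  qed
  moreover have op: "open ((overlap c d \<inter> overlap c e) \<times> (UNIV :: ('e \<times> 'e) set))"
    using A by (intro open_Times open_Int open_overlap) auto
  ultimately have "(PT c e has_derivative (\<lambda>k. DP d e (snd d q, v d, p d) (DP c d ?z k))) (at ?z)"
  proof (rule has_derivative_transform_within_open)
    show "?z \<in> (overlap c d \<inter> overlap c e) \<times> UNIV" using A by auto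
    fix z :: "'e \<times> 'e \<times> 'e" assume "z \<in> (overlap c d \<inter> overlap c e) \<times> UNIV"
    then obtain x u \<pi> where z: "z = (x, u, \<pi>)" "x \<in> overlap c d" "x \<in> overlap c e" by (cases z) auto
    then obtain q' where q': "x = snd c q'" "q' \<in> fst c" "q' \<in> fst d" by auto
    obtain q'' where "x = snd c q''" "q'' \<in> fst c" "q'' \<in> fst e" using z by auto
    then have q'': "q' \<in> fst e" using q' A(1) by (metis chart_inv_chart)
    have ch: "c \<in> charts_at A q'" "d \<in> charts_at A q'" "e \<in> charts_at A q'"
      using A q' q'' by (auto simp: charts_at_def)
    let ?v = "tangent_of_coords A c q' u" and ?p = "cotangent_of_coords A c q' \<pi>"
    note vp = tangent_of_coords_in[OF ch(1), of u] cotangent_of_coords_in[OF ch(1), of \<pi>]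
    have "z = (snd c q', ?v c, ?p c)"
      using z q' by (simp add: tangent_of_coords_self[OF ch(1)] cotangent_of_coords_self[OF ch(1)])
    then show "PT d e (PT c d z) = PT c e z"
      using pontryagin_transition_coords[OF ch(1,2) vp] pontryagin_transition_coords[OF ch(2,3) vp]
        pontryagin_transition_coords[OF ch(1,3) vp] by simp
  qed
  moreover have "(PT c e has_derivative DP c e ?z) (at ?z)"
    using A by (intro C1_deriv_onD[OF C1_pontryagin_transition]) auto
  ultimately show ?thesis by (rule fun_cong[OF has_derivative_unique])
qed

text \<open>Change of coordinates \<open>(x, y, u, \<pi>)\<close>, where \<open>y\<close> is the time derivative of \<open>x\<close>.\<close>

definition path_transition ::
  "('q, 'e) chart \<Rightarrow> ('q, 'e) chart \<Rightarrow> 'e \<times> 'e \<times> 'e \<times> 'e \<Rightarrow> 'e \<times> 'e \<times> 'e \<times> 'e" where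
  "path_transition c d z = (let P = PT c d (fst z, snd (snd z)) in
     (fst P, D c d (fst z) (fst (snd z)), snd P))"

definition path_transition' ::
  "('q, 'e) chart \<Rightarrow> ('q, 'e) chart \<Rightarrow> 'e \<times> 'e \<times> 'e \<times> 'e \<Rightarrow> 'e \<times> 'e \<times> 'e \<times> 'e \<Rightarrow> 'e \<times> 'e \<times> 'e \<times> 'e" where
  "path_transition' c d z k = (let P = DP c d (fst z, snd (snd z)) (fst k, snd (snd k)) in
     (fst P, D2 c d (fst (snd z)) (fst z) (fst k) + D c d (fst z) (fst (snd k)), snd P))"

text \<open>This is calculus on coordinate quadruples only; that variations of paths really
  transform by \<open>path_transition'\<close> is shown in
  \<open>variation_coords_change\<close>.\<close>

lemma C1_path_transition:
  assumes "c \<in> A" "d \<in> A"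
  shows "C1_deriv_on (overlap c d \<times> UNIV) (path_transition c d) (path_transition' c d)"
proof -
  have 1: "C1_deriv_on (overlap c d \<times> UNIV) (\<lambda>z::'e \<times> 'e \<times> 'e \<times> 'e. (fst z, snd (snd z)))
      (\<lambda>_ k. (fst k, snd (snd k)))"
    by (rule C1_deriv_on_linear) (intro bounded_linear_intros)
  have 2: "C1_deriv_on (overlap c d \<times> UNIV) (\<lambda>z::'e \<times> 'e \<times> 'e \<times> 'e. (fst z, fst (snd z)))
      (\<lambda>_ k. (fst k, fst (snd k)))"
    by (rule C1_deriv_on_linear) (intro bounded_linear_intros)
  have P: "C1_deriv_on (overlap c d \<times> UNIV) (\<lambda>z::'e \<times> 'e \<times> 'e \<times> 'e. PT c d (fst z, snd (snd z)))
     (\<lambda>z k. DP c d (fst z, snd (snd z)) (fst k, snd (snd k)))"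
    by (rule C1_deriv_on_compose[OF 1 C1_pontryagin_transition[OF assms]]) auto
  have V: "C1_deriv_on (overlap c d \<times> UNIV) (\<lambda>z::'e \<times> 'e \<times> 'e \<times> 'e. D c d (fst z) (fst (snd z)))
     (\<lambda>z k. D2 c d (fst (snd z)) (fst z) (fst k) + D c d (fst z) (fst (snd k)))"
    using C1_deriv_on_compose[OF 2 C1_deriv_on_derivative_pairing[OF C1_transition[OF assms] open_overlap[OF assms]]]
    by (simp add: image_subset_iff mem_Times_iff)
  show ?thesis
    unfolding path_transition_def[abs_def] path_transition'_def[abs_def] Let_def
    by (intro C1_deriv_on_Pair V C1_deriv_on_compose[OF P C1_deriv_on_linear[OF bounded_linear_fst]]
        C1_deriv_on_compose[OF P C1_deriv_on_linear[OF bounded_linear_snd]]) auto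
qed

end

section \<open>Paths and variations in coordinates\<close>

lemma has_vector_derivative_openin_cong:
  assumes "openin (top_of_set T) S" "r \<in> S" "\<And>t. t \<in> S \<Longrightarrow> g t = f t"
    and "(f has_vector_derivative y) (at r within T)"
  shows "(g has_vector_derivative y) (at r within T)"
  using has_vector_derivative_transform[of r S g f y] assms
  by (simp add: at_within_openin[OF assms(1,2), symmetric])

text \<open>Gluing: a subset of X that is relatively open in the larger set T is relatively open in
  X as well, so continuity on X can be tested on such pieces.\<close>

lemma continuous_on_openin_localI:
  fixes f :: "'a::t2_space \<Rightarrow> 'b::topological_space"
  assumes "X \<subseteq> T"
    and loc: "\<And>r. r \<in> X \<Longrightarrow> \<exists>S. openin (top_of_set T) S \<and> r \<in> S \<and> S \<subseteq> X \<and> continuous_on S f"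
  shows "continuous_on X f"
  unfolding continuous_on_eq_continuous_within
proof
  fix r assume "r \<in> X"
  from loc[OF this] obtain S where S: "openin (top_of_set T) S" "r \<in> S" "S \<subseteq> X" "continuous_on S f" by blast
  have "openin (top_of_set X) S" using S assms(1) by (meson openin_subset_trans)
  note eq = at_within_openin[OF this S(2)]
  show "continuous (at r within X) f"
    using S(2,4) unfolding eq[symmetric] continuous_on_eq_continuous_within by blast
qed

locale interval_atlas = atlas A for A :: "('q::t2_space, 'e::euclidean_space) chart set" +
  fixes a b :: real
  assumes ab: "a < b"
begin

abbreviation "chart_times q c \<equiv> {t\<in>{a..b}. q t \<in> fst c}"

lemma openin_times:
  assumes "continuous_on {a..b} q" "c \<in> A"
  shows "openin (top_of_set {a..b}) (chart_times q c)"
proof -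
  have "chart_times q c = {a..b} \<inter> q -` fst c" by auto
  then show ?thesis using continuous_openin_preimage_gen[OF assms(1) open_chart[OF assms(2)]] by simp
qed

lemma vector_derivative_eq:
  "(f has_vector_derivative y) (at r within {a..b}) \<Longrightarrow> r \<in> {a..b} \<Longrightarrow>
    vector_derivative f (at r within {a..b}) = y"
  using ab vector_derivative_within_cbox[of a b r f y] by simp

section \<open>Regularity along curves, tested locally\<close>

lemma C0_along_localI:
  assumes "\<And>d r. d \<in> A \<Longrightarrow> r \<in> chart_times q d \<Longrightarrow>
    \<exists>S. openin (top_of_set {a..b}) S \<and> r \<in> S \<and> S \<subseteq> chart_times q d \<and> continuous_on S (\<lambda>t. f t d)"
  shows "C0_along A a b q f"
  unfolding C0_along_def
  by (intro ballI continuous_on_openin_localI[where T = "{a..b}"] assms) auto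

lemma C1_along_localI:
  assumes loc: "\<And>d r. d \<in> A \<Longrightarrow> r \<in> chart_times q d \<Longrightarrow>
    \<exists>S y. openin (top_of_set {a..b}) S \<and> r \<in> S \<and> S \<subseteq> chart_times q d \<and>
      (\<forall>r'\<in>S. ((\<lambda>t. f t d) has_vector_derivative y r') (at r' within {a..b})) \<and> continuous_on S y"
  shows "C1_along A a b q f"
  unfolding C1_along_def
proof (intro ballI conjI)
  fix d r assume "d \<in> A" "r \<in> chart_times q d"
  then show "(\<lambda>t. f t d) differentiable (at r within {a..b})"
    using loc by (meson differentiableI_vector)
next
  fix d assume d: "d \<in> A"
  show "continuous_on (chart_times q d) (\<lambda>t. vector_derivative (\<lambda>t. f t d) (at t within {a..b}))"
  proof (rule continuous_on_openin_localI[where T = "{a..b}"])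
    fix r assume r: "r \<in> chart_times q d"
    from loc[OF d r] obtain S y where S: "openin (top_of_set {a..b}) S" "r \<in> S" "S \<subseteq> chart_times q d"
      and y: "\<And>r'. r' \<in> S \<Longrightarrow> ((\<lambda>t. f t d) has_vector_derivative y r') (at r' within {a..b})"
      and cy: "continuous_on S y" by blast
    have "y t = vector_derivative (\<lambda>t. f t d) (at t within {a..b})" if "t \<in> S" for t
      using vector_derivative_eq[OF y[OF that]] that S(3) by auto
    then have "continuous_on S (\<lambda>t. vector_derivative (\<lambda>t. f t d) (at t within {a..b}))"
      using cy by (simp cong: continuous_on_cong)
    with S show "\<exists>S. openin (top_of_set {a..b}) S \<and> r \<in> S \<and> S \<subseteq> chart_times q d \<and>
        continuous_on S (\<lambda>t. vector_derivative (\<lambda>t. f t d) (at t within {a..b}))" by blast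
  qed auto
qed

lemma chart_change_has_vector_derivative:
  assumes "c \<in> A" "d \<in> A" "openin (top_of_set {a..b}) S" "r \<in> S" "q ` S \<subseteq> fst c \<inter> fst d"
    and "((\<lambda>t. snd c (q t)) has_vector_derivative y) (at r within {a..b})"
  shows "((\<lambda>t. snd d (q t)) has_vector_derivative D c d (snd c (q r)) y) (at r within {a..b})"
proof (rule has_vector_derivative_openin_cong[OF assms(3,4)])
  show "((\<lambda>t. transition c d (snd c (q t))) has_vector_derivative D c d (snd c (q r)) y) (at r within {a..b})"
    using assms by (intro C1_deriv_on_has_vector_derivative[OF C1_transition(1)[OF assms(1,2)] assms(6)]) auto
  show "snd d (q t) = transition c d (snd c (q t))" if "t \<in> S" for t
    using assms that by (auto simp: image_subset_iff)
qed

lemma pontryagin_tangent_spaceI: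
  assumes "\<And>c d. c \<in> charts_at A x \<Longrightarrow> d \<in> charts_at A x \<Longrightarrow>
      (\<delta>q d, \<delta>v d, \<delta>p d) = DP c d (snd c x, u c, \<pi> c) (\<delta>q c, \<delta>v c, \<delta>p c)"
    and "\<And>c. c \<notin> charts_at A x \<Longrightarrow> \<delta>q c = 0 \<and> \<delta>v c = 0 \<and> \<delta>p c = 0"
  shows "(\<delta>q, \<delta>v, \<delta>p) \<in> pontryagin_tangent_space A x u \<pi>"
  unfolding pontryagin_tangent_space_def using assms by blast

lemma pontryagin_tangent_spaceD:
  assumes "(\<delta>q, \<delta>v, \<delta>p) \<in> pontryagin_tangent_space A q' v' p'" "c \<in> charts_at A q'" "d \<in> charts_at A q'"
  shows "(\<delta>q d, \<delta>v d, \<delta>p d) = DP c d (snd c q', v' c, p' c) (\<delta>q c, \<delta>v c, \<delta>p c)"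
    and "\<delta>q d = D c d (snd c q') (\<delta>q c)"
proof -
  show 1: "(\<delta>q d, \<delta>v d, \<delta>p d) = DP c d (snd c q', v' c, p' c) (\<delta>q c, \<delta>v c, \<delta>p c)"
    using assms unfolding pontryagin_tangent_space_def by blast
  show "\<delta>q d = D c d (snd c q') (\<delta>q c)"
    using arg_cong[OF 1, of fst] fst_DP[of c d "snd c q'"] assms(2,3) by (auto simp: charts_at_def)
qed

text \<open>One good chart around each time suffices: the C1 transitions carry the local regularity
  to every other chart around the point. The varied paths will be checked through this
  criterion.\<close>

lemma path_space_localI:
  assumes q: "continuous_on {a..b} q" "q a = q1" "q b = q2"
    and vp: "\<And>r. r \<in> {a..b} \<Longrightarrow> v r \<in> tangent_space A (q r) \<and> p r \<in> cotangent_space A (q r)"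
    and loc: "\<And>r. r \<in> {a..b} \<Longrightarrow> \<exists>c S y. c \<in> A \<and> openin (top_of_set {a..b}) S \<and> r \<in> S \<and> q ` S \<subseteq> fst c \<and>
      (\<forall>r'\<in>S. ((\<lambda>t. snd c (q t)) has_vector_derivative y r') (at r' within {a..b})) \<and>
      continuous_on S y \<and> continuous_on S (\<lambda>r. v r c) \<and> continuous_on S (\<lambda>r. p r c)"
  shows "(q, v, p) \<in> path_space A a b q1 q2"
proof -
  have main: "\<exists>S y. openin (top_of_set {a..b}) S \<and> r \<in> S \<and> S \<subseteq> chart_times q d \<and>
      (\<forall>r'\<in>S. ((\<lambda>t. snd d (q t)) has_vector_derivative y r') (at r' within {a..b})) \<and>
      continuous_on S y \<and> continuous_on S (\<lambda>r. v r d) \<and> continuous_on S (\<lambda>r. p r d)"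
    if d: "d \<in> A" and r: "r \<in> chart_times q d" for d r
  proof -
    have rab: "r \<in> {a..b}" using r by simp
    from loc[OF rab] obtain c S y where c: "c \<in> A" and S: "openin (top_of_set {a..b}) S" "r \<in> S" "q ` S \<subseteq> fst c"
      and y: "\<And>r'. r' \<in> S \<Longrightarrow> ((\<lambda>t. snd c (q t)) has_vector_derivative y r') (at r' within {a..b})"
      and cont: "continuous_on S y" "continuous_on S (\<lambda>r. v r c)" "continuous_on S (\<lambda>r. p r c)" by blast
    define S' where "S' = S \<inter> chart_times q d"
    have S': "openin (top_of_set {a..b}) S'" unfolding S'_def by (intro openin_Int S openin_times q d)
    have sub: "S' \<subseteq> S" "S' \<subseteq> chart_times q d" "r \<in> S'" using S r by (auto simp: S'_def)
    have qS': "q ` S' \<subseteq> fst c \<inter> fst d" using S(3) by (auto simp: S'_def)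
    have x: "continuous_on S' (\<lambda>t. snd c (q t))"
    proof (rule continuous_on_compose2[OF continuous_chart[OF c]])
      show "continuous_on S' q" using q(1) by (rule continuous_on_subset) (auto simp: S'_def)
    qed (use qS' in auto)
    have xin: "snd c (q t) \<in> overlap c d" if "t \<in> S'" for t using qS' that by auto
    have ch: "c \<in> charts_at A (q t)" "d \<in> charts_at A (q t)" "t \<in> {a..b}" if "t \<in> S'" for t
      using qS' c d sub that by (auto simp: charts_at_def)
    have PT: "continuous_on S' (\<lambda>t. PT c d (snd c (q t), v t c, p t c))"
      using xin by (intro continuous_on_compose2[OF C1_deriv_on_continuous[OF C1_pontryagin_transition[OF c d]]]
          continuous_on_Pair x continuous_on_subset[OF cont(2) sub(1)] continuous_on_subset[OF cont(3) sub(1)]) auto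
    have "PT c d (snd c (q t), v t c, p t c) = (snd d (q t), v t d, p t d)" if "t \<in> S'" for t
      using ch[OF that] vp[OF ch(3)[OF that]] by (intro pontryagin_transition_coords) auto
    then have C: "continuous_on S' (\<lambda>t. (snd d (q t), v t d, p t d))"
      using PT by (simp cong: continuous_on_cong)
    have "continuous_on S' (\<lambda>t. v t d)" "continuous_on S' (\<lambda>t. p t d)"
      using continuous_on_fst[OF continuous_on_snd[OF C]] continuous_on_snd[OF continuous_on_snd[OF C]] by simp_all
    moreover have "continuous_on S' (\<lambda>t. D c d (snd c (q t)) (y t))"
      using xin by (intro C1_deriv_on_joint_continuous[OF C1_transition(1)[OF c d]] x continuous_on_subset[OF cont(1) sub(1)])
    moreover have "((\<lambda>t. snd d (q t)) has_vector_derivative D c d (snd c (q r')) (y r')) (at r' within {a..b})"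
      if "r' \<in> S'" for r'
      using that sub y by (intro chart_change_has_vector_derivative[OF c d S' that qS']) auto
    ultimately show ?thesis
      using S' sub(2,3) by (intro exI[of _ S'] exI[of _ "\<lambda>t. D c d (snd c (q t)) (y t)"]) simp
  qed
  have "C1_along A a b q (\<lambda>t c. snd c (q t))" by (rule C1_along_localI, drule (1) main, blast)
  moreover have "C0_along A a b q v" "C0_along A a b q p" by (rule C0_along_localI, drule (1) main, blast)+
  ultimately show ?thesis
    using q vp by (simp add: path_space_def C1_curve_def)
qed

context
  fixes q v p q1 q2
  assumes P: "(q, v, p) \<in> path_space A a b q1 q2"
begin

lemma path_continuous: "continuous_on {a..b} q"
  and path_tangent: "r \<in> {a..b} \<Longrightarrow> v r \<in> tangent_space A (q r)"
  and path_cotangent: "r \<in> {a..b} \<Longrightarrow> p r \<in> cotangent_space A (q r)"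
  using P by (auto simp: path_space_def C1_curve_def)

lemma path_has_vector_derivative:
  assumes "c \<in> A" "r \<in> chart_times q c"
  shows "((\<lambda>t. snd c (q t)) has_vector_derivative fst (snd (path_coords a b c (q, v, p) r))) (at r within {a..b})"
  using P assms by (auto simp: path_space_def C1_curve_def C1_along_def vector_derivative_works[symmetric])

lemma path_coords_continuous:
  assumes "c \<in> A"
  shows "continuous_on (chart_times q c) (path_coords a b c (q, v, p))"
proof -
  have "continuous_on (chart_times q c) (\<lambda>t. snd c (q t))"
    by (rule continuous_on_compose2[OF continuous_chart[OF assms] continuous_on_subset[OF path_continuous]]) auto
  then show ?thesis
    unfolding path_coords.simps using P assms
    by (intro continuous_on_Pair) (auto simp: path_space_def C1_curve_def C1_along_def C0_along_def)
qed

lemma path_velocity_change: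
  assumes "c \<in> A" "d \<in> A" "r \<in> chart_times q c" "r \<in> chart_times q d"
  shows "fst (snd (path_coords a b d (q, v, p) r)) = D c d (snd c (q r)) (fst (snd (path_coords a b c (q, v, p) r)))"
proof -
  have "((\<lambda>t. snd d (q t)) has_vector_derivative D c d (snd c (q r)) (fst (snd (path_coords a b c (q, v, p) r)))) (at r within {a..b})"
    using assms path_continuous path_has_vector_derivative[OF assms(1,3)]
    by (intro chart_change_has_vector_derivative[OF assms(1,2), of "chart_times q c \<inter> chart_times q d"]
        openin_Int openin_times) auto
  from vector_derivative_eq[OF this] show ?thesis using assms(3) by simp
qed

lemma velocity_tangent:
  assumes "r \<in> {a..b}" shows "velocity A a b q r \<in> tangent_space A (q r)"
proof (rule tangent_spaceI)
  fix c d assume "c \<in> charts_at A (q r)" "d \<in> charts_at A (q r)"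
  then show "velocity A a b q r d = D c d (snd c (q r)) (velocity A a b q r c)"
    using path_velocity_change[of c d r] assms by (simp add: velocity_def charts_at_def)
qed (simp add: velocity_def)

lemma path_coords_change:
  assumes "c \<in> A" "d \<in> A" "r \<in> chart_times q c" "r \<in> chart_times q d"
  shows "path_coords a b d (q, v, p) r = path_transition c d (path_coords a b c (q, v, p) r)"
proof -
  have "PT c d (snd c (q r), v r c, p r c) = (snd d (q r), v r d, p r d)"
    using assms path_tangent path_cotangent by (intro pontryagin_transition_coords) (auto simp: charts_at_def)
  then show ?thesis using path_velocity_change[OF assms] by (simp add: path_transition_def)
qed

lemma variation_has_vector_derivative:
  assumes "(\<delta>q, \<delta>v, \<delta>p) \<in> path_tangent_space A a b (q, v, p)" "c \<in> A" "r \<in> chart_times q c"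
  shows "((\<lambda>t. \<delta>q t c) has_vector_derivative fst (snd (variation_coords a b c (\<delta>q, \<delta>v, \<delta>p) r))) (at r within {a..b})"
  using assms by (auto simp: C1_along_def vector_derivative_works[symmetric])

lemma variation_coords_continuous:
  assumes "(\<delta>q, \<delta>v, \<delta>p) \<in> path_tangent_space A a b (q, v, p)" "c \<in> A"
  shows "continuous_on (chart_times q c) (variation_coords a b c (\<delta>q, \<delta>v, \<delta>p))"
proof -
  have "continuous_on (chart_times q c) (\<lambda>t. \<delta>q t c)"
    unfolding continuous_on_eq_continuous_within
  proof
    fix r assume "r \<in> chart_times q c"
    from has_vector_derivative_continuous[OF variation_has_vector_derivative[OF assms this]]
    show "continuous (at r within chart_times q c) (\<lambda>t. \<delta>q t c)"
      by (rule continuous_within_subset) auto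
  qed
  then show ?thesis
    unfolding variation_coords.simps using assms
    by (intro continuous_on_Pair) (auto simp: C1_along_def C0_along_def)
qed

text \<open>The derivative of a transition, evaluated along the path, acts on \<delta>q, so the time
  derivative acquires a second-derivative term with \<delta>q as direction and the velocity of the
  path as increment.\<close>

lemma variation_change:
  assumes "\<And>t. t \<in> {a..b} \<Longrightarrow> (\<delta>q t, \<delta>v t, \<delta>p t) \<in> pontryagin_tangent_space A (q t) (v t) (p t)"
    and "c \<in> A" "d \<in> A" "r \<in> chart_times q c" "r \<in> chart_times q d"
    and \<eta>: "((\<lambda>t. \<delta>q t c) has_vector_derivative \<eta>) (at r within {a..b})"
  shows "((\<lambda>t. \<delta>q t d) has_vector_derivative
      D2 c d (\<delta>q r c) (snd c (q r)) (fst (snd (path_coords a b c (q, v, p) r))) + D c d (snd c (q r)) \<eta>)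
      (at r within {a..b})"
proof (rule has_vector_derivative_openin_cong)
  show "openin (top_of_set {a..b}) (chart_times q c \<inter> chart_times q d)"
    using assms by (intro openin_Int openin_times path_continuous)
  show "r \<in> chart_times q c \<inter> chart_times q d" using assms by auto
  show "\<delta>q t d = D c d (snd c (q t)) (\<delta>q t c)" if "t \<in> chart_times q c \<inter> chart_times q d" for t
    using that assms(2,3) by (intro pontryagin_tangent_spaceD(2)[OF assms(1)]) (auto simp: charts_at_def)
  show "((\<lambda>t. D c d (snd c (q t)) (\<delta>q t c)) has_vector_derivative
      D2 c d (\<delta>q r c) (snd c (q r)) (fst (snd (path_coords a b c (q, v, p) r))) + D c d (snd c (q r)) \<eta>)
      (at r within {a..b})"
    using assms by (intro derivative_pairing_has_vector_derivative[OF C1_transition[OF assms(2,3)]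
          open_overlap[OF assms(2,3)] path_has_vector_derivative[OF assms(2,4)]]) auto
qed

text \<open>The time derivative of the transformed \<delta>q and the linearised change of the
  velocity differ only in the order of the two arguments of the second derivative of the transition.
  By symmetry, variations transform with the derivative of \<open>path_transition\<close>.\<close>

lemma variation_coords_change:
  assumes \<delta>: "(\<delta>q, \<delta>v, \<delta>p) \<in> path_tangent_space A a b (q, v, p)"
    and cd: "c \<in> A" "d \<in> A" "r \<in> chart_times q c" "r \<in> chart_times q d"
  shows "variation_coords a b d (\<delta>q, \<delta>v, \<delta>p) r =
    path_transition' c d (path_coords a b c (q, v, p) r) (variation_coords a b c (\<delta>q, \<delta>v, \<delta>p) r)"
proof -
  have pt: "(\<delta>q t, \<delta>v t, \<delta>p t) \<in> pontryagin_tangent_space A (q t) (v t) (p t)" if "t \<in> {a..b}" for t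
    using \<delta> that by simp
  have ch: "c \<in> charts_at A (q r)" "d \<in> charts_at A (q r)" "r \<in> {a..b}" using cd by (auto simp: charts_at_def)
  have x: "snd c (q r) \<in> overlap c d" using cd by auto
  note 1 = pontryagin_tangent_spaceD(1)[OF pt[OF ch(3)] ch(1,2)]
  note 2 = variation_change[OF pt cd variation_has_vector_derivative[OF \<delta> cd(1,3)]]
  have "vector_derivative (\<lambda>t. \<delta>q t d) (at r within {a..b}) =
     D2 c d (\<delta>q r c) (snd c (q r)) (fst (snd (path_coords a b c (q, v, p) r))) +
     D c d (snd c (q r)) (fst (snd (variation_coords a b c (\<delta>q, \<delta>v, \<delta>p) r)))"
    by (rule vector_derivative_eq[OF 2 ch(3)])
  also have "D2 c d (\<delta>q r c) (snd c (q r)) (fst (snd (path_coords a b c (q, v, p) r))) =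
     D2 c d (fst (snd (path_coords a b c (q, v, p) r))) (snd c (q r)) (\<delta>q r c)"
    by (rule symmetric_second_derivative[OF open_overlap[OF cd(1,2)] x C1_transition[OF cd(1,2)]])
  finally show ?thesis
    using 1[symmetric] by (simp add: path_transition'_def)
qed

text \<open>As for paths, one chart around each time suffices; the second-derivative term in the
  change of charts is continuous because the path itself is C1.\<close>

lemma path_tangent_space_localI:
  assumes pt: "\<And>t. t \<in> {a..b} \<Longrightarrow> (\<delta>q t, \<delta>v t, \<delta>p t) \<in> pontryagin_tangent_space A (q t) (v t) (p t)"
    and ends: "\<And>c. \<delta>q a c = 0 \<and> \<delta>q b c = 0"
    and loc: "\<And>r. r \<in> {a..b} \<Longrightarrow> \<exists>c S \<eta>. c \<in> A \<and> openin (top_of_set {a..b}) S \<and> r \<in> S \<and> S \<subseteq> chart_times q c \<and>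
      (\<forall>r'\<in>S. ((\<lambda>t. \<delta>q t c) has_vector_derivative \<eta> r') (at r' within {a..b})) \<and>
      continuous_on S \<eta> \<and> continuous_on S (\<lambda>r. \<delta>v r c) \<and> continuous_on S (\<lambda>r. \<delta>p r c)"
  shows "(\<delta>q, \<delta>v, \<delta>p) \<in> path_tangent_space A a b (q, v, p)"
proof -
  have main: "\<exists>S \<eta>. openin (top_of_set {a..b}) S \<and> r \<in> S \<and> S \<subseteq> chart_times q d \<and>
      (\<forall>r'\<in>S. ((\<lambda>t. \<delta>q t d) has_vector_derivative \<eta> r') (at r' within {a..b})) \<and>
      continuous_on S \<eta> \<and> continuous_on S (\<lambda>r. \<delta>v r d) \<and> continuous_on S (\<lambda>r. \<delta>p r d)"
    if d: "d \<in> A" and r: "r \<in> chart_times q d" for d r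
  proof -
    have rab: "r \<in> {a..b}" using r by simp
    from loc[OF rab] obtain c S \<eta> where c: "c \<in> A" and S: "openin (top_of_set {a..b}) S" "r \<in> S" "S \<subseteq> chart_times q c"
      and \<eta>: "\<And>r'. r' \<in> S \<Longrightarrow> ((\<lambda>t. \<delta>q t c) has_vector_derivative \<eta> r') (at r' within {a..b})"
      and cont: "continuous_on S \<eta>" "continuous_on S (\<lambda>r. \<delta>v r c)" "continuous_on S (\<lambda>r. \<delta>p r c)" by blast
    define S' where "S' = S \<inter> chart_times q d"
    have S': "openin (top_of_set {a..b}) S'"
      unfolding S'_def by (intro openin_Int S openin_times path_continuous d)
    have sub: "S' \<subseteq> S" "S' \<subseteq> chart_times q d" "r \<in> S'" "S' \<subseteq> chart_times q c" using S r by (auto simp: S'_def)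
    have ch: "c \<in> charts_at A (q t)" "d \<in> charts_at A (q t)" "t \<in> {a..b}" if "t \<in> S'" for t
      using sub that c d by (auto simp: charts_at_def)
    have xin: "snd c (q t) \<in> overlap c d" if "t \<in> S'" for t using sub that by auto
    note cp = continuous_on_subset[OF path_coords_continuous[OF c] sub(4), unfolded path_coords.simps]
    have x: "continuous_on S' (\<lambda>t. snd c (q t))" using continuous_on_fst[OF cp] by simp
    have y: "continuous_on S' (\<lambda>t. vector_derivative (\<lambda>t. snd c (q t)) (at t within {a..b}))"
      using continuous_on_fst[OF continuous_on_snd[OF cp]] by simp
    have vp: "continuous_on S' (\<lambda>t. (v t c, p t c))"
      using continuous_on_snd[OF continuous_on_snd[OF cp]] by simp
    have \<delta>c: "continuous_on S' (\<lambda>t. \<delta>q t c)"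
      unfolding continuous_on_eq_continuous_within
      using has_vector_derivative_continuous[OF \<eta>] sub by (blast intro: continuous_within_subset openin_imp_subset[OF S'])
    have "continuous_on S' (\<lambda>t. DP c d (snd c (q t), v t c, p t c) (\<delta>q t c, \<delta>v t c, \<delta>p t c))"
      using xin by (intro C1_deriv_on_joint_continuous[OF C1_pontryagin_transition[OF c d]]
          continuous_on_Pair x vp \<delta>c continuous_on_subset[OF cont(2) sub(1)] continuous_on_subset[OF cont(3) sub(1)]) auto
    moreover have "DP c d (snd c (q t), v t c, p t c) (\<delta>q t c, \<delta>v t c, \<delta>p t c) = (\<delta>q t d, \<delta>v t d, \<delta>p t d)"
      if "t \<in> S'" for t
      by (rule pontryagin_tangent_spaceD(1)[OF pt[OF ch(3)[OF that]] ch(1,2)[OF that], symmetric])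
    ultimately have C: "continuous_on S' (\<lambda>t. (\<delta>q t d, \<delta>v t d, \<delta>p t d))"
      by (simp cong: continuous_on_cong)
    have "continuous_on S' (\<lambda>t. \<delta>v t d)" "continuous_on S' (\<lambda>t. \<delta>p t d)"
      using continuous_on_fst[OF continuous_on_snd[OF C]] continuous_on_snd[OF continuous_on_snd[OF C]] by simp_all
    moreover have "continuous_on S' (\<lambda>t. D2 c d (\<delta>q t c) (snd c (q t)) (fst (snd (path_coords a b c (q, v, p) t))) + D c d (snd c (q t)) (\<eta> t))"
      using C1_deriv_on_joint_continuous[OF C1_deriv_on_derivative_pairing[OF C1_transition[OF c d] open_overlap[OF c d]]
        continuous_on_Pair[OF x \<delta>c] continuous_on_Pair[OF y continuous_on_subset[OF cont(1) sub(1)]]] xin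
      by simp
    moreover have "((\<lambda>t. \<delta>q t d) has_vector_derivative
       D2 c d (\<delta>q r' c) (snd c (q r')) (fst (snd (path_coords a b c (q, v, p) r'))) + D c d (snd c (q r')) (\<eta> r')) (at r' within {a..b})"
      if "r' \<in> S'" for r'
      using that sub \<eta> by (intro variation_change[OF pt c d]) auto
    ultimately show ?thesis
      using S' sub(2,3) by (intro exI[of _ S'] exI[of _ "\<lambda>t. D2 c d (\<delta>q t c) (snd c (q t))
          (fst (snd (path_coords a b c (q, v, p) t))) + D c d (snd c (q t)) (\<eta> t)"]) simp
  qed
  have "C1_along A a b q \<delta>q" by (rule C1_along_localI, drule (1) main, blast)
  moreover have "C0_along A a b q \<delta>v" "C0_along A a b q \<delta>p" by (rule C0_along_localI, drule (1) main, blast)+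
  ultimately show ?thesis
    using pt ends by (simp del: split_paired_All)
qed

end

end

section \<open>The action on subintervals\<close>

locale hp_system = interval_atlas A a b
  for A :: "('q::t2_space, 'e::euclidean_space) chart set" and a b :: real +
  fixes L :: "'q \<times> ('q, 'e) fibre \<Rightarrow> real" and m :: nat and \<gamma> :: "nat \<Rightarrow> 'q \<Rightarrow> real"
    and w :: "nat \<Rightarrow> real \<Rightarrow> real"
  assumes L: "C2_lagrangian A L" and \<gamma>: "\<And>i. i \<in> {1..m} \<Longrightarrow> C2_function A (\<gamma> i)"
    and w: "\<And>i. i \<in> {1..m} \<Longrightarrow> continuous_on {a..b} (w i)"
begin

abbreviation "\<l> c \<equiv> local_lagrangian A L c"
abbreviation "\<l>' c z \<equiv> frechet_derivative (\<l> c) (at z)"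
abbreviation "g c i \<equiv> \<gamma> i \<circ> chart_inv c"
abbreviation "g' c i x \<equiv> frechet_derivative (g c i) (at x)"
abbreviation "g2 c i v x \<equiv> frechet_derivative (\<lambda>x. g' c i x v) (at x)"

lemma coordinate_action:
  assumes "c \<in> A" "a \<le> s" "s \<le> t" "t \<le> b"
  shows "coordinate_action (coord_dom c) (\<l> c) (\<l>' c) m (g c) (g' c) (g2 c) w s t"
proof
  show "open (coord_dom c)" by (rule open_coord_dom[OF assms(1)])
  show "C1_deriv_on (coord_dom c \<times> UNIV) (\<l> c) (\<l>' c)"
    using L assms(1) unfolding C2_lagrangian_def by (intro Ck_on_2D(1)) blast
  fix i assume i: "i \<in> {1..m}"
  have *: "Ck_on 2 (coord_dom c) (g c i)" using \<gamma>[OF i] assms(1) unfolding C2_function_def by blast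
  show "C1_deriv_on (coord_dom c) (g c i) (g' c i)" by (rule Ck_on_2D(1)[OF *])
  show "C1_deriv_on (coord_dom c) (\<lambda>x. g' c i x v) (g2 c i v)" for v by (rule Ck_on_2D(2)[OF *])
  show "continuous_on {s..t} (w i)" using w[OF i] assms by (auto elim: continuous_on_subset)
qed (rule assms)

text \<open>The noise enters through the time derivative of \<gamma> along the path. This is an
  ordinary continuous integrand, independent of the choice of a chart, so actions over adjacent
  intervals add up by additivity of the ordinary integral.\<close>

fun density :: "('q, 'e) path \<Rightarrow> real \<Rightarrow> real" where
  "density (q, v, p) r = L (q r, v r) + pairing A (q r) (p r) (\<lambda>c. velocity A a b q r c - v r c) -
     (\<Sum>i=1..m. w i r * vector_derivative (\<lambda>t. \<gamma> i (q t)) (at r within {a..b}))"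

definition partial_action :: "real \<Rightarrow> real \<Rightarrow> ('q, 'e) path \<Rightarrow> real" where
  "partial_action s t c = integral {s..t} (density c) +
     (\<Sum>i=1..m. \<gamma> i (fst c t) * w i t - \<gamma> i (fst c s) * w i s)"

context
  fixes q v p q1 q2
  assumes P: "(q, v, p) \<in> path_space A a b q1 q2"
begin

abbreviation "\<kappa> c \<equiv> path_coords a b c (q, v, p)"

lemma lagrangian_coords:
  assumes "c \<in> A" "r \<in> chart_times q c"
  shows "L (q r, v r) = \<l> c (snd c (q r), v r c)"
  using assms tangent_of_coords_eq[OF path_tangent[OF P], of r c]
  by (simp add: local_lagrangian_def charts_at_def)

lemma pairing_coords:
  assumes "c \<in> A" "r \<in> chart_times q c"
  shows "pairing A (q r) (p r) (\<lambda>c. velocity A a b q r c - v r c) = p r c \<bullet> (fst (snd (\<kappa> c r)) - v r c)"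
proof -
  have c: "c \<in> charts_at A (q r)" using assms by (simp add: charts_at_def)
  have "(\<lambda>c. velocity A a b q r c - v r c) \<in> tangent_space A (q r)"
    using assms by (intro tangent_space_diff velocity_tangent[OF P] path_tangent[OF P]) auto
  then show ?thesis
    using pairing_eq[OF path_cotangent[OF P], of r, OF _ _ c] assms c by (simp add: velocity_def)
qed

lemma gamma_has_vector_derivative:
  assumes "c \<in> A" "r \<in> chart_times q c" "i \<in> {1..m}"
  shows "((\<lambda>t. \<gamma> i (q t)) has_vector_derivative g' c i (snd c (q r)) (fst (snd (\<kappa> c r)))) (at r within {a..b})"
proof (rule has_vector_derivative_openin_cong[OF openin_times[OF path_continuous[OF P] assms(1)] assms(2)])
  interpret C: coordinate_action "coord_dom c" "\<l> c" "\<l>' c" m "g c" "g' c" "g2 c" w a b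
    using ab assms by (intro coordinate_action) auto
  show "((\<lambda>t. g c i (snd c (q t))) has_vector_derivative g' c i (snd c (q r)) (fst (snd (\<kappa> c r)))) (at r within {a..b})"
    using assms by (intro C1_deriv_on_has_vector_derivative[OF C.\<gamma> path_has_vector_derivative[OF P]]) auto
qed (use assms in auto)

lemma gamma_vector_derivative:
  assumes "c \<in> A" "r \<in> chart_times q c" "i \<in> {1..m}"
  shows "vector_derivative (\<lambda>t. \<gamma> i (q t)) (at r within {a..b}) = g' c i (snd c (q r)) (fst (snd (\<kappa> c r)))"
  using vector_derivative_eq[OF gamma_has_vector_derivative[OF assms]] assms(2) by simp

lemma continuous_on_if_charts:
  assumes "\<And>c. c \<in> A \<Longrightarrow> continuous_on (chart_times q c) f"
  shows "continuous_on {a..b} f"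
proof (rule continuous_on_openin_localI[where T = "{a..b}"])
  fix r assume r: "r \<in> {a..b}"
  obtain c where "c \<in> charts_at A (q r)" using ex_chart by blast
  then have "c \<in> A" "r \<in> chart_times q c" using r by (auto simp: charts_at_def)
  then show "\<exists>S. openin (top_of_set {a..b}) S \<and> r \<in> S \<and> S \<subseteq> {a..b} \<and> continuous_on S f"
    using openin_times[OF path_continuous[OF P]] assms by (intro exI[of _ "chart_times q c"]) auto
qed simp

lemma continuous_path_coords_compose:
  assumes "c \<in> A" "C1_deriv_on (coord_dom c \<times> UNIV) f f'"
  shows "continuous_on (chart_times q c) (\<lambda>r. f (\<kappa> c r))"
  by (rule continuous_on_compose2[OF C1_deriv_on_continuous[OF assms(2)] path_coords_continuous[OF P assms(1)]]) auto

lemma continuous_lagrangian: "continuous_on {a..b} (\<lambda>r. L (q r, v r))"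
proof (rule continuous_on_if_charts)
  fix c assume c: "c \<in> A"
  interpret C: coordinate_action "coord_dom c" "\<l> c" "\<l>' c" m "g c" "g' c" "g2 c" w a b
    using ab c by (intro coordinate_action) auto
  have "C1_deriv_on (coord_dom c \<times> UNIV) (\<lambda>z::'e \<times> 'e \<times> 'e \<times> 'e. (fst z, fst (snd (snd z))))
      (\<lambda>_ k. (fst k, fst (snd (snd k))))"
    by (rule C1_deriv_on_linear) (intro bounded_linear_intros)
  note * = C1_deriv_on_compose[OF this C.\<l>]
  have "continuous_on (chart_times q c) (\<lambda>r. \<l> c (fst (\<kappa> c r), fst (snd (snd (\<kappa> c r)))))"
    by (rule continuous_path_coords_compose[OF c *]) auto
  then show "continuous_on (chart_times q c) (\<lambda>r. L (q r, v r))"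
    by (rule continuous_on_eq) (use lagrangian_coords[OF c] in simp)
qed

lemma continuous_pairing:
  "continuous_on {a..b} (\<lambda>r. pairing A (q r) (p r) (\<lambda>c. velocity A a b q r c - v r c))"
proof (rule continuous_on_if_charts)
  fix c assume c: "c \<in> A"
  have "continuous_on (chart_times q c) (\<lambda>r. snd (snd (snd (\<kappa> c r))) \<bullet> (fst (snd (\<kappa> c r)) - fst (snd (snd (\<kappa> c r)))))"
    by (intro continuous_intros path_coords_continuous[OF P c])
  then show "continuous_on (chart_times q c) (\<lambda>r. pairing A (q r) (p r) (\<lambda>c. velocity A a b q r c - v r c))"
    by (rule continuous_on_eq) (use pairing_coords[OF c] in simp)
qed

lemma continuous_gamma_derivative:
  assumes "i \<in> {1..m}"
  shows "continuous_on {a..b} (\<lambda>r. vector_derivative (\<lambda>t. \<gamma> i (q t)) (at r within {a..b}))"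
proof (rule continuous_on_if_charts)
  fix c assume c: "c \<in> A"
  interpret C: coordinate_action "coord_dom c" "\<l> c" "\<l>' c" m "g c" "g' c" "g2 c" w a b
    using ab c by (intro coordinate_action) auto
  have "continuous_on (chart_times q c) (\<lambda>r. C.noise_term i (\<kappa> c r))"
    by (rule continuous_path_coords_compose[OF c C.C1_noise_term[OF assms]])
  then show "continuous_on (chart_times q c) (\<lambda>r. vector_derivative (\<lambda>t. \<gamma> i (q t)) (at r within {a..b}))"
    by (rule continuous_on_eq) (use gamma_vector_derivative[OF c _ assms] in \<open>simp add: C.noise_term_def\<close>)
qed

lemma continuous_density: "continuous_on {a..b} (density (q, v, p))"
  by (simp only: density.simps[abs_def])
    (intro continuous_intros continuous_lagrangian continuous_pairing continuous_gamma_derivative w)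

text \<open>Summation by parts over all of [a,b] at once: \<gamma> composed with the path is
  real-valued and C1 on the whole interval even when no single chart contains the path.\<close>

lemma hp_action_eq_partial_action: "hp_action A a b L m \<gamma> w (q, v, p) = partial_action a b (q, v, p)"
proof -
  let ?d = "\<lambda>i r. vector_derivative (\<lambda>t. \<gamma> i (q t)) (at r within {a..b})"
  have rs: "rs_integral a b (\<lambda>t. \<gamma> i (q t)) (w i) =
      \<gamma> i (q b) * w i b - \<gamma> i (q a) * w i a - integral {a..b} (\<lambda>r. w i r * ?d i r)" if i: "i \<in> {1..m}" for i
  proof (rule rs_integral_C1)
    fix r assume r: "r \<in> {a..b}"
    obtain c where "c \<in> charts_at A (q r)" using ex_chart by blast
    then have c: "c \<in> A" "r \<in> chart_times q c" using r by (auto simp: charts_at_def)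
    show "((\<lambda>t. \<gamma> i (q t)) has_vector_derivative ?d i r) (at r within {a..b})"
      using gamma_has_vector_derivative[OF c i] unfolding gamma_vector_derivative[OF c i] .
  qed (use ab w[OF i] continuous_gamma_derivative[OF i] in auto)
  have int: "(\<lambda>r. L (q r, v r)) integrable_on {a..b}"
    "(\<lambda>r. pairing A (q r) (p r) (\<lambda>c. velocity A a b q r c - v r c)) integrable_on {a..b}"
    "(\<lambda>r. \<Sum>i=1..m. w i r * ?d i r) integrable_on {a..b}"
    by (intro integrable_continuous_real continuous_intros continuous_lagrangian continuous_pairing
        continuous_gamma_derivative w)+
  have "integral {a..b} (density (q, v, p)) = integral {a..b} (\<lambda>r. L (q r, v r)) +
      integral {a..b} (\<lambda>r. pairing A (q r) (p r) (\<lambda>c. velocity A a b q r c - v r c)) -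
      integral {a..b} (\<lambda>r. \<Sum>i=1..m. w i r * ?d i r)"
    unfolding density.simps[abs_def] using int by (simp only: integral_add integral_diff integrable_add)
  also have "integral {a..b} (\<lambda>r. \<Sum>i=1..m. w i r * ?d i r) = (\<Sum>i=1..m. integral {a..b} (\<lambda>r. w i r * ?d i r))"
    by (intro integral_sum integrable_continuous_real continuous_intros continuous_gamma_derivative w) auto
  finally have dens: "integral {a..b} (density (q, v, p)) = integral {a..b} (\<lambda>r. L (q r, v r)) +
      integral {a..b} (\<lambda>r. pairing A (q r) (p r) (\<lambda>c. velocity A a b q r c - v r c)) -
      (\<Sum>i=1..m. integral {a..b} (\<lambda>r. w i r * ?d i r))" .
  have "(\<Sum>i=1..m. rs_integral a b (\<lambda>t. \<gamma> i (q t)) (w i)) =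
      (\<Sum>i=1..m. \<gamma> i (q b) * w i b - \<gamma> i (q a) * w i a - integral {a..b} (\<lambda>r. w i r * ?d i r))"
    by (intro sum.cong refl rs)
  then show ?thesis
    unfolding partial_action_def dens hp_action.simps by (simp add: sum_subtractf)
qed

lemma partial_action_combine:
  assumes "a \<le> s" "s \<le> t" "t \<le> u" "u \<le> b"
  shows "partial_action s u (q, v, p) = partial_action s t (q, v, p) + partial_action t u (q, v, p)"
proof -
  have "density (q, v, p) integrable_on {s..u}"
    using assms by (intro integrable_continuous_real continuous_on_subset[OF continuous_density]) auto
  from Henstock_Kurzweil_Integration.integral_combine[OF assms(2,3) this] show ?thesis
    by (simp add: partial_action_def sum.distrib[symmetric] sum_subtractf)
qed

lemma density_coords:
  assumes "c \<in> A" "r \<in> chart_times q c"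
  shows "density (q, v, p) r = \<l> c (snd c (q r), v r c) + p r c \<bullet> (fst (snd (\<kappa> c r)) - v r c) -
    (\<Sum>i=1..m. w i r * g' c i (snd c (q r)) (fst (snd (\<kappa> c r))))"
  using lagrangian_coords[OF assms] pairing_coords[OF assms] gamma_vector_derivative[OF assms]
  by (simp only: density.simps cong: sum.cong)

text \<open>Over a time interval spent in one chart the global density becomes the integrand of the
  coordinate action, to which the first-variation formula applies.\<close>

lemma partial_action_coords:
  assumes "c \<in> A" "a \<le> s" "s \<le> t" "t \<le> b" "q ` {s..t} \<subseteq> fst c"
  shows "partial_action s t (q, v, p) =
    coordinate_action.action (\<l> c) m (g c) (g' c) w s t (\<kappa> c)"
proof -
  interpret C: coordinate_action "coord_dom c" "\<l> c" "\<l>' c" m "g c" "g' c" "g2 c" w s t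
    using assms by (intro coordinate_action) auto
  have mem: "r \<in> chart_times q c" if "r \<in> {s..t}" for r using that assms by auto
  have "integral {s..t} (density (q, v, p)) =
      integral {s..t} (\<lambda>r. C.hp_term (\<kappa> c r) - (\<Sum>i=1..m. w i r * C.noise_term i (\<kappa> c r)))"
    by (intro integral_cong) (simp add: density_coords[OF assms(1) mem] C.hp_term_def C.noise_term_def del: density.simps)
  then show ?thesis
    using assms mem[of s] mem[of t] by (simp add: partial_action_def C.action_def)
qed

lemma coordinate_curve:
  assumes "c \<in> A" "a \<le> s" "s \<le> t" "t \<le> b" "q ` {s..t} \<subseteq> fst c"
  shows "r \<in> {s..t} \<Longrightarrow> ((\<lambda>t. snd c (q t)) has_vector_derivative fst (snd (\<kappa> c r))) (at r within {s..t})"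
    and "r \<in> {s..t} \<Longrightarrow> snd c (q r) \<in> coord_dom c"
    and "continuous_on {s..t} (\<kappa> c)"
    and "continuous_on {s..t} (\<lambda>r. fst (snd (\<kappa> c r)))"
    and "continuous_on {s..t} (\<lambda>r. v r c)" and "continuous_on {s..t} (\<lambda>r. p r c)"
proof -
  have mem: "r \<in> chart_times q c" if "r \<in> {s..t}" for r using that assms by auto
  show "((\<lambda>t. snd c (q t)) has_vector_derivative fst (snd (\<kappa> c r))) (at r within {s..t})" if "r \<in> {s..t}" for r
    by (rule has_vector_derivative_within_subset[where S = "{a..b}"]) (use path_has_vector_derivative[OF P assms(1) mem[OF that]] assms in auto)
  show "snd c (q r) \<in> coord_dom c" if "r \<in> {s..t}" for r using mem[OF that] by auto
  show c: "continuous_on {s..t} (\<kappa> c)"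
    using path_coords_continuous[OF P assms(1)] by (rule continuous_on_subset) (use mem in blast)
  show "continuous_on {s..t} (\<lambda>r. fst (snd (\<kappa> c r)))" by (intro continuous_intros c)
  show "continuous_on {s..t} (\<lambda>r. v r c)" using continuous_on_fst[OF continuous_on_snd[OF continuous_on_snd[OF c]]] by simp
  show "continuous_on {s..t} (\<lambda>r. p r c)" using continuous_on_snd[OF continuous_on_snd[OF continuous_on_snd[OF c]]] by simp
qed

end

abbreviation "balance s c q v j \<equiv>
  coordinate_action.momentum_balance (\<l>' c) m (g' c) w s (\<lambda>r. snd c (q r)) (\<lambda>r. v r c) j"

text \<open>The definition of \<open>has_path_derivative\<close> keeps the nearby paths in the chart
  over [s,t] and makes the difference quotients of their quadruples converge uniformly. So for small
  h their actions have the coordinate form, and the coordinate computation applies.\<close>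

lemma partial_action_has_derivative:
  fixes \<Gamma> :: "real \<Rightarrow> ('q, 'e) path"
  assumes \<Gamma>: "\<And>h. \<bar>h\<bar> < h0 \<Longrightarrow> \<Gamma> h \<in> path_space A a b q1 q2" "h0 > 0" "\<Gamma> 0 = (q, v, p)"
    and \<delta>: "(\<delta>q, \<delta>v, \<delta>p) \<in> path_tangent_space A a b (q, v, p)"
    and der: "has_path_derivative A a b \<Gamma> (\<delta>q, \<delta>v, \<delta>p) 0"
    and c: "c \<in> A" "a \<le> s" "s \<le> t" "t \<le> b" "q ` {s..t} \<subseteq> fst c"
  shows "((\<lambda>h. partial_action s t (\<Gamma> h)) has_real_derivative
    (\<Sum>j\<in>Basis. balance s c q v j t * (\<delta>q t c \<bullet> j)
       + integral {s..t} (\<lambda>r. (p r c \<bullet> j - balance s c q v j r) *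
           (vector_derivative (\<lambda>t. \<delta>q t c) (at r within {a..b}) \<bullet> j))
       + integral {s..t} (\<lambda>r. (\<l>' c (snd c (q r), v r c) (0, j) - p r c \<bullet> j) * (\<delta>v r c \<bullet> j))
       + integral {s..t} (\<lambda>r. (vector_derivative (\<lambda>t. snd c (q t)) (at r within {a..b}) \<bullet> j - v r c \<bullet> j) *
           (\<delta>p r c \<bullet> j)))) (at 0)"
proof -
  interpret C: coordinate_action "coord_dom c" "\<l> c" "\<l>' c" m "g c" "g' c" "g2 c" w s t
    using c by (intro coordinate_action) auto
  have P: "(q, v, p) \<in> path_space A a b q1 q2" using \<Gamma>(1)[of 0] \<Gamma>(2,3) by simp
  note curve = coordinate_curve[OF P c]
  have mem: "r \<in> chart_times q c" if "r \<in> {s..t}" for r using that c by auto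
  have sub: "{s..t} \<subseteq> chart_times q c" using mem by blast
  let ?\<kappa> = "\<lambda>h. path_coords a b c (\<Gamma> h)" and ?\<delta> = "variation_coords a b c (\<delta>q, \<delta>v, \<delta>p)"
  have "\<forall>c\<in>A. \<forall>s t. a \<le> s \<and> s \<le> t \<and> t \<le> b \<and> fst (\<Gamma> 0) ` {s..t} \<subseteq> fst c \<longrightarrow>
        (\<forall>\<^sub>F h in at 0. fst (\<Gamma> (0 + h)) ` {s..t} \<subseteq> fst c) \<and>
        uniform_limit {s..t} (\<lambda>h r. (path_coords a b c (\<Gamma> (0 + h)) r - path_coords a b c (\<Gamma> 0) r) /\<^sub>R h)
          (variation_coords a b c (\<delta>q, \<delta>v, \<delta>p)) (at 0)"
    using der unfolding has_path_derivative_def .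
  from this[rule_format, OF c(1), of s t] have ev: "\<forall>\<^sub>F h in at 0. fst (\<Gamma> h) ` {s..t} \<subseteq> fst c"
    and lim: "uniform_limit {s..t} (\<lambda>h r. (?\<kappa> h r - ?\<kappa> 0 r) /\<^sub>R h) ?\<delta> (at 0)"
    using c \<Gamma>(3) by simp_all
  \<comment> \<open>At h = 0 the inclusion is the hypothesis on q, which fills in the punctured
    neighbourhood.\<close>
  have ev0: "\<forall>\<^sub>F h in nhds 0. fst (\<Gamma> h) ` {s..t} \<subseteq> fst c"
    using ev \<Gamma>(3) c(5) by (auto simp: eventually_at_filter elim!: eventually_mono)
  have ev1: "\<forall>\<^sub>F h in nhds 0. \<Gamma> h \<in> path_space A a b q1 q2"
    using \<Gamma>(1,2) by (auto simp: eventually_nhds_metric dist_real_def)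
  have good: "\<forall>\<^sub>F h in nhds 0. (continuous_on {s..t} (?\<kappa> h) \<and> ?\<kappa> h ` {s..t} \<subseteq> coord_dom c \<times> UNIV) \<and>
      partial_action s t (\<Gamma> h) = C.action (?\<kappa> h)"
    using ev0 ev1
  proof eventually_elim
    case (elim h)
    obtain q' v' p' where h: "\<Gamma> h = (q', v', p')" by (cases "\<Gamma> h")
    have P': "(q', v', p') \<in> path_space A a b q1 q2" and q': "q' ` {s..t} \<subseteq> fst c" using elim h by auto
    show ?case
      using coordinate_curve(3)[OF P' c(1-4) q'] partial_action_coords[OF P' c(1-4) q'] q'
      by (auto simp: h image_subset_iff)
  qed
  have cd: "continuous_on {s..t} ?\<delta>"
    using variation_coords_continuous[OF P \<delta> c(1)] sub by (rule continuous_on_subset)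
  have 1: "((\<lambda>h. C.action (?\<kappa> h)) has_real_derivative C.action' (?\<kappa> 0) ?\<delta>) (at 0)"
    by (rule C.action_has_derivative[OF _ cd lim]) (use good in \<open>auto elim: eventually_mono\<close>)
  have 2: "((\<lambda>h. partial_action s t (\<Gamma> h)) has_real_derivative C.action' (?\<kappa> 0) ?\<delta>) (at 0)"
  proof -
    have "\<forall>\<^sub>F h in nhds 0. partial_action s t (\<Gamma> h) = C.action (?\<kappa> h)"
      using good by (rule eventually_mono) blast
    from DERIV_cong_ev[OF refl this refl] 1 show ?thesis by blast
  qed
  have "C.action' (?\<kappa> 0) ?\<delta> = C.action'
      (\<lambda>r. (snd c (q r), fst (snd (path_coords a b c (q, v, p) r)), v r c, p r c))
      (\<lambda>r. (\<delta>q r c, fst (snd (?\<delta> r)), \<delta>v r c, \<delta>p r c))"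
    by (intro arg_cong2[where f = C.action'] ext) (simp_all add: \<Gamma>(3))
  also have "\<dots> = (\<Sum>j\<in>Basis. balance s c q v j t * (\<delta>q t c \<bullet> j)
       + integral {s..t} (\<lambda>r. (p r c \<bullet> j - balance s c q v j r) * (fst (snd (?\<delta> r)) \<bullet> j))
       + integral {s..t} (\<lambda>r. (\<l>' c (snd c (q r), v r c) (0, j) - p r c \<bullet> j) * (\<delta>v r c \<bullet> j))
       + integral {s..t} (\<lambda>r. (fst (snd (path_coords a b c (q, v, p) r)) \<bullet> j - v r c \<bullet> j) * (\<delta>p r c \<bullet> j)))"
  proof (rule C.action'_eq)
    show "((\<lambda>r. \<delta>q r c) has_vector_derivative fst (snd (?\<delta> r))) (at r within {s..t})" if "r \<in> {s..t}" for r
      by (rule has_vector_derivative_within_subset[where S = "{a..b}"]) (use variation_has_vector_derivative[OF P \<delta> c(1) mem[OF that]] c in auto)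
    show "continuous_on {s..t} (\<lambda>r. fst (snd (?\<delta> r)))" by (intro continuous_intros cd)
    show "continuous_on {s..t} (\<lambda>r. \<delta>v r c)" using continuous_on_fst[OF continuous_on_snd[OF continuous_on_snd[OF cd]]] by simp
    show "continuous_on {s..t} (\<lambda>r. \<delta>p r c)" using continuous_on_snd[OF continuous_on_snd[OF continuous_on_snd[OF cd]]] by simp
  qed (rule curve; assumption)+
  finally show ?thesis using 2 by simp
qed

section \<open>Solutions of the equations are critical\<close>

text \<open>The formula for the derivative is available only over intervals spent in one chart. No
  partition is chosen; Bolzano's bisection principle propagates the formula from short intervals to
  [a,b]. The pairing vanishes at a and b because \<delta>q does.\<close>

lemma hp_equations_imp_critical:
  assumes P: "(q, v, p) \<in> path_space A a b q1 q2" and eqs: "hp_equations A a b L m \<gamma> w (q, v, p)"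
  shows "critical_point A a b q1 q2 (hp_action A a b L m \<gamma> w) (q, v, p)"
  unfolding critical_point_def has_path_differential_def
proof (intro ballI allI impI)
  fix \<delta> \<Gamma> assume "\<delta> \<in> path_tangent_space A a b (q, v, p)" and fam: "path_family A a b q1 q2 (q, v, p) \<delta> \<Gamma>"
  then obtain \<delta>q \<delta>v \<delta>p where \<delta>: "(\<delta>q, \<delta>v, \<delta>p) \<in> path_tangent_space A a b (q, v, p)" and \<delta>_eq: "\<delta> = (\<delta>q, \<delta>v, \<delta>p)"
    by (cases \<delta>) auto
  obtain h0 where h0: "h0 > 0" "\<And>h. \<bar>h\<bar> < h0 \<Longrightarrow> \<Gamma> h \<in> path_space A a b q1 q2"
    and \<Gamma>0: "\<Gamma> 0 = (q, v, p)" and der: "has_path_derivative A a b \<Gamma> (\<delta>q, \<delta>v, \<delta>p) 0"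
    using fam unfolding path_family_def \<delta>_eq by blast
  have tan: "\<delta>q r \<in> tangent_space A (q r)" if "r \<in> {a..b}" for r
  proof (rule tangent_spaceI)
    have pt: "(\<delta>q r, \<delta>v r, \<delta>p r) \<in> pontryagin_tangent_space A (q r) (v r) (p r)" using \<delta> that by simp
    show "\<delta>q r d = D c d (snd c (q r)) (\<delta>q r c)" if "c \<in> charts_at A (q r)" "d \<in> charts_at A (q r)" for c d
      by (rule pontryagin_tangent_spaceD(2)[OF pt that])
    show "\<delta>q r c = 0" if "c \<notin> charts_at A (q r)" for c
      using pt that unfolding pontryagin_tangent_space_def by blast
  qed
  define B where "B r = pairing A (q r) (p r) (\<delta>q r)" for r
  have vel: "velocity A a b q r = v r" and mom: "p r = fibre_derivative A L (q r) (v r)" if "r \<in> {a..b}" for r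
    using eqs that by auto
  have bal: "p r c \<bullet> j - p s c \<bullet> j = balance s c q v j r"
    if "c \<in> A" "a \<le> s" "s \<le> r" "r \<le> b" "q ` {s..r} \<subseteq> fst c" "j \<in> Basis" for c s r j
  proof -
    interpret C: coordinate_action "coord_dom c" "\<l> c" "\<l>' c" m "g c" "g' c" "g2 c" w s r
      using that by (intro coordinate_action) auto
    show ?thesis using eqs that unfolding C.momentum_balance_def hp_equations.simps by blast
  qed
  have piece: "((\<lambda>h. partial_action s t (\<Gamma> h)) has_real_derivative B t - B s) (at 0)"
    if c: "c \<in> A" "a \<le> s" "s \<le> t" "t \<le> b" "q ` {s..t} \<subseteq> fst c" for c s t
  proof -
    let ?\<eta> = "\<lambda>r. vector_derivative (\<lambda>t. \<delta>q t c) (at r within {a..b})"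
    have mem: "r \<in> chart_times q c" "c \<in> charts_at A (q r)" "r \<in> {a..b}" if "r \<in> {s..t}" for r
      using that c by (auto simp: charts_at_def)
    have j: "balance s c q v j t * (\<delta>q t c \<bullet> j)
       + integral {s..t} (\<lambda>r. (p r c \<bullet> j - balance s c q v j r) * (?\<eta> r \<bullet> j))
       + integral {s..t} (\<lambda>r. (\<l>' c (snd c (q r), v r c) (0, j) - p r c \<bullet> j) * (\<delta>v r c \<bullet> j))
       + integral {s..t} (\<lambda>r. (vector_derivative (\<lambda>t. snd c (q t)) (at r within {a..b}) \<bullet> j - v r c \<bullet> j) * (\<delta>p r c \<bullet> j))
       = (p t c \<bullet> j) * (\<delta>q t c \<bullet> j) - (p s c \<bullet> j) * (\<delta>q s c \<bullet> j)" if j: "j \<in> Basis" for j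
    proof -
      have b: "balance s c q v j r = p r c \<bullet> j - p s c \<bullet> j" if "r \<in> {s..t}" for r
        using that c j by (intro bal[symmetric]) auto
      \<comment> \<open>On a solution p - E is the constant p(s), so the term with the time
        derivative of \<delta>q integrates to an increment.\<close>
      have 1: "integral {s..t} (\<lambda>r. (p r c \<bullet> j - balance s c q v j r) * (?\<eta> r \<bullet> j))
          = integral {s..t} (\<lambda>r. (p s c \<bullet> j) * (?\<eta> r \<bullet> j))"
        by (rule integral_cong) (simp add: b)
      have "((\<lambda>r. \<delta>q r c \<bullet> j) has_vector_derivative ?\<eta> r \<bullet> j) (at r within {s..t})" if "r \<in> {s..t}" for r
      proof -
        have "((\<lambda>r. \<delta>q r c) has_vector_derivative ?\<eta> r) (at r within {s..t})"
          by (rule has_vector_derivative_within_subset[where S = "{a..b}"]) (use variation_has_vector_derivative[OF P \<delta> c(1) mem(1)[OF that]] c in auto)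
        from bounded_linear.has_vector_derivative[OF bounded_linear_inner_left this] show ?thesis .
      qed
      from fundamental_theorem_of_calculus[OF c(3) this]
      have 2: "integral {s..t} (\<lambda>r. ?\<eta> r \<bullet> j) = \<delta>q t c \<bullet> j - \<delta>q s c \<bullet> j" by (simp add: integral_unique)
      have "\<l>' c (snd c (q r), v r c) (0, j) = p r c \<bullet> j" if "r \<in> {s..t}" for r
        using mom[OF mem(3)[OF that]] mem(2)[OF that] j
        by (simp add: fibre_derivative_def inner_sum_left inner_Basis if_distrib cong: if_cong)
      then have 3: "integral {s..t} (\<lambda>r. (\<l>' c (snd c (q r), v r c) (0, j) - p r c \<bullet> j) * (\<delta>v r c \<bullet> j)) = 0"
        by (subst integral_cong[where g = "\<lambda>_. 0"]) auto
      have "vector_derivative (\<lambda>t. snd c (q t)) (at r within {a..b}) = v r c" if "r \<in> {s..t}" for r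
        using fun_cong[OF vel[OF mem(3)[OF that]], of c] mem(2)[OF that] by (simp add: velocity_def)
      then have 4: "integral {s..t} (\<lambda>r. (vector_derivative (\<lambda>t. snd c (q t)) (at r within {a..b}) \<bullet> j - v r c \<bullet> j) * (\<delta>p r c \<bullet> j)) = 0"
        by (subst integral_cong[where g = "\<lambda>_. 0"]) auto
      have b': "balance s c q v j t = p t c \<bullet> j - p s c \<bullet> j" using b[of t] c by simp
      show ?thesis unfolding 1 3 4 b' by (simp add: 2 algebra_simps)
    qed
    have "B r = (\<Sum>j\<in>Basis. (p r c \<bullet> j) * (\<delta>q r c \<bullet> j))" if "r \<in> {s..t}" for r
      unfolding B_def using pairing_eq[OF path_cotangent[OF P mem(3)[OF that]] tan[OF mem(3)[OF that]] mem(2)[OF that]]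
        euclidean_inner[of "p r c" "\<delta>q r c"] by simp
    then have "B t - B s = (\<Sum>j\<in>Basis. (p t c \<bullet> j) * (\<delta>q t c \<bullet> j) - (p s c \<bullet> j) * (\<delta>q s c \<bullet> j))"
      using c by (simp add: sum_subtractf)
    then show ?thesis
      using partial_action_has_derivative[OF h0(2,1) \<Gamma>0 \<delta> der c] by (simp only: j cong: sum.cong)
  qed
  \<comment> \<open>The bisection principle speaks of all short intervals around a point, including
    those that stick out of [a,b]; the guard makes the predicate vacuous there.\<close>
  have "a \<le> a \<and> a \<le> b \<and> b \<le> b \<longrightarrow> ((\<lambda>h. partial_action a b (\<Gamma> h)) has_real_derivative B b - B a) (at 0)"
  proof (rule Bolzano[of a b "\<lambda>s t. a \<le> s \<and> s \<le> t \<and> t \<le> b \<longrightarrow>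
      ((\<lambda>h. partial_action s t (\<Gamma> h)) has_real_derivative B t - B s) (at 0)"])
    fix s t u
    assume IH: "a \<le> s \<and> s \<le> t \<and> t \<le> b \<longrightarrow> ((\<lambda>h. partial_action s t (\<Gamma> h)) has_real_derivative B t - B s) (at 0)"
      "a \<le> t \<and> t \<le> u \<and> u \<le> b \<longrightarrow> ((\<lambda>h. partial_action t u (\<Gamma> h)) has_real_derivative B u - B t) (at 0)"
      and st: "s \<le> t" and tu: "t \<le> u"
    show "a \<le> s \<and> s \<le> u \<and> u \<le> b \<longrightarrow> ((\<lambda>h. partial_action s u (\<Gamma> h)) has_real_derivative B u - B s) (at 0)"
    proof
      assume su: "a \<le> s \<and> s \<le> u \<and> u \<le> b"
      have d: "((\<lambda>h. partial_action s t (\<Gamma> h) + partial_action t u (\<Gamma> h)) has_real_derivative (B t - B s) + (B u - B t)) (at 0)"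
        using IH su st tu by (intro DERIV_add) auto
      have "\<forall>\<^sub>F h in nhds 0. \<bar>h\<bar> < h0"
        using h0(1) by (auto simp: eventually_nhds_metric dist_real_def)
      then have "\<forall>\<^sub>F h in nhds 0. partial_action s u (\<Gamma> h) = partial_action s t (\<Gamma> h) + partial_action t u (\<Gamma> h)"
      proof eventually_elim
        case (elim h)
        obtain q' v' p' where "\<Gamma> h = (q', v', p')" by (cases "\<Gamma> h")
        then show ?case using partial_action_combine[of q' v' p' q1 q2 s t u] h0(2)[OF elim] su st tu by simp
      qed
      from DERIV_cong_ev[OF refl this refl] d
      show "((\<lambda>h. partial_action s u (\<Gamma> h)) has_real_derivative B u - B s) (at 0)" by simp
    qed
  next
    fix x assume x: "a \<le> x" "x \<le> b"
    obtain c where c: "c \<in> charts_at A (q x)" using ex_chart by blast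
    then have cA: "c \<in> A" and xc: "x \<in> chart_times q c" using x by (auto simp: charts_at_def)
    from openin_times[OF path_continuous[OF P] cA] xc obtain d where d: "d > 0"
      "\<And>r. r \<in> {a..b} \<Longrightarrow> dist r x < d \<Longrightarrow> r \<in> chart_times q c"
      unfolding openin_euclidean_subtopology_iff by blast
    show "\<exists>d>0. \<forall>s t. s \<le> x \<and> x \<le> t \<and> t - s < d \<longrightarrow> (a \<le> s \<and> s \<le> t \<and> t \<le> b \<longrightarrow>
        ((\<lambda>h. partial_action s t (\<Gamma> h)) has_real_derivative B t - B s) (at 0))"
    proof (intro exI[of _ d] conjI allI impI d(1))
      fix s t assume st: "s \<le> x \<and> x \<le> t \<and> t - s < d" "a \<le> s \<and> s \<le> t \<and> t \<le> b"
      have "q ` {s..t} \<subseteq> fst c"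
      proof clarify
        fix r assume "r \<in> {s..t}"
        then have "r \<in> {a..b}" "dist r x < d" using st by (auto simp: dist_real_def)
        from d(2)[OF this] show "q r \<in> fst c" by simp
      qed
      then show "((\<lambda>h. partial_action s t (\<Gamma> h)) has_real_derivative B t - B s) (at 0)"
        using st by (intro piece[OF cA]) auto
    qed
  qed (use ab in simp)
  moreover have "B a = 0" "B b = 0" using \<delta> by (simp_all add: B_def pairing_def Let_def del: split_paired_All)
  ultimately have d: "((\<lambda>h. partial_action a b (\<Gamma> h)) has_real_derivative 0) (at 0)" using ab by simp
  have "\<forall>\<^sub>F h in nhds 0. \<bar>h\<bar> < h0"
    using h0(1) by (auto simp: eventually_nhds_metric dist_real_def)
  then have "\<forall>\<^sub>F h in nhds 0. hp_action A a b L m \<gamma> w (\<Gamma> h) = partial_action a b (\<Gamma> h)"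
  proof eventually_elim
    case (elim h)
    obtain q' v' p' where "\<Gamma> h = (q', v', p')" by (cases "\<Gamma> h")
    then show ?case using hp_action_eq_partial_action[of q' v' p' q1 q2] h0(2)[OF elim] by simp
  qed
  from DERIV_cong_ev[OF refl this refl] d
  show "((\<lambda>e. hp_action A a b L m \<gamma> w (\<Gamma> e)) has_real_derivative 0) (at 0)" by simp
qed

end

section \<open>Variations supported in a chart\<close>

context atlas
begin

lemma linear_DP:
  "c \<in> A \<Longrightarrow> d \<in> A \<Longrightarrow> x \<in> overlap c d \<Longrightarrow> linear (DP c d (x, z))"
  by (rule has_derivative_linear[OF C1_deriv_onD[OF C1_pontryagin_transition]]) auto

lemma DP_self:
  assumes "c \<in> A" "x \<in> coord_dom c" shows "DP c c (x, u, \<pi>) k = k"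
proof -
  have op: "open (coord_dom c \<times> (UNIV :: ('e \<times> 'e) set))" using assms open_coord_dom by (intro open_Times) auto
  have "(PT c c has_derivative (\<lambda>k. k)) (at (x, u, \<pi>))"
  proof (rule has_derivative_transform_within_open[OF has_derivative_ident op])
    show "(x, u, \<pi>) \<in> coord_dom c \<times> UNIV" using assms by simp
    fix z :: "'e \<times> 'e \<times> 'e" assume "z \<in> coord_dom c \<times> UNIV"
    then obtain q u \<pi> where z: "z = (snd c q, u, \<pi>)" "q \<in> fst c" by (cases z) auto
    have ch: "c \<in> charts_at A q" using z assms by (simp add: charts_at_def)
    show "z = PT c c z"
      using pontryagin_transition_coords[OF ch ch tangent_of_coords_in[OF ch, of u] cotangent_of_coords_in[OF ch, of \<pi>]]
      by (simp add: z tangent_of_coords_self[OF ch] cotangent_of_coords_self[OF ch])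
  qed
  from frechet_derivative_at[OF this] show ?thesis by metis
qed

end

section \<open>A family of paths that varies a given path inside one chart\<close>

text \<open>The fields \<xi>, \<eta>, \<alpha>, \<beta> are the prescribed coordinates in
  \<open>c\<close> of the variations of position, its time derivative, velocity variable and
  momentum. They live on [a,b] and vanish off the open interval (s,t), so the perturbed path keeps
  its position, its time derivative and both fibre variables at s and t.\<close>

locale chart_variation = interval_atlas A a b
  for A :: "('q::t2_space, 'e::euclidean_space) chart set" and a b :: real +
  fixes q :: "real \<Rightarrow> 'q" and v p :: "real \<Rightarrow> ('q, 'e) fibre" and q1 q2 :: 'q and c :: "('q, 'e) chart"
    and s t :: real and \<xi> \<eta> \<alpha> \<beta> :: "real \<Rightarrow> 'e"
  assumes P: "(q, v, p) \<in> path_space A a b q1 q2" and c: "c \<in> A"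
    and st: "a \<le> s" "s < t" "t \<le> b" and qc: "q ` {s..t} \<subseteq> fst c"
    and \<xi>: "\<And>r. r \<in> {a..b} \<Longrightarrow> (\<xi> has_vector_derivative \<eta> r) (at r within {a..b})"
    and \<eta>: "continuous_on {a..b} \<eta>" and \<alpha>: "continuous_on {a..b} \<alpha>" and \<beta>: "continuous_on {a..b} \<beta>"
    and supp: "\<And>r. r \<in> {a..b} \<Longrightarrow> r \<notin> {s<..<t} \<Longrightarrow> \<xi> r = 0 \<and> \<eta> r = 0 \<and> \<alpha> r = 0 \<and> \<beta> r = 0"
begin

abbreviation "T1 \<equiv> chart_times q c"
abbreviation "T2 \<equiv> {a..b} - {s..t}"
abbreviation "\<kappa> \<equiv> path_coords a b c (q, v, p)"

text \<open>The perturbation is written down wherever the path is in the chart and not only on \<open>[s,t]\<close>: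
  the times where it applies and the times where nothing changes then form a relatively open cover
  of \<open>[a,b]\<close>, and regularity at the end points of the support comes for free.\<close>

definition qv :: "real \<Rightarrow> real \<Rightarrow> 'q" where
  "qv e r = (if r \<in> T1 then chart_inv c (snd c (q r) + e *\<^sub>R \<xi> r) else q r)"

definition vv :: "real \<Rightarrow> real \<Rightarrow> ('q, 'e) fibre" where
  "vv e r = (if r \<in> T1 then tangent_of_coords A c (qv e r) (v r c + e *\<^sub>R \<alpha> r) else v r)"

definition pv :: "real \<Rightarrow> real \<Rightarrow> ('q, 'e) fibre" where
  "pv e r = (if r \<in> T1 then cotangent_of_coords A c (qv e r) (p r c + e *\<^sub>R \<beta> r) else p r)"

definition varied :: "real \<Rightarrow> ('q, 'e) path" where
  "varied e = (qv e, vv e, pv e)"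

text \<open>The fields, read in \<open>c\<close> at the perturbed point, are pushed to the chart
  \<open>d\<close> by the derivative of the bundle transition. The value 0 at charts that miss the
  base point is the convention of \<open>pontryagin_tangent_space\<close>; at times when the path is
  outside \<open>c\<close> nothing moves, and 0 is the actual variation.\<close>

definition vcoords :: "real \<Rightarrow> real \<Rightarrow> ('q, 'e) chart \<Rightarrow> 'e \<times> 'e \<times> 'e" where
  "vcoords e r d = (if r \<in> T1 \<and> d \<in> charts_at A (qv e r)
     then DP c d (snd c (q r) + e *\<^sub>R \<xi> r, v r c + e *\<^sub>R \<alpha> r, p r c + e *\<^sub>R \<beta> r) (\<xi> r, \<alpha> r, \<beta> r) else 0)"

definition variation :: "real \<Rightarrow> ('q, 'e) path_variation" where
  "variation e = (\<lambda>r d. fst (vcoords e r d), \<lambda>r d. fst (snd (vcoords e r d)), \<lambda>r d. snd (snd (vcoords e r d)))"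

lemma T1: "openin (top_of_set {a..b}) T1"
  by (rule openin_times[OF path_continuous[OF P] c])

lemma T2: "openin (top_of_set {a..b}) T2"
  using openin_open_Int[OF open_Compl[OF closed_atLeastAtMost], of "{a..b}" s t] by (simp add: Diff_eq)

lemma T_cover: "r \<in> {a..b} \<Longrightarrow> r \<in> T1 \<or> r \<in> T2"
  using qc by (auto simp: image_subset_iff)

lemma st_T1: "{s..t} \<subseteq> T1" using qc st by auto

lemma continuous_\<xi>: "continuous_on {a..b} \<xi>"
  by (rule has_vector_derivative_continuous_on[OF \<xi>])

text \<open>Compactness gives a margin around the coordinates over [s,t]. At the remaining times in
  \<open>T1\<close> the field \<xi> is zero, so the point cannot leave the chart.\<close>

lemma ex_amplitude: "\<exists>h0>0. \<forall>e r. \<bar>e\<bar> < h0 \<longrightarrow> r \<in> T1 \<longrightarrow> snd c (q r) + e *\<^sub>R \<xi> r \<in> coord_dom c"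
proof -
  have cx: "continuous_on {s..t} (\<lambda>r. snd c (q r))"
    using st by (intro continuous_on_compose2[OF continuous_chart[OF c] continuous_on_subset[OF path_continuous[OF P]] qc]) auto
  have "compact ((\<lambda>r. snd c (q r)) ` {s..t})" by (intro compact_continuous_image cx) auto
  then obtain d0 where d0: "d0 > 0" "(\<Union>x\<in>(\<lambda>r. snd c (q r)) ` {s..t}. cball x d0) \<subseteq> coord_dom c"
    using compact_subset_open_imp_cball_epsilon_subset[OF _ open_coord_dom[OF c]] qc by blast
  have "bounded (\<xi> ` {a..b})" by (intro compact_imp_bounded compact_continuous_image continuous_\<xi>) auto
  then obtain B where B: "B > 0" "\<And>r. r \<in> {a..b} \<Longrightarrow> norm (\<xi> r) \<le> B" by (auto simp: bounded_pos)
  show ?thesis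
  proof (intro exI[of _ "d0 / B"] conjI allI impI)
    show "d0 / B > 0" using d0 B by simp
    fix e r assume e: "\<bar>e\<bar> < d0 / B" and r: "r \<in> T1"
    show "snd c (q r) + e *\<^sub>R \<xi> r \<in> coord_dom c"
    proof (cases "r \<in> {s<..<t}")
      case True
      have "norm (e *\<^sub>R \<xi> r) \<le> \<bar>e\<bar> * B" using B(2) r by (simp add: mult_left_mono)
      also have "\<dots> \<le> d0" using e B by (simp add: field_simps)
      finally have "snd c (q r) + e *\<^sub>R \<xi> r \<in> cball (snd c (q r)) d0" by (simp add: dist_norm)
      moreover have "r \<in> {s..t}" using True by simp
      ultimately show ?thesis using d0(2) by blast
    next
      case False
      then show ?thesis using supp[of r] r by auto
    qed
  qed
qed

text \<open>A named constant rather than a locally obtained bound, so that statements outside the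
  locale can refer to the admissible amplitudes.\<close>

definition h0 :: real where
  "h0 = (SOME h. h > 0 \<and> (\<forall>e r. \<bar>e\<bar> < h \<longrightarrow> r \<in> T1 \<longrightarrow> snd c (q r) + e *\<^sub>R \<xi> r \<in> coord_dom c))"

lemma h0: "h0 > 0" "\<bar>e\<bar> < h0 \<Longrightarrow> r \<in> T1 \<Longrightarrow> snd c (q r) + e *\<^sub>R \<xi> r \<in> coord_dom c"
  using someI_ex[OF ex_amplitude] unfolding h0_def[symmetric] by blast+

context
  fixes e :: real assumes e: "\<bar>e\<bar> < h0"
begin

lemma qv_coords:
  assumes "r \<in> T1"
  shows "qv e r \<in> fst c" "snd c (qv e r) = snd c (q r) + e *\<^sub>R \<xi> r" "c \<in> charts_at A (qv e r)"
  using chart_inv_in[OF c h0(2)[OF e assms]] chart_chart_inv[OF c h0(2)[OF e assms]] assms c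
  by (simp_all add: qv_def charts_at_def)

lemma vv_coords: "r \<in> T1 \<Longrightarrow> vv e r c = v r c + e *\<^sub>R \<alpha> r"
  using tangent_of_coords_self[OF qv_coords(3)] by (simp add: vv_def)

lemma pv_coords: "r \<in> T1 \<Longrightarrow> pv e r c = p r c + e *\<^sub>R \<beta> r"
  using cotangent_of_coords_self[OF qv_coords(3)] by (simp add: pv_def)

text \<open>Where the path is in \<open>c\<close> but the fields vanish, point, vector and covector
  are rebuilt from unchanged coordinates and hence are the original ones.\<close>

lemma varied_outside:
  assumes "r \<in> {a..b}" "r \<notin> {s<..<t}"
  shows "qv e r = q r" "vv e r = v r" "pv e r = p r"
proof -
  have ch: "c \<in> charts_at A (q r)" if "r \<in> T1" using that c by (simp add: charts_at_def)
  show q: "qv e r = q r" using supp[OF assms] chart_inv_chart[OF c] by (simp add: qv_def)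
  show "vv e r = v r"
    using supp[OF assms] tangent_of_coords_eq[OF path_tangent[OF P assms(1)]] ch by (simp add: vv_def q)
  show "pv e r = p r"
    using supp[OF assms] cotangent_of_coords_eq[OF path_cotangent[OF P assms(1)]] ch by (simp add: pv_def q)
qed

lemma varied_T2: "r \<in> T2 \<Longrightarrow> qv e r = q r" "r \<in> T2 \<Longrightarrow> vv e r = v r" "r \<in> T2 \<Longrightarrow> pv e r = p r"
  using varied_outside[of r] by auto

lemma continuous_qv: "continuous_on {a..b} (qv e)"
proof (rule continuous_on_openin_localI[where T = "{a..b}"])
  fix r assume "r \<in> {a..b}"
  then consider "r \<in> T1" | "r \<in> T2" using T_cover by blast
  then show "\<exists>S. openin (top_of_set {a..b}) S \<and> r \<in> S \<and> S \<subseteq> {a..b} \<and> continuous_on S (qv e)"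
  proof cases
    case 1
    have "continuous_on T1 (\<lambda>r. snd c (q r))"
      using continuous_on_fst[OF path_coords_continuous[OF P c]] by simp
    moreover have "continuous_on T1 \<xi>" using continuous_\<xi> by (rule continuous_on_subset) auto
    ultimately have "continuous_on T1 (\<lambda>r. snd c (q r) + e *\<^sub>R \<xi> r)" by (intro continuous_intros)
    then have "continuous_on T1 (\<lambda>r. chart_inv c (snd c (q r) + e *\<^sub>R \<xi> r))"
      by (rule continuous_on_compose2[OF continuous_chart_inv[OF c]]) (use h0(2)[OF e] in blast)
    then have "continuous_on T1 (qv e)" by (rule continuous_on_eq) (simp add: qv_def)
    then show ?thesis using 1 T1 by (intro exI[of _ T1]) auto
  next
    case 2
    have "continuous_on T2 q" using path_continuous[OF P] by (rule continuous_on_subset) auto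
    then have "continuous_on T2 (qv e)" by (rule continuous_on_eq) (use varied_T2 in simp)
    then show ?thesis using 2 T2 by (intro exI[of _ T2]) auto
  qed
qed simp

lemma qv_has_vector_derivative:
  assumes "r \<in> T1"
  shows "((\<lambda>t. snd c (qv e t)) has_vector_derivative fst (snd (\<kappa> r)) + e *\<^sub>R \<eta> r) (at r within {a..b})"
proof (rule has_vector_derivative_openin_cong[OF T1 assms qv_coords(2)])
  have "((\<lambda>t. e *\<^sub>R \<xi> t) has_vector_derivative e *\<^sub>R \<eta> r) (at r within {a..b})"
    using bounded_linear.has_vector_derivative[OF bounded_linear_scaleR_right \<xi>] assms by auto
  then show "((\<lambda>t. snd c (q t) + e *\<^sub>R \<xi> t) has_vector_derivative fst (snd (\<kappa> r)) + e *\<^sub>R \<eta> r) (at r within {a..b})"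
    by (intro has_vector_derivative_add path_has_vector_derivative[OF P c assms])
qed

lemma varied_path: "varied e \<in> path_space A a b q1 q2"
  unfolding varied_def
proof (rule path_space_localI[OF continuous_qv])
  show "qv e a = q1" "qv e b = q2"
    using P varied_outside(1)[of a] varied_outside(1)[of b] st by (auto simp: path_space_def)
  fix r assume r: "r \<in> {a..b}"
  show "vv e r \<in> tangent_space A (qv e r) \<and> pv e r \<in> cotangent_space A (qv e r)"
  proof (cases "r \<in> T1")
    case True
    then show ?thesis
      using tangent_of_coords_in[OF qv_coords(3)] cotangent_of_coords_in[OF qv_coords(3)] by (simp add: vv_def pv_def)
  next
    case False
    then have "r \<in> T2" using T_cover[OF r] by blast
    then show ?thesis using varied_T2 path_tangent[OF P r] path_cotangent[OF P r] by simp
  qed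
  from T_cover[OF r] show "\<exists>d S y. d \<in> A \<and> openin (top_of_set {a..b}) S \<and> r \<in> S \<and> qv e ` S \<subseteq> fst d \<and>
      (\<forall>r'\<in>S. ((\<lambda>t. snd d (qv e t)) has_vector_derivative y r') (at r' within {a..b})) \<and>
      continuous_on S y \<and> continuous_on S (\<lambda>r. vv e r d) \<and> continuous_on S (\<lambda>r. pv e r d)"
  proof
    assume r1: "r \<in> T1"
    have sub: "T1 \<subseteq> {a..b}" by auto
    note ck = path_coords_continuous[OF P c]
    have "continuous_on T1 (\<lambda>r. v r c + e *\<^sub>R \<alpha> r)"
      using continuous_on_fst[OF continuous_on_snd[OF continuous_on_snd[OF ck]]]
      by (intro continuous_intros continuous_on_subset[OF \<alpha> sub]) simp
    then have cv: "continuous_on T1 (\<lambda>r. vv e r c)" by (rule continuous_on_eq) (rule vv_coords[symmetric])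
    have "continuous_on T1 (\<lambda>r. p r c + e *\<^sub>R \<beta> r)"
      using continuous_on_snd[OF continuous_on_snd[OF continuous_on_snd[OF ck]]]
      by (intro continuous_intros continuous_on_subset[OF \<beta> sub]) simp
    then have cp: "continuous_on T1 (\<lambda>r. pv e r c)" by (rule continuous_on_eq) (rule pv_coords[symmetric])
    have "continuous_on T1 (\<lambda>r. fst (snd (\<kappa> r)) + e *\<^sub>R \<eta> r)"
      by (intro continuous_intros ck continuous_on_subset[OF \<eta> sub])
    then show ?thesis
      using c T1 r1 qv_coords(1) qv_has_vector_derivative cv cp
      by (intro exI[of _ c] exI[of _ T1] exI[of _ "\<lambda>r. fst (snd (\<kappa> r)) + e *\<^sub>R \<eta> r"]) blast
  next
    assume r2: "r \<in> T2"
    obtain d where d: "d \<in> A" "q r \<in> fst d" using ex_chart[of "q r"] by (auto simp: charts_at_def)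
    define S where "S = T2 \<inter> chart_times q d"
    have "openin (top_of_set {a..b}) S"
      unfolding S_def by (rule openin_Int[OF T2 openin_times[OF path_continuous[OF P] d(1)]])
    moreover have "r \<in> S" "S \<subseteq> T2" "S \<subseteq> chart_times q d" using r2 d by (auto simp: S_def)
    ultimately have S: "openin (top_of_set {a..b}) S" "r \<in> S" "S \<subseteq> T2" "S \<subseteq> chart_times q d" by blast+
    have eq: "qv e r' = q r'" "vv e r' = v r'" "pv e r' = p r'" if "r' \<in> S" for r'
      using varied_T2 S(3) that by blast+
    note ck = continuous_on_subset[OF path_coords_continuous[OF P d(1)] S(4)]
    have "continuous_on S (\<lambda>r. v r d)" using continuous_on_fst[OF continuous_on_snd[OF continuous_on_snd[OF ck]]] by simp
    then have cv: "continuous_on S (\<lambda>r. vv e r d)" by (rule continuous_on_eq) (simp add: eq)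
    have "continuous_on S (\<lambda>r. p r d)" using continuous_on_snd[OF continuous_on_snd[OF continuous_on_snd[OF ck]]] by simp
    then have cp: "continuous_on S (\<lambda>r. pv e r d)" by (rule continuous_on_eq) (simp add: eq)
    have der: "((\<lambda>t. snd d (qv e t)) has_vector_derivative fst (snd (path_coords a b d (q, v, p) r'))) (at r' within {a..b})"
      if "r' \<in> S" for r'
      by (rule has_vector_derivative_openin_cong[OF S(1) that, of _ "\<lambda>t. snd d (q t)"])
        (use path_has_vector_derivative[OF P d(1) subsetD[OF S(4) that]] eq in auto)
    have im: "qv e ` S \<subseteq> fst d" using eq(1) S(4) by force
    show ?thesis
      using d(1) S(1,2) im der continuous_on_fst[OF continuous_on_snd[OF ck]] cv cp
      by (intro exI[of _ d] exI[of _ S] exI[of _ "\<lambda>r. fst (snd (path_coords a b d (q, v, p) r))"]) blast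
  qed
qed

lemma varied_coords:
  assumes "r \<in> T1"
  shows "path_coords a b c (varied e) r = \<kappa> r + e *\<^sub>R (\<xi> r, \<eta> r, \<alpha> r, \<beta> r)"
  using vector_derivative_eq[OF qv_has_vector_derivative[OF assms]] assms qv_coords(2)[OF assms]
    vv_coords[OF assms] pv_coords[OF assms]
  by (simp add: varied_def)

text \<open>The quadruple contains a time derivative, which the values at the single time r do not
  determine. If the path is in \<open>c\<close> at r, vanishing of \<eta> settles this in
  \<open>c\<close> and \<open>path_transition\<close> carries it to \<open>d\<close>; otherwise the
  path is unchanged on the relatively open set \<open>T2\<close> around r.\<close>

lemma varied_coords_outside:
  assumes r: "r \<in> {a..b}" "r \<notin> {s<..<t}" and d: "d \<in> A" "q r \<in> fst d"
  shows "path_coords a b d (varied e) r = path_coords a b d (q, v, p) r"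
proof (cases "r \<in> T1")
  case True
  have eq: "path_coords a b c (qv e, vv e, pv e) r = \<kappa> r"
    using varied_coords[OF True] supp[OF r] by (simp add: varied_def zero_prod_def[symmetric])
  have "path_coords a b d (qv e, vv e, pv e) r = path_transition c d (path_coords a b c (qv e, vv e, pv e) r)"
    using True d varied_outside(1)[OF r] qv_coords(1)[OF True]
    by (intro path_coords_change[OF varied_path[unfolded varied_def] c d(1)]) auto
  also have "\<dots> = path_coords a b d (q, v, p) r"
    unfolding eq using True d by (intro path_coords_change[OF P c d(1), symmetric]) auto
  finally show ?thesis by (simp add: varied_def)
next
  case False
  then have r2: "r \<in> T2" using T_cover[OF r(1)] by blast
  have "((\<lambda>t. snd d (qv e t)) has_vector_derivative fst (snd (path_coords a b d (q, v, p) r))) (at r within {a..b})"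
    by (rule has_vector_derivative_openin_cong[OF T2 r2, of _ "\<lambda>t. snd d (q t)"])
      (use path_has_vector_derivative[OF P d(1), of r] r(1) d(2) varied_T2 in auto)
  from vector_derivative_eq[OF this r(1)] show ?thesis
    using varied_outside[OF r] by (simp add: varied_def)
qed

lemma vcoords_outside:
  assumes "r \<in> {a..b}" "r \<notin> {s<..<t}" shows "vcoords e r d = 0"
proof (cases "r \<in> T1 \<and> d \<in> charts_at A (qv e r)")
  case True
  then have "linear (DP c d (snd c (q r) + e *\<^sub>R \<xi> r, v r c + e *\<^sub>R \<alpha> r, p r c + e *\<^sub>R \<beta> r))"
    using qv_coords[of r] c by (intro linear_DP) (auto simp: charts_at_def intro!: image_eqI[of _ _ "qv e r"])
  from linear_0[OF this] True supp[OF assms] show ?thesis by (simp add: vcoords_def zero_prod_def)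
qed (auto simp: vcoords_def)

lemma vcoords_self:
  assumes "r \<in> T1" shows "vcoords e r c = (\<xi> r, \<alpha> r, \<beta> r)"
  using DP_self[OF c h0(2)[OF e assms]] qv_coords(3)[OF assms] assms by (simp add: vcoords_def)

text \<open>Compatibility between charts is \<open>DP_chain\<close> with \<open>c\<close> as
  intermediate source; when the path is outside \<open>c\<close>, both sides are 0 by
  linearity.\<close>

lemma variation_tangent: "variation e \<in> path_tangent_space A a b (varied e)"
  unfolding variation_def varied_def
proof (rule path_tangent_space_localI[OF varied_path[unfolded varied_def]])
  fix r assume r: "r \<in> {a..b}"
  have fib: "vv e r \<in> tangent_space A (qv e r)" "pv e r \<in> cotangent_space A (qv e r)"
    using path_tangent[OF varied_path[unfolded varied_def] r] path_cotangent[OF varied_path[unfolded varied_def] r] by auto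
  have chain: "vcoords e r d' = DP d d' (snd d (qv e r), vv e r d, pv e r d) (vcoords e r d)"
    if d: "d \<in> charts_at A (qv e r)" "d' \<in> charts_at A (qv e r)" for d d'
  proof (cases "r \<in> T1")
    case True
    then show ?thesis
      using DP_chain[OF qv_coords(3)[OF True] d fib, of "(\<xi> r, \<alpha> r, \<beta> r)"] d
      by (simp add: vcoords_def qv_coords(2) vv_coords pv_coords)
  next
    case False
    have "linear (DP d d' (snd d (qv e r), vv e r d, pv e r d))"
      using d by (intro linear_DP) (auto simp: charts_at_def)
    moreover have "vcoords e r d = 0" "vcoords e r d' = 0"
      by (simp_all only: vcoords_def False simp_thms if_False)
    ultimately show ?thesis by (simp add: linear_0)
  qed
  show "(\<lambda>d. fst (vcoords e r d), \<lambda>d. fst (snd (vcoords e r d)), \<lambda>d. snd (snd (vcoords e r d)))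
      \<in> pontryagin_tangent_space A (qv e r) (vv e r) (pv e r)"
  proof (rule pontryagin_tangent_spaceI)
    fix d d' assume "d \<in> charts_at A (qv e r)" "d' \<in> charts_at A (qv e r)"
    from chain[OF this] show "(fst (vcoords e r d'), fst (snd (vcoords e r d')), snd (snd (vcoords e r d'))) =
        DP d d' (snd d (qv e r), vv e r d, pv e r d)
          (fst (vcoords e r d), fst (snd (vcoords e r d)), snd (snd (vcoords e r d)))"
      by (simp only: prod.collapse)
  qed (simp add: vcoords_def)
next
  show "fst (vcoords e a d) = 0 \<and> fst (vcoords e b d) = 0" for d
    using vcoords_outside[of a d] vcoords_outside[of b d] st by simp
next
  fix r assume r: "r \<in> {a..b}"
  from T_cover[OF r] show "\<exists>d S \<eta>. d \<in> A \<and> openin (top_of_set {a..b}) S \<and> r \<in> S \<and> S \<subseteq> chart_times (qv e) d \<and>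
      (\<forall>r'\<in>S. ((\<lambda>t. fst (vcoords e t d)) has_vector_derivative \<eta> r') (at r' within {a..b})) \<and>
      continuous_on S \<eta> \<and> continuous_on S (\<lambda>r. fst (snd (vcoords e r d))) \<and> continuous_on S (\<lambda>r. snd (snd (vcoords e r d)))"
  proof
    assume r1: "r \<in> T1"
    have sub: "T1 \<subseteq> {a..b}" "T1 \<subseteq> chart_times (qv e) c" using qv_coords(1) by auto
    have der: "((\<lambda>t. fst (vcoords e t c)) has_vector_derivative \<eta> r') (at r' within {a..b})" if "r' \<in> T1" for r'
      by (rule has_vector_derivative_openin_cong[OF T1 that, of _ \<xi>]) (use that in \<open>auto simp: vcoords_self intro!: \<xi>\<close>)
    have "continuous_on T1 (\<lambda>r. fst (snd (vcoords e r c)))"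
      by (rule continuous_on_eq[OF continuous_on_subset[OF \<alpha> sub(1)]]) (simp add: vcoords_self)
    moreover have "continuous_on T1 (\<lambda>r. snd (snd (vcoords e r c)))"
      by (rule continuous_on_eq[OF continuous_on_subset[OF \<beta> sub(1)]]) (simp add: vcoords_self)
    ultimately show ?thesis
      using c T1 r1 sub(2) der continuous_on_subset[OF \<eta> sub(1)]
      by (intro exI[of _ c] exI[of _ T1] exI[of _ \<eta>]) blast
  next
    assume r2: "r \<in> T2"
    obtain d where d: "d \<in> A" "q r \<in> fst d" using ex_chart[of "q r"] by (auto simp: charts_at_def)
    define S where "S = T2 \<inter> chart_times q d"
    have "openin (top_of_set {a..b}) S"
      unfolding S_def by (rule openin_Int[OF T2 openin_times[OF path_continuous[OF P] d(1)]])
    moreover have "r \<in> S" "S \<subseteq> T2" "S \<subseteq> chart_times q d" using r2 d by (auto simp: S_def)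
    ultimately have S: "openin (top_of_set {a..b}) S" "r \<in> S" "S \<subseteq> T2" "S \<subseteq> chart_times q d" by blast+
    have z: "vcoords e r' d = 0" if "r' \<in> S" for r' using vcoords_outside[of r' d] subsetD[OF S(3) that] by auto
    have sub: "S \<subseteq> chart_times (qv e) d" using varied_T2(1) S(3,4) by force
    have der: "((\<lambda>t. fst (vcoords e t d)) has_vector_derivative 0) (at r' within {a..b})" if "r' \<in> S" for r'
      by (rule has_vector_derivative_openin_cong[OF S(1) that, of _ "\<lambda>_. 0"]) (auto simp: z)
    have "continuous_on S (\<lambda>r. fst (snd (vcoords e r d)))" "continuous_on S (\<lambda>r. snd (snd (vcoords e r d)))"
      using z by (auto cong: continuous_on_cong)
    then show ?thesis
      using d(1) S(1,2) sub der by (intro exI[of _ d] exI[of _ S] exI[of _ "\<lambda>_. 0"]) auto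
  qed
qed

lemma variation_coords_T1:
  assumes "r \<in> T1" shows "variation_coords a b c (variation e) r = (\<xi> r, \<eta> r, \<alpha> r, \<beta> r)"
proof -
  have "((\<lambda>t. fst (vcoords e t c)) has_vector_derivative \<eta> r) (at r within {a..b})"
    by (rule has_vector_derivative_openin_cong[OF T1 assms, of _ \<xi>]) (use assms in \<open>auto simp: vcoords_self intro!: \<xi>\<close>)
  from vector_derivative_eq[OF this] show ?thesis
    using assms vcoords_self[OF assms] by (simp add: variation_def)
qed

lemma variation_coords_T2:
  assumes "r \<in> T2" shows "variation_coords a b d (variation e) r = 0"
proof -
  have z: "vcoords e r' d = 0" if "r' \<in> T2" for r' using vcoords_outside[of r' d] that by auto
  have "((\<lambda>t. fst (vcoords e t d)) has_vector_derivative 0) (at r within {a..b})"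
    by (rule has_vector_derivative_openin_cong[OF T2 assms, of _ "\<lambda>_. 0"]) (auto simp: z)
  from vector_derivative_eq[OF this] show ?thesis
    using assms z[OF assms] by (simp add: variation_def zero_prod_def)
qed

text \<open>In \<open>c\<close> the family is affine in the parameter. For another chart
  \<open>d\<close> the interval is split: on its compact part K inside [s,t] the uniform chain rule
  for \<open>path_transition\<close> applies, and off K the quadruples do not move. The parameter e
  is arbitrary below the amplitude bound because \<open>path_family\<close> asks for
  differentiability at all nearby parameters.\<close>

lemma varied_has_path_derivative: "has_path_derivative A a b varied (variation e) e"
  unfolding has_path_derivative_def
proof (intro ballI allI impI)
  fix d \<sigma> \<theta> assume d: "d \<in> A" and asm: "a \<le> \<sigma> \<and> \<sigma> \<le> \<theta> \<and> \<theta> \<le> b \<and> fst (varied e) ` {\<sigma>..\<theta>} \<subseteq> fst d"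
  then have \<sigma>\<theta>: "a \<le> \<sigma>" "\<theta> \<le> b" and qd: "qv e ` {\<sigma>..\<theta>} \<subseteq> fst d" by (auto simp: varied_def)
  define K where "K = {\<sigma>..\<theta>} \<inter> {s..t}"
  \<comment> \<open>The affine coordinate curve is defined for every h; it gives the coordinates of
    \<open>varied (e + h)\<close> once the absolute value of e + h is below the amplitude
    bound.\<close>
  define Y where "Y h r = path_coords a b c (varied e) r + h *\<^sub>R (\<xi> r, \<eta> r, \<alpha> r, \<beta> r)" for h r
  define k where "k r = (\<xi> r, \<eta> r, \<alpha> r, \<beta> r)" for r
  have K: "compact K" "K \<subseteq> T1" "K \<subseteq> {a..b}" "K \<subseteq> {\<sigma>..\<theta>}"
    using st_T1 \<sigma>\<theta> by (auto simp: K_def)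
  have varT: "varied e = (qv e, vv e, pv e)" by (simp add: varied_def)
  note P' = varied_path[unfolded varT]
  have KT: "r \<in> chart_times (qv e) c" "r \<in> chart_times (qv e) d" if "r \<in> K" for r
    using that K(2-4) qv_coords(1)[OF subsetD[OF K(2) that]] subsetD[OF qd imageI[OF subsetD[OF K(4) that]]] by auto
  have "K \<subseteq> chart_times (qv e) c" using KT by blast
  then have cY: "continuous_on K (path_coords a b c (varied e))"
    unfolding varT by (rule continuous_on_subset[OF path_coords_continuous[OF P' c]])
  have Yin: "path_coords a b c (varied e) ` K \<subseteq> overlap c d \<times> UNIV"
    using KT by (auto simp: varT)
  have "continuous_on K k"
    unfolding k_def using K(3)
    by (intro continuous_on_Pair continuous_on_subset[OF continuous_\<xi>] continuous_on_subset[OF \<eta>]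
        continuous_on_subset[OF \<alpha>] continuous_on_subset[OF \<beta>])
  then have bd: "bounded (k ` K)" by (intro compact_imp_bounded compact_continuous_image K)
  have lim0: "uniform_limit K (\<lambda>h r. (Y h r - path_coords a b c (varied e) r) /\<^sub>R h) k (at 0)"
  proof (rule uniform_limitI)
    fix \<epsilon> :: real assume "\<epsilon> > 0"
    have "\<forall>\<^sub>F h in at (0::real). h \<noteq> 0" by (simp add: eventually_at_filter)
    then show "\<forall>\<^sub>F h in at 0. \<forall>r\<in>K. dist ((Y h r - path_coords a b c (varied e) r) /\<^sub>R h) (k r) < \<epsilon>"
      by eventually_elim (use \<open>\<epsilon> > 0\<close> in \<open>auto simp: Y_def k_def\<close>)
  qed
  have op: "open (overlap c d \<times> (UNIV :: ('e \<times> 'e \<times> 'e) set))" using open_overlap[OF c d] by (intro open_Times) auto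
  have cK: "compact (path_coords a b c (varied e) ` K)" by (intro compact_continuous_image cY K)
  note ul = uniform_limit_difference_quotient_compose[OF op C1_path_transition[OF c d] cK Yin bd lim0]
  have small: "\<forall>\<^sub>F h in at 0. \<bar>e + h\<bar> < h0"
  proof -
    have "\<bar>e + h\<bar> < h0" if "dist h 0 < h0 - \<bar>e\<bar>" for h using that by (simp add: dist_real_def)
    moreover have "h0 - \<bar>e\<bar> > 0" using e by simp
    ultimately show ?thesis unfolding eventually_at by blast
  qed
  have onK: "\<forall>\<^sub>F h in at 0. \<forall>r\<in>K. qv (e + h) r \<in> fst d \<and>
      path_coords a b d (varied (e + h)) r = path_transition c d (Y h r)"
    using ul(1) small
  proof eventually_elim
    case (elim h)
    show ?case
    proof
      fix r assume r: "r \<in> K"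
      have r1: "r \<in> T1" using r K by blast
      have Yr: "path_coords a b c (varied (e + h)) r = Y h r"
        using varied_coords[OF r1] chart_variation.varied_coords[OF chart_variation_axioms elim(2) r1]
        by (simp add: Y_def scaleR_add_left add.assoc)
      \<comment> \<open>The chain rule also keeps the coordinates in the overlap for small h;
        injectivity of the chart \<open>c\<close> then places the perturbed point itself in
        \<open>d\<close>.\<close>
      have "snd c (qv (e + h) r) \<in> overlap c d"
      proof -
        have "Y h r \<in> overlap c d \<times> UNIV" using elim(1) r by blast
        then have "fst (Y h r) \<in> overlap c d" by (rule mem_Times_iff[THEN iffD1, THEN conjunct1])
        then show ?thesis by (simp only: Yr[symmetric] varied_def path_coords.simps fst_conv)
      qed
      then obtain q' where q': "snd c (qv (e + h) r) = snd c q'" "q' \<in> fst c" "q' \<in> fst d" by blast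
      have "qv (e + h) r = q'"
        using arg_cong[OF q'(1), of "chart_inv c"] q'(2) c
          chart_variation.qv_coords(1)[OF chart_variation_axioms elim(2) r1] by simp
      then have in_d: "qv (e + h) r \<in> fst d" using q'(3) by simp
      have "path_coords a b d (varied (e + h)) r = path_transition c d (path_coords a b c (varied (e + h)) r)"
        unfolding varied_def using r K in_d chart_variation.qv_coords(1)[OF chart_variation_axioms elim(2) r1]
        by (intro path_coords_change[OF chart_variation.varied_path[OF chart_variation_axioms elim(2), unfolded varied_def] c d]) auto
      then show "qv (e + h) r \<in> fst d \<and> path_coords a b d (varied (e + h)) r = path_transition c d (Y h r)"
        using in_d Yr by simp
    qed
  qed
  have off: "\<forall>\<^sub>F h in at 0. \<forall>r\<in>{\<sigma>..\<theta>} - K. qv (e + h) r \<in> fst d \<and>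
      path_coords a b d (varied (e + h)) r = path_coords a b d (varied e) r"
    using small
  proof eventually_elim
    case (elim h)
    show ?case
    proof
      fix r assume r: "r \<in> {\<sigma>..\<theta>} - K"
      then have r2: "r \<in> {a..b}" "r \<notin> {s<..<t}" using \<sigma>\<theta> by (auto simp: K_def)
      have qr: "q r \<in> fst d" using qd r varied_outside(1)[OF r2] by force
      show "qv (e + h) r \<in> fst d \<and> path_coords a b d (varied (e + h)) r = path_coords a b d (varied e) r"
        using chart_variation.varied_outside(1)[OF chart_variation_axioms elim r2]
          chart_variation.varied_coords_outside[OF chart_variation_axioms elim r2 d qr]
          varied_coords_outside[OF r2 d qr] qr by simp
    qed
  qed
  have un: "{\<sigma>..\<theta>} = K \<union> ({\<sigma>..\<theta>} - K)" using K by blast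
  have ev: "\<forall>\<^sub>F h in at 0. fst (varied (e + h)) ` {\<sigma>..\<theta>} \<subseteq> fst d"
    using onK off by eventually_elim (use un in \<open>auto simp: varied_def\<close>)
  have limit_K: "path_transition' c d (path_coords a b c (varied e) r) (k r) = variation_coords a b d (variation e) r"
    if "r \<in> K" for r
  proof -
    have r1: "r \<in> T1" using that K by blast
    show ?thesis
      using variation_coords_change[OF P' variation_tangent[unfolded varT variation_def] c d KT[OF that]]
        variation_coords_T1[OF r1] by (simp add: varT variation_def k_def)
  qed
  have l1: "uniform_limit K (\<lambda>h r. (path_coords a b d (varied (e + h)) r - path_coords a b d (varied e) r) /\<^sub>R h)
      (variation_coords a b d (variation e)) (at 0)"
  proof (rule uniform_limit_cong[THEN iffD1, OF _ _ ul(2)])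
    have "path_coords a b d (varied e) r = path_transition c d (path_coords a b c (varied e) r)" if "r \<in> K" for r
      unfolding varT using KT[OF that] by (intro path_coords_change[OF P' c d])
    then show "\<forall>\<^sub>F h in at 0. \<forall>r\<in>K. (path_transition c d (Y h r) - path_transition c d (path_coords a b c (varied e) r)) /\<^sub>R h =
        (path_coords a b d (varied (e + h)) r - path_coords a b d (varied e) r) /\<^sub>R h"
      using onK by (auto elim!: eventually_mono)
  qed (rule limit_K)
  have l2: "uniform_limit ({\<sigma>..\<theta>} - K) (\<lambda>h r. (path_coords a b d (varied (e + h)) r - path_coords a b d (varied e) r) /\<^sub>R h)
      (variation_coords a b d (variation e)) (at 0)"
  proof (rule uniform_limit_cong[THEN iffD1, OF _ _ uniform_limit_const[where c = "\<lambda>_. 0"]])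
    show "\<forall>\<^sub>F h in at 0. \<forall>r\<in>{\<sigma>..\<theta>} - K. 0 = (path_coords a b d (varied (e + h)) r - path_coords a b d (varied e) r) /\<^sub>R h"
      using off by (auto elim!: eventually_mono)
    show "0 = variation_coords a b d (variation e) r" if "r \<in> {\<sigma>..\<theta>} - K" for r
      using that \<sigma>\<theta> by (intro variation_coords_T2[symmetric]) (auto simp: K_def)
  qed
  show "(\<forall>\<^sub>F h in at 0. fst (varied (e + h)) ` {\<sigma>..\<theta>} \<subseteq> fst d) \<and>
      uniform_limit {\<sigma>..\<theta>} (\<lambda>h r. (path_coords a b d (varied (e + h)) r - path_coords a b d (varied e) r) /\<^sub>R h)
        (variation_coords a b d (variation e)) (at 0)"
    using ev uniform_limit_on_Un[OF l1 l2] un by simp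
qed

end

lemma varied_0: "varied 0 = (q, v, p)"
proof -
  have "qv 0 r = q r \<and> vv 0 r = v r \<and> pv 0 r = p r" for r
  proof (cases "r \<in> T1")
    case True
    then have ch: "c \<in> charts_at A (q r)" using c by (simp add: charts_at_def)
    have "qv 0 r = q r" using True chart_inv_chart[OF c] by (simp add: qv_def)
    then show ?thesis
      using True tangent_of_coords_eq[OF path_tangent[OF P] ch] cotangent_of_coords_eq[OF path_cotangent[OF P] ch]
      by (simp add: vv_def pv_def)
  qed (auto simp: qv_def vv_def pv_def)
  then show ?thesis by (auto simp: varied_def)
qed

lemma path_family_varied: "path_family A a b q1 q2 (q, v, p) (variation 0) varied"
  unfolding path_family_def
  using h0(1) varied_path variation_tangent varied_has_path_derivative varied_0
  by (intro conjI exI[of _ h0]) auto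

end

section \<open>Critical points solve the equations\<close>

context hp_system
begin

text \<open>The density at r sees a path only through its quadruple in one chart, so paths that
  agree to first order at r can be compared there even if they differ at times nearby.\<close>

lemma density_eq_if_path_coords_eq:
  assumes P: "(q, v, p) \<in> path_space A a b q1 q2" and P': "(q', v', p') \<in> path_space A a b q1' q2'"
    and c: "c \<in> A" "r \<in> chart_times q c" "r \<in> chart_times q' c"
    and eq: "path_coords a b c (q, v, p) r = path_coords a b c (q', v', p') r"
  shows "density (q, v, p) r = density (q', v', p') r"
  unfolding density_coords[OF P c(1,2)] density_coords[OF P' c(1,3)] eq using eq by simp

text \<open>Along the constructed family only the action over [s,t] depends on the parameter, and
  the boundary term at t drops out because \<xi> vanishes there. What remains is the first variation
  tested with the prescribed fields.\<close>

lemma critical_weak_form: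
  assumes V: "chart_variation A a b q v p q1 q2 c s t \<xi> \<eta> \<alpha> \<beta>"
    and crit: "critical_point A a b q1 q2 (hp_action A a b L m \<gamma> w) (q, v, p)"
  shows "(\<Sum>j\<in>Basis. integral {s..t} (\<lambda>r. (p r c \<bullet> j - balance s c q v j r) * (\<eta> r \<bullet> j))
       + integral {s..t} (\<lambda>r. (\<l>' c (snd c (q r), v r c) (0, j) - p r c \<bullet> j) * (\<alpha> r \<bullet> j))
       + integral {s..t} (\<lambda>r. (vector_derivative (\<lambda>t. snd c (q t)) (at r within {a..b}) \<bullet> j - v r c \<bullet> j) * (\<beta> r \<bullet> j))) = 0"
    (is "?D = 0")
proof -
  interpret V: chart_variation A a b q v p q1 q2 c s t \<xi> \<eta> \<alpha> \<beta> by (rule V)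
  have zero: "\<bar>0::real\<bar> < V.h0" using V.h0(1) by simp
  have st: "a \<le> s" "s \<le> t" "t \<le> b" using V.st by auto
  obtain \<delta>q \<delta>v \<delta>p where \<delta>_eq: "V.variation 0 = (\<delta>q, \<delta>v, \<delta>p)" by (cases "V.variation 0")
  have \<delta>: "(\<delta>q, \<delta>v, \<delta>p) \<in> path_tangent_space A a b (q, v, p)"
    using V.variation_tangent[OF zero] by (simp only: \<delta>_eq V.varied_0)
  have coords: "\<delta>q r c = \<xi> r" "vector_derivative (\<lambda>t. \<delta>q t c) (at r within {a..b}) = \<eta> r" "\<delta>v r c = \<alpha> r" "\<delta>p r c = \<beta> r"
    if "r \<in> {s..t}" for r
    using V.variation_coords_T1[OF zero, of r] V.st_T1 that by (auto simp: \<delta>_eq)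
  have \<xi>t: "\<xi> t = 0" using V.supp[of t] V.st by simp
  have pa: "((\<lambda>h. partial_action s t (V.varied h)) has_real_derivative ?D) (at 0)"
  proof -
    let ?y = "\<lambda>r. vector_derivative (\<lambda>t. snd c (q t)) (at r within {a..b})"
      and ?\<eta> = "\<lambda>r. vector_derivative (\<lambda>t. \<delta>q t c) (at r within {a..b})"
    have j: "balance s c q v j t * (\<delta>q t c \<bullet> j)
       + integral {s..t} (\<lambda>r. (p r c \<bullet> j - balance s c q v j r) * (?\<eta> r \<bullet> j))
       + integral {s..t} (\<lambda>r. (\<l>' c (snd c (q r), v r c) (0, j) - p r c \<bullet> j) * (\<delta>v r c \<bullet> j))
       + integral {s..t} (\<lambda>r. (?y r \<bullet> j - v r c \<bullet> j) * (\<delta>p r c \<bullet> j))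
       = integral {s..t} (\<lambda>r. (p r c \<bullet> j - balance s c q v j r) * (\<eta> r \<bullet> j))
       + integral {s..t} (\<lambda>r. (\<l>' c (snd c (q r), v r c) (0, j) - p r c \<bullet> j) * (\<alpha> r \<bullet> j))
       + integral {s..t} (\<lambda>r. (?y r \<bullet> j - v r c \<bullet> j) * (\<beta> r \<bullet> j))" for j
    proof -
      have "balance s c q v j t * (\<delta>q t c \<bullet> j) = 0" using coords(1)[of t] \<xi>t st by simp
      then show ?thesis
        by (simp only: add_0) (intro arg_cong2[where f = "(+)"] integral_cong; simp only: coords)
    qed
    have der: "has_path_derivative A a b V.varied (\<delta>q, \<delta>v, \<delta>p) 0"
      using V.varied_has_path_derivative[OF zero] by (simp only: \<delta>_eq)
    from partial_action_has_derivative[OF V.varied_path V.h0(1) V.varied_0 \<delta> der V.c st V.qc]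
    show ?thesis by (simp only: j)
  qed
  \<comment> \<open>The intervals touch s and t, where the perturbed path still has the original
    quadruple, so the densities agree up to and including these ends.\<close>
  have outer: "partial_action \<sigma> \<theta> (V.varied h) = partial_action \<sigma> \<theta> (q, v, p)"
    if h: "\<bar>h\<bar> < V.h0" and \<sigma>\<theta>: "a \<le> \<sigma>" "\<sigma> \<le> \<theta>" "\<theta> \<le> b" "\<theta> \<le> s \<or> t \<le> \<sigma>" for h \<sigma> \<theta>
  proof -
    have out: "r \<in> {a..b}" "r \<notin> {s<..<t}" if "r \<in> {\<sigma>..\<theta>}" for r using that \<sigma>\<theta> by auto
    have "density (V.varied h) r = density (q, v, p) r" if "r \<in> {\<sigma>..\<theta>}" for r
    proof -
      obtain d where d: "d \<in> A" "q r \<in> fst d" using ex_chart[of "q r"] by (auto simp: charts_at_def)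
      show ?thesis
        unfolding V.varied_def
        using V.varied_coords_outside[OF h out[OF that] d] V.varied_outside(1)[OF h out[OF that]] d out(1)[OF that]
        by (intro density_eq_if_path_coords_eq[OF V.varied_path[OF h, unfolded V.varied_def] V.P d(1)])
          (auto simp: V.varied_def)
    qed
    then have "integral {\<sigma>..\<theta>} (density (V.varied h)) = integral {\<sigma>..\<theta>} (density (q, v, p))"
      by (rule integral_cong)
    moreover have "V.qv h \<sigma> = q \<sigma>" "V.qv h \<theta> = q \<theta>"
      using V.varied_outside(1)[OF h out] \<sigma>\<theta> by auto
    ultimately show ?thesis by (simp add: partial_action_def V.varied_def)
  qed
  define K where "K = partial_action a s (q, v, p) + partial_action t b (q, v, p)"
  have "\<forall>\<^sub>F h in nhds 0. \<bar>h\<bar> < V.h0"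
    using V.h0(1) by (auto simp: eventually_nhds_metric dist_real_def)
  then have ev: "\<forall>\<^sub>F h in nhds 0. hp_action A a b L m \<gamma> w (V.varied h) = partial_action s t (V.varied h) + K"
  proof eventually_elim
    case (elim h)
    note P = V.varied_path[OF elim, unfolded V.varied_def]
    have "hp_action A a b L m \<gamma> w (V.varied h) = partial_action a b (V.varied h)"
      unfolding V.varied_def by (rule hp_action_eq_partial_action[OF P])
    also have "\<dots> = partial_action a s (V.varied h) + (partial_action s t (V.varied h) + partial_action t b (V.varied h))"
      unfolding V.varied_def using st
      by (simp add: partial_action_combine[OF P, of a s b] partial_action_combine[OF P, of s t b])
    finally show ?case
      using outer[OF elim, of a s] outer[OF elim, of t b] st by (simp add: K_def)
  qed
  have "((\<lambda>h. hp_action A a b L m \<gamma> w (V.varied h)) has_real_derivative 0) (at 0)"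
    using crit \<delta> V.path_family_varied
    unfolding critical_point_def has_path_differential_def \<delta>_eq by blast
  then have "((\<lambda>h. partial_action s t (V.varied h) + K) has_real_derivative 0) (at 0)"
    using DERIV_cong_ev[OF refl ev refl] by blast
  moreover have "((\<lambda>h. partial_action s t (V.varied h) + K) has_real_derivative ?D) (at 0)"
    using DERIV_add[OF pa DERIV_const[of K]] by simp
  ultimately show ?thesis using DERIV_unique by blast
qed

context
  fixes q v p q1 q2 c s t
  assumes P: "(q, v, p) \<in> path_space A a b q1 q2"
    and crit: "critical_point A a b q1 q2 (hp_action A a b L m \<gamma> w) (q, v, p)"
    and c: "c \<in> A" and st: "a \<le> s" "s < t" "t \<le> b" and qc: "q ` {s..t} \<subseteq> fst c"
begin

text \<open>Varying the momentum alone leaves only the kinematic constraint in the weak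
  form.\<close>

lemma critical_velocity:
  assumes "r \<in> {s..t}"
  shows "vector_derivative (\<lambda>t. snd c (q t)) (at r within {a..b}) = v r c"
proof (rule euclidean_eqI)
  fix j :: 'e assume j: "j \<in> Basis"
  let ?y = "\<lambda>r. vector_derivative (\<lambda>t. snd c (q t)) (at r within {a..b})"
  note curve = coordinate_curve[OF P c st(1) less_imp_le[OF st(2)] st(3) qc]
  have "?y r \<bullet> j - v r c \<bullet> j = 0"
  proof (rule vanishing_coefficients[OF st j, where H = "\<lambda>k r. ?y r \<bullet> k - v r c \<bullet> k"])
    show "continuous_on {s..t} (\<lambda>r. ?y r \<bullet> j - v r c \<bullet> j)"
      using curve(4,5) by (intro continuous_intros) auto
    fix \<beta> :: "real \<Rightarrow> 'e" assume "continuous_on {a..b} \<beta>" "\<And>r. r \<notin> {s<..<t} \<Longrightarrow> \<beta> r = 0"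
    then have "chart_variation A a b q v p q1 q2 c s t (\<lambda>_. 0) (\<lambda>_. 0) (\<lambda>_. 0) \<beta>"
      using P c st qc by unfold_locales auto
    from critical_weak_form[OF this crit]
    show "(\<Sum>k\<in>Basis. integral {s..t} (\<lambda>r. (?y r \<bullet> k - v r c \<bullet> k) * (\<beta> r \<bullet> k))) = 0" by simp
  qed (rule assms)
  then show "?y r \<bullet> j = v r c \<bullet> j" by simp
qed

text \<open>Varying the velocity variable alone leaves only the difference between the fibre
  derivative of the Lagrangian and the momentum.\<close>

lemma critical_legendre:
  assumes "r \<in> {s..t}" and j: "j \<in> Basis"
  shows "\<l>' c (snd c (q r), v r c) (0, j) = p r c \<bullet> j"
proof -
  note curve = coordinate_curve[OF P c st(1) less_imp_le[OF st(2)] st(3) qc]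
  interpret C: coordinate_action "coord_dom c" "\<l> c" "\<l>' c" m "g c" "g' c" "g2 c" w s t
    using st c by (intro coordinate_action) auto
  have "\<l>' c (snd c (q r), v r c) (0, j) - p r c \<bullet> j = 0"
  proof (rule vanishing_coefficients[OF st j, where H = "\<lambda>k r. \<l>' c (snd c (q r), v r c) (0, k) - p r c \<bullet> k"])
    show "continuous_on {s..t} (\<lambda>r. \<l>' c (snd c (q r), v r c) (0, j) - p r c \<bullet> j)"
      by (intro continuous_intros curve(6) C.continuous_partial_lagrangian[OF curve(1,2,4,5,6)])
    fix \<alpha> :: "real \<Rightarrow> 'e" assume "continuous_on {a..b} \<alpha>" "\<And>r. r \<notin> {s<..<t} \<Longrightarrow> \<alpha> r = 0"
    then have "chart_variation A a b q v p q1 q2 c s t (\<lambda>_. 0) (\<lambda>_. 0) \<alpha> (\<lambda>_. 0)"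
      using P c st qc by unfold_locales auto
    from critical_weak_form[OF this crit]
    show "(\<Sum>k\<in>Basis. integral {s..t} (\<lambda>r. (\<l>' c (snd c (q r), v r c) (0, k) - p r c \<bullet> k) * (\<alpha> r \<bullet> k))) = 0"
      by simp
  qed (rule assms)
  then show ?thesis by simp
qed

text \<open>Now the base curve is varied in the direction j, with \<eta> given by a test function of
  mean zero and \<xi> by its primitive. This yields that p - E is constant on [s,t]; the value E(s)
  = 0 identifies the constant as p(s).\<close>

lemma critical_momentum:
  assumes j: "j \<in> Basis"
  shows "p t c \<bullet> j - p s c \<bullet> j = balance s c q v j t"
proof -
  note curve = coordinate_curve[OF P c st(1) less_imp_le[OF st(2)] st(3) qc]
  interpret C: coordinate_action "coord_dom c" "\<l> c" "\<l>' c" m "g c" "g' c" "g2 c" w s t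
    using st c by (intro coordinate_action) auto
  have "p t c \<bullet> j - balance s c q v j t = p s c \<bullet> j - balance s c q v j s"
  proof (rule du_bois_reymond[OF st(2)])
    show "continuous_on {s..t} (\<lambda>r. p r c \<bullet> j - balance s c q v j r)"
      by (intro continuous_intros curve(6) C.continuous_momentum_balance[OF curve(1,2,4,5,6)])
    show "t \<in> {s..t}" using st by simp
    fix \<psi> :: "real \<Rightarrow> real" assume \<psi>: "continuous_on {s..t} \<psi>" "\<psi> s = 0" "\<psi> t = 0" "integral {s..t} \<psi> = 0"
    define \<Psi> where "\<Psi> r = \<psi> (max s (min r t))" for r
    have c\<Psi>: "continuous_on {a..b} \<Psi>"
      unfolding \<Psi>_def using st by (intro continuous_on_clamp[OF \<psi>(1)]) simp
    have \<Psi>0: "\<Psi> r = 0" if "r \<notin> {s<..<t}" for r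
      using that st \<psi>(2,3) by (auto simp: \<Psi>_def max_def min_def)
    have \<Psi>: "\<Psi> r = \<psi> r" if "r \<in> {s..t}" for r using that by (auto simp: \<Psi>_def max_def min_def)
    \<comment> \<open>The zero mean of \<psi> makes this primitive vanish again from t on, so the
      variation is supported in [s,t].\<close>
    define \<Phi> where "\<Phi> r = integral {a..r} \<Psi>" for r
    have der: "(\<Phi> has_vector_derivative \<Psi> r) (at r within {a..b})" if "r \<in> {a..b}" for r
      unfolding \<Phi>_def by (rule integral_has_vector_derivative[OF c\<Psi> that])
    have \<Phi>0: "\<Phi> r = 0" if "r \<in> {a..b}" "r \<notin> {s<..<t}" for r
    proof (cases "r \<le> s")
      case True
      then have "integral {a..r} \<Psi> = integral {a..r} (\<lambda>_. 0)" using \<Psi>0 by (intro integral_cong) auto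
      then show ?thesis by (simp add: \<Phi>_def)
    next
      case False
      then have tr: "t \<le> r" using that by auto
      have int: "\<Psi> integrable_on {a..r}"
        using that by (intro integrable_continuous_real continuous_on_subset[OF c\<Psi>]) auto
      have int': "\<Psi> integrable_on {a..t}"
        using st by (intro integrable_continuous_real continuous_on_subset[OF c\<Psi>]) auto
      have "integral {a..r} \<Psi> = integral {a..t} \<Psi> + integral {t..r} \<Psi>"
        using Henstock_Kurzweil_Integration.integral_combine[OF _ tr int] st by simp
      also have "integral {a..t} \<Psi> = integral {a..s} \<Psi> + integral {s..t} \<Psi>"
        using Henstock_Kurzweil_Integration.integral_combine[OF st(1) less_imp_le[OF st(2)] int'] by simp
      also have "integral {a..s} \<Psi> = integral {a..s} (\<lambda>_. 0)" using \<Psi>0 by (intro integral_cong) auto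
      also have "integral {t..r} \<Psi> = integral {t..r} (\<lambda>_. 0)" using \<Psi>0 by (intro integral_cong) auto
      also have "integral {s..t} \<Psi> = integral {s..t} \<psi>" by (intro integral_cong \<Psi>)
      finally show ?thesis using \<psi>(4) by (simp add: \<Phi>_def)
    qed
    have "chart_variation A a b q v p q1 q2 c s t (\<lambda>r. \<Phi> r *\<^sub>R j) (\<lambda>r. \<Psi> r *\<^sub>R j) (\<lambda>_. 0) (\<lambda>_. 0)"
    proof unfold_locales
      show "((\<lambda>r. \<Phi> r *\<^sub>R j) has_vector_derivative \<Psi> r *\<^sub>R j) (at r within {a..b})" if "r \<in> {a..b}" for r
        using bounded_linear.has_vector_derivative[OF bounded_linear_scaleR_left der[OF that]] .
      show "continuous_on {a..b} (\<lambda>r. \<Psi> r *\<^sub>R j)" by (intro continuous_intros c\<Psi>)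
    qed (use P c st qc \<Phi>0 \<Psi>0 in auto)
    from critical_weak_form[OF this crit]
    have "(\<Sum>k\<in>Basis. integral {s..t} (\<lambda>r. (p r c \<bullet> k - balance s c q v k r) * (\<Psi> r * (j \<bullet> k)))) = 0"
      by simp
    then have "integral {s..t} (\<lambda>r. (p r c \<bullet> j - balance s c q v j r) * (\<Psi> r * 1)) = 0"
      by (subst (asm) sum_Basis_single[OF j, where f = "\<lambda>k x. integral {s..t} (\<lambda>r. (p r c \<bullet> k - balance s c q v k r) * (\<Psi> r * x))"]) simp_all
    moreover have "integral {s..t} (\<lambda>r. (p r c \<bullet> j - balance s c q v j r) * (\<Psi> r * 1))
        = integral {s..t} (\<lambda>r. (p r c \<bullet> j - balance s c q v j r) * \<psi> r)"
      by (rule integral_cong) (simp add: \<Psi>)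
    ultimately show "integral {s..t} (\<lambda>r. (p r c \<bullet> j - balance s c q v j r) * \<psi> r) = 0" by simp
  qed
  moreover have "balance s c q v j s = 0"
    by (simp add: C.momentum_balance_def rs_integral_refl)
  ultimately show ?thesis by simp
qed

end

text \<open>The variational arguments require s < t, and since a < b such an interval exists also
  around the end points r = a and r = b.\<close>

lemma ex_chart_interval:
  assumes "continuous_on {a..b} q" "c \<in> A" "r \<in> chart_times q c"
  shows "\<exists>s t. a \<le> s \<and> s < t \<and> t \<le> b \<and> r \<in> {s..t} \<and> q ` {s..t} \<subseteq> fst c"
proof -
  from openin_times[OF assms(1,2)] assms(3) obtain d where d: "d > 0"
    "\<And>r'. r' \<in> {a..b} \<Longrightarrow> dist r' r < d \<Longrightarrow> r' \<in> chart_times q c"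
    unfolding openin_euclidean_subtopology_iff by blast
  let ?s = "max a (r - d / 2)" and ?t = "min b (r + d / 2)"
  have "q ` {?s..?t} \<subseteq> fst c"
  proof clarify
    fix r' assume "r' \<in> {?s..?t}"
    then have "r' \<in> {a..b}" "dist r' r < d" using d(1) by (auto simp: dist_real_def abs_if)
    from d(2)[OF this] show "q r' \<in> fst c" by simp
  qed
  moreover have "a \<le> ?s" "?s < ?t" "?t \<le> b" "r \<in> {?s..?t}" using d(1) ab assms(3) by auto
  ultimately show ?thesis by blast
qed

text \<open>The velocity and Legendre conditions are pointwise and are read off on a short interval
  around each time. The momentum equation concerns every interval spent in a chart, and the
  variation is taken on that interval itself.\<close>

lemma critical_imp_hp_equations:
  assumes P: "(q, v, p) \<in> path_space A a b q1 q2"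
    and crit: "critical_point A a b q1 q2 (hp_action A a b L m \<gamma> w) (q, v, p)"
  shows "hp_equations A a b L m \<gamma> w (q, v, p)"
  unfolding hp_equations.simps
proof (intro conjI ballI allI impI)
  fix r assume r: "r \<in> {a..b}"
  have local: "vector_derivative (\<lambda>t. snd c (q t)) (at r within {a..b}) = v r c \<and>
      (\<forall>j\<in>Basis. \<l>' c (snd c (q r), v r c) (0, j) = p r c \<bullet> j)" if "c \<in> charts_at A (q r)" for c
  proof -
    have c: "c \<in> A" "r \<in> chart_times q c" using that r by (auto simp: charts_at_def)
    from ex_chart_interval[OF path_continuous[OF P] c] obtain s t where
      st: "a \<le> s" "s < t" "t \<le> b" "r \<in> {s..t}" "q ` {s..t} \<subseteq> fst c" by blast
    show ?thesis
      using critical_velocity[OF P crit c(1) st(1-3,5,4)] critical_legendre[OF P crit c(1) st(1-3,5,4)] by blast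
  qed
  show "velocity A a b q r = v r"
  proof
    fix c
    show "velocity A a b q r c = v r c"
      using local[of c] tangent_spaceD(2)[OF path_tangent[OF P r], of c] by (simp add: velocity_def)
  qed
  show "p r = fibre_derivative A L (q r) (v r)"
  proof
    fix c
    show "p r c = fibre_derivative A L (q r) (v r) c"
    proof (cases "c \<in> charts_at A (q r)")
      case True
      have "(\<Sum>j\<in>Basis. \<l>' c (snd c (q r), v r c) (0, j) *\<^sub>R j) = (\<Sum>j\<in>Basis. (p r c \<bullet> j) *\<^sub>R j)"
        using local[OF True] by (intro sum.cong refl) simp
      then show ?thesis using True by (simp add: fibre_derivative_def euclidean_representation)
    next
      case False
      then show ?thesis using cotangent_spaceD(2)[OF path_cotangent[OF P r]] by (simp add: fibre_derivative_def)
    qed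
  qed
next
  fix c s t and j :: 'e
  assume c: "c \<in> A" and st: "a \<le> s \<and> s \<le> t \<and> t \<le> b \<and> q ` {s..t} \<subseteq> fst c" and j: "j \<in> Basis"
  interpret C: coordinate_action "coord_dom c" "\<l> c" "\<l>' c" m "g c" "g' c" "g2 c" w s t
    using st c by (intro coordinate_action) auto
  have "p t c \<bullet> j - p s c \<bullet> j = balance s c q v j t"
  \<comment> \<open>A degenerate interval carries no variation; there both sides are 0.\<close>
  proof (cases "s = t")
    case False
    then show ?thesis using critical_momentum[OF P crit c, of s t j] st j by simp
  next
    case True
    then show ?thesis unfolding C.momentum_balance_def by (simp add: rs_integral_refl)
  qed
  then show "p t c \<bullet> j - p s c \<bullet> j =
      integral {s..t} (\<lambda>r. \<l>' c (snd c (q r), v r c) (j, 0)) +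
      (\<Sum>i=1..m. rs_integral s t (\<lambda>r. g' c i (snd c (q r)) j) (w i))"
    by (simp add: C.momentum_balance_def)
qed

end

theorem mainTheorem1:
  fixes A R :: "('q::t2_space, 'e::euclidean_space) chart set"
    and a b :: real and q1 q2 :: 'q
    and M :: "'w measure" and F :: "real \<Rightarrow> 'w measure"
    and m :: nat and W :: "nat \<Rightarrow> real \<Rightarrow> 'w \<Rightarrow> real"
    and L :: "'q \<times> ('q, 'e) fibre \<Rightarrow> real" and \<gamma> :: "nat \<Rightarrow> 'q \<Rightarrow> real"
  assumes "paracompact_smooth_manifold A"
    and "R \<subseteq> A" and "(\<Union>c\<in>R. fst c) = UNIV"
    and "a < b"
    and "prob_space M"
    and "filtration_on M a b F"
    and "\<forall>i\<in>{1..m}. wiener_process M a b (W i)"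
    and "independent_processes M a b W {1..m}"
    and "\<forall>i\<in>{1..m}. \<forall>t\<in>{a..b}. W i t \<in> borel_measurable (F t)"
    and "C2_lagrangian A L"
    and "globally_lipschitz_derivs_lagrangian A R L"
    and "\<forall>i\<in>{1..m}. C2_function A (\<gamma> i)"
    and "\<forall>i\<in>{1..m}. globally_lipschitz_derivs R (\<gamma> i)"
  shows "AE \<omega> in M. \<forall>c\<in>path_space A a b q1 q2.
           hp_equations A a b L m \<gamma> (\<lambda>i t. W i t \<omega>) c \<longleftrightarrow>
           critical_point A a b q1 q2 (hp_action A a b L m \<gamma> (\<lambda>i t. W i t \<omega>)) c"
proof -
  \<comment> \<open>One null set serves all curves: it only has to cover the finitely many events on
    which a noise path is discontinuous. The rest is deterministic for fixed \<omega>, which is why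
    the curve may depend on \<omega>.\<close>
  have "AE \<omega> in M. \<forall>i\<in>{1..m}. continuous_on {a..b} (\<lambda>t. W i t \<omega>)"
    using assms(7) by (intro AE_finite_allI) (auto simp: wiener_process_def)
  then show ?thesis
  proof eventually_elim
    case (elim \<omega>)
    interpret hp_system A a b L m \<gamma> "\<lambda>i t. W i t \<omega>"
      using assms elim by unfold_locales (auto simp: paracompact_smooth_manifold_def)
    show ?case
    proof
      fix c assume "c \<in> path_space A a b q1 q2"
      then show "hp_equations A a b L m \<gamma> (\<lambda>i t. W i t \<omega>) c \<longleftrightarrow>
          critical_point A a b q1 q2 (hp_action A a b L m \<gamma> (\<lambda>i t. W i t \<omega>)) c"
        using hp_equations_imp_critical critical_imp_hp_equations by (cases c) blast
    qed
  qed
qed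

end
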